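(* Let $\alpha>0$, $a>0$, $b>0$ be constants, let $W\ge 0$ be a random variable such that for some $x_0>0$, $\mathbb{P}(W>x)=a x^{-\alpha}$ for all $x\ge x_0$, and let $G(n,\alpha)$ be the random graph on $\{1,\dots,n\}$ with i.i.d. vertex weights $W_1,\dots,W_n$ distributed as $W$ in which, conditionally on the weights, distinct vertices $i,j$ are joined independently with probability $1-\exp(-bW_iW_j/n)$. Then there exists an algorithm which, given $G(n,\alpha)$ together with its vertex weights, with high probability finds in $G(n,\alpha)$ a clique of size $(1+o(1))\,\omega(G(n,\alpha))$ in time polynomial in $n$. That is, there are an algorithm, a polynomial $q$ and a sequence $\varepsilon_n\to0$ such that, with probability tending to $1$ as $n\to\infty$, the algorithm outputs within $q(n)$ steps a clique $\mathcal{K}$ of $G(n,\alpha)$ with $|\mathcal{K}|\ge(1-\varepsilon_n)\,\omega(G(n,\alpha))$.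
   Context: The model: each vertex $i\in\{1,\dots,n\}$ gets a weight $W_i$; the $W_i$ are i.i.d. copies of a nonnegative random variable $W$ with $\mathbb{P}(W>x)=ax^{-\alpha}$ for $x\ge x_0$, where $a,\alpha,x_0>0$ are constants (the distribution below $x_0$ is arbitrary). Conditionally on the weights, each pair $\{i,j\}$ with $1\le i<j\le n$ is joined by an edge with probability $p_{ij}=1-\exp(-\lambda_{ij})$, $\lambda_{ij}=bW_iW_j/n$, independently for all pairs, where $b>0$ is a constant. The resulting simple graph is $G(n,\alpha)$. The constants and the distribution of $W$ are fixed and $n\to\infty$. $\omega(G)$ is the number of vertices in a largest clique (set of pairwise adjacent vertices) of $G$. "With high probability" means with probability tending to $1$ as $n\to\infty$. The comparison of two weights and the test of whether two vertices are adjacent each count as one elementary step. *)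

theory Defs
  imports "HOL-Probability.Probability" "HOL-Computational_Algebra.Polynomial"
begin

section \<open>The random graph\<close>

text \<open>
  A graph on \<open>{1..n}\<close> is encoded by a Boolean function on the pairs \<open>(i, j)\<close> with
  \<open>i < j\<close>; the values of the function at all other arguments are ignored.
\<close>

definition vertex_pairs :: "nat \<Rightarrow> (nat \<times> nat) set" where
  "vertex_pairs n = {(i, j). 1 \<le> i \<and> i < j \<and> j \<le> n}"

definition adjacent :: "nat \<Rightarrow> (nat \<times> nat \<Rightarrow> bool) \<Rightarrow> nat \<Rightarrow> nat \<Rightarrow> bool" where
  "adjacent n E i j \<longleftrightarrow>
     (i, j) \<in> vertex_pairs n \<and> E (i, j) \<or> (j, i) \<in> vertex_pairs n \<and> E (j, i)"

definition is_clique :: "nat \<Rightarrow> (nat \<times> nat \<Rightarrow> bool) \<Rightarrow> nat set \<Rightarrow> bool" where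
  "is_clique n E K \<longleftrightarrow> K \<subseteq> {1..n} \<and> (\<forall>i\<in>K. \<forall>j\<in>K. i \<noteq> j \<longrightarrow> adjacent n E i j)"

definition clique_number :: "nat \<Rightarrow> (nat \<times> nat \<Rightarrow> bool) \<Rightarrow> nat" where
  "clique_number n E = Max (card ` {K. is_clique n E K})"

text \<open>The conditional law of the edges given the weights \<open>w\<close>.\<close>

definition edges_pmf :: "real \<Rightarrow> nat \<Rightarrow> (nat \<Rightarrow> real) \<Rightarrow> (nat \<times> nat \<Rightarrow> bool) pmf" where
  "edges_pmf b n w =
     Pi_pmf (vertex_pairs n) False
       (\<lambda>(i, j). bernoulli_pmf (1 - exp (- (b * w i * w j / real n))))"

definition graph_space :: "nat \<Rightarrow> ((nat \<Rightarrow> real) \<times> (nat \<times> nat \<Rightarrow> bool)) measure" where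
  "graph_space n = (\<Pi>\<^sub>M i\<in>{1..n}. borel) \<Otimes>\<^sub>M count_space UNIV"

text \<open>
  The joint law of the weights and the graph, where \<open>D\<close> is the law of a single weight:
  first the weights are drawn independently from \<open>D\<close>, then the edges given the weights.
\<close>

definition weighted_graph ::
  "real measure \<Rightarrow> real \<Rightarrow> nat \<Rightarrow> ((nat \<Rightarrow> real) \<times> (nat \<times> nat \<Rightarrow> bool)) measure" where
  "weighted_graph D b n =
     (\<Pi>\<^sub>M i\<in>{1..n}. D) \<bind> (\<lambda>w.
       measure_pmf (edges_pmf b n w) \<bind> (\<lambda>E. return (graph_space n) (w, E)))"

text \<open>
  \<^const>\<open>bind\<close> is only meaningful for measurable kernels. The following facts show that
  the kernels above are measurable, so that the joint law is the intended one.
\<close>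

lemma finite_vertex_pairs [simp]: "finite (vertex_pairs n)"
  by (rule finite_subset[of _ "{1..n} \<times> {1..n}"]) (auto simp: vertex_pairs_def)

lemma pmf_bernoulli_clamp:
  "pmf (bernoulli_pmf p) x = (if x then max 0 (min 1 p) else 1 - max 0 (min 1 p))"
  by (cases x) (simp_all add: bernoulli_pmf.rep_eq)

lemma measurable_pmf_edges:
  "(\<lambda>w. pmf (edges_pmf b n w) E) \<in> borel_measurable (\<Pi>\<^sub>M i\<in>{1..n}. borel)"
proof -
  have w [measurable]: "(\<lambda>w. w i) \<in> borel_measurable (\<Pi>\<^sub>M i\<in>{1..n}. (borel :: real measure))"
    if "i \<in> {1..n}" for i
    using that by (rule measurable_component_singleton)
  have "(\<lambda>w. pmf (bernoulli_pmf (1 - exp (- (b * w i * w j / real n)))) (E (i, j)))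
          \<in> borel_measurable (\<Pi>\<^sub>M i\<in>{1..n}. borel)" if "(i, j) \<in> vertex_pairs n" for i j
  proof -
    have [measurable]: "(\<lambda>w. w i) \<in> borel_measurable (\<Pi>\<^sub>M i\<in>{1..n}. (borel :: real measure))"
      "(\<lambda>w. w j) \<in> borel_measurable (\<Pi>\<^sub>M i\<in>{1..n}. (borel :: real measure))"
      using that by (auto intro!: w simp: vertex_pairs_def)
    show ?thesis
      unfolding pmf_bernoulli_clamp by measurable
  qed
  then show ?thesis
    unfolding edges_pmf_def pmf_Pi[OF finite_vertex_pairs]
    by (cases "\<forall>x. x \<notin> vertex_pairs n \<longrightarrow> E x = False")
      (simp_all only: if_True if_False, auto intro!: borel_measurable_prod)
qed

lemma measurable_edges_pmf:
  "(\<lambda>w. measure_pmf (edges_pmf b n w))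
     \<in> (\<Pi>\<^sub>M i\<in>{1..n}. borel) \<rightarrow>\<^sub>M prob_algebra (count_space UNIV)"
proof (intro measurable_prob_algebraI measurable_subprob_algebra)
  fix A :: "(nat \<times> nat \<Rightarrow> bool) set"
  define S :: "(nat \<times> nat \<Rightarrow> bool) set" where
    "S = {E. \<forall>x. x \<notin> vertex_pairs n \<longrightarrow> E x = False}"
  have "S \<subseteq> (\<lambda>X p. p \<in> X) ` Pow (vertex_pairs n)"
  proof
    fix E assume "E \<in> S"
    then have "E = (\<lambda>p. p \<in> {p. E p})" "{p. E p} \<in> Pow (vertex_pairs n)"
      by (auto simp: S_def)
    then show "E \<in> (\<lambda>X p. p \<in> X) ` Pow (vertex_pairs n)"
      by blast
  qed
  then have fin: "finite (A \<inter> S)"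
    by (meson finite_Int finite_Pow_iff finite_imageI finite_subset finite_vertex_pairs)
  have "emeasure (measure_pmf (edges_pmf b n w)) A = (\<Sum>E\<in>A \<inter> S. ennreal (pmf (edges_pmf b n w) E))"
    for w
  proof -
    have "set_pmf (edges_pmf b n w) \<subseteq> S"
      unfolding edges_pmf_def S_def by (rule set_Pi_pmf_subset) simp
    then have "emeasure (measure_pmf (edges_pmf b n w)) A =
        emeasure (measure_pmf (edges_pmf b n w)) (A \<inter> S)"
      by (intro emeasure_eq_AE) (auto simp: AE_measure_pmf_iff)
    also have "\<dots> = (\<Sum>E\<in>A \<inter> S. ennreal (pmf (edges_pmf b n w) E))"
      using fin by (simp add: emeasure_measure_pmf_finite sum_ennreal)
    finally show ?thesis .
  qed
  then show "(\<lambda>w. emeasure (measure_pmf (edges_pmf b n w)) A)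
      \<in> borel_measurable (\<Pi>\<^sub>M i\<in>{1..n}. borel)"
    using measurable_pmf_edges by (simp add: borel_measurable_sum)
qed (auto simp: measure_pmf.prob_space_axioms measure_pmf.subprob_space_axioms)

lemma measurable_weighted_edges:
  "(\<lambda>w. measure_pmf (edges_pmf b n w) \<bind> (\<lambda>E. return (graph_space n) (w, E)))
     \<in> (\<Pi>\<^sub>M i\<in>{1..n}. borel) \<rightarrow>\<^sub>M prob_algebra (graph_space n)"
proof (rule measurable_bind_prob_space2[OF measurable_edges_pmf])
  show "(\<lambda>(w, E). return (graph_space n) (w, E))
      \<in> (\<Pi>\<^sub>M i\<in>{1..n}. borel) \<Otimes>\<^sub>M count_space UNIV \<rightarrow>\<^sub>M prob_algebra (graph_space n)"
    using measurable_return_prob_space[of "graph_space n"] by (simp add: graph_space_def)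
qed

lemma weights_in_prob_algebra:
  assumes "prob_space D" "sets D = sets borel"
  shows "(\<Pi>\<^sub>M i\<in>{1..n}. D) \<in> space (prob_algebra (\<Pi>\<^sub>M i\<in>{1..n}. borel))"
  using assms by (auto simp: space_prob_algebra intro!: prob_space_PiM sets_PiM_cong)

lemma prob_space_weighted_graph:
  assumes "prob_space D" "sets D = sets borel"
  shows "prob_space (weighted_graph D b n)"
  unfolding weighted_graph_def
  by (rule prob_space_bind'[OF weights_in_prob_algebra[OF assms] measurable_weighted_edges])

lemma sets_weighted_graph:
  assumes "prob_space D" "sets D = sets borel"
  shows "sets (weighted_graph D b n) = sets (graph_space n)"
  unfolding weighted_graph_def
  by (rule sets_bind'[OF weights_in_prob_algebra[OF assms] measurable_weighted_edges])

lemma emeasure_weighted_graph: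
  assumes "prob_space D" "sets D = sets borel" "X \<in> sets (graph_space n)"
  shows "emeasure (weighted_graph D b n) X =
    (\<integral>\<^sup>+ w. emeasure (measure_pmf (edges_pmf b n w)) {E. (w, E) \<in> X} \<partial>(\<Pi>\<^sub>M i\<in>{1..n}. D))"
proof -
  have "emeasure (measure_pmf (edges_pmf b n w) \<bind> (\<lambda>E. return (graph_space n) (w, E))) X =
      emeasure (measure_pmf (edges_pmf b n w)) {E. (w, E) \<in> X}"
    if "w \<in> space (\<Pi>\<^sub>M i\<in>{1..n}. D)" for w
  proof -
    have w: "w \<in> space (\<Pi>\<^sub>M i\<in>{1..n}. borel)"
      using that assms(2) by (simp add: space_PiM sets_eq_imp_space_eq)
    have "emeasure (measure_pmf (edges_pmf b n w) \<bind> (\<lambda>E. return (graph_space n) (w, E))) X =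
        (\<integral>\<^sup>+ E. emeasure (return (graph_space n) (w, E)) X \<partial>measure_pmf (edges_pmf b n w))"
      using w assms(3)
      by (intro emeasure_bind[where N = "graph_space n"])
        (auto simp: graph_space_def space_pair_measure intro!: return_measurable[THEN measurable_space])
    also have "\<dots> = (\<integral>\<^sup>+ E. indicator {E. (w, E) \<in> X} E \<partial>measure_pmf (edges_pmf b n w))"
      using assms(3) by (intro nn_integral_cong) (auto simp: indicator_def)
    finally show ?thesis
      by simp
  qed
  then show ?thesis
    unfolding weighted_graph_def
    by (subst emeasure_bind_prob_algebra[OF weights_in_prob_algebra[OF assms(1,2)]
          measurable_weighted_edges assms(3)]) (auto intro!: nn_integral_cong)
qed


section \<open>Algorithms\<close>

text \<open>
  Algorithms are structured programs for a random access machine with registers and an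
  addressable memory, both holding natural numbers. The arguments of instructions and tests are
  register numbers, except for the second argument of \<open>LIT\<close>, which is a literal.
  Every instruction and every evaluation of a test costs one step. Multiplication is left out on
  purpose: with addition only, the numbers in use after \<open>t\<close> steps have \<open>O(t + log n)\<close> bits, so that
  counting each step as one unit agrees with Turing machine time up to a polynomial.

  The weights and the graph are accessible only through \<open>LIGHTER\<close> and \<open>ADJACENT\<close>.
\<close>

datatype instr =
    LIT nat nat
  | MOVE nat nat
  | ADD nat nat nat
  | SUB nat nat nat
  | LOAD nat nat
  | STORE nat nat

datatype test =
    LESS nat nat
  | LIGHTER nat nat
  | ADJACENT nat nat

datatype com =
    SKIP
  | INSTR instr
  | SEQ com com
  | COND test com com
  | LOOP test com

text \<open>A state consists of the contents of the registers and the contents of the memory.\<close>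

type_synonym state = "(nat \<Rightarrow> nat) \<times> (nat \<Rightarrow> nat)"

fun run_instr :: "instr \<Rightarrow> state \<Rightarrow> state" where
  "run_instr (LIT i k) (R, M) = (R(i := k), M)"
| "run_instr (MOVE i j) (R, M) = (R(i := R j), M)"
| "run_instr (ADD i j k) (R, M) = (R(i := R j + R k), M)"
| "run_instr (SUB i j k) (R, M) = (R(i := R j - R k), M)"
| "run_instr (LOAD i j) (R, M) = (R(i := M (R j)), M)"
| "run_instr (STORE i j) (R, M) = (R, M(R i := R j))"

text \<open>Tests involving numbers that are not vertices fail, so that they reveal nothing.\<close>

fun holds :: "nat \<Rightarrow> (nat \<Rightarrow> real) \<Rightarrow> (nat \<times> nat \<Rightarrow> bool) \<Rightarrow> test \<Rightarrow> state \<Rightarrow> bool" where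
  "holds n w E (LESS i j) (R, M) \<longleftrightarrow> R i < R j"
| "holds n w E (LIGHTER i j) (R, M) \<longleftrightarrow> R i \<in> {1..n} \<and> R j \<in> {1..n} \<and> w (R i) < w (R j)"
| "holds n w E (ADJACENT i j) (R, M) \<longleftrightarrow> adjacent n E (R i) (R j)"

text \<open>\<open>exec n w E c s t s'\<close>: started in state \<open>s\<close>, \<open>c\<close> halts after exactly \<open>t\<close> steps in \<open>s'\<close>.\<close>

inductive exec ::
  "nat \<Rightarrow> (nat \<Rightarrow> real) \<Rightarrow> (nat \<times> nat \<Rightarrow> bool) \<Rightarrow> com \<Rightarrow> state \<Rightarrow> nat \<Rightarrow> state \<Rightarrow> bool"
  for n w E where
  Skip: "exec n w E SKIP s 1 s"
| Instr: "exec n w E (INSTR a) s 1 (run_instr a s)"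
| Seq: "exec n w E c s t s' \<Longrightarrow> exec n w E d s' u s'' \<Longrightarrow> exec n w E (SEQ c d) s (t + u) s''"
| CondTrue: "holds n w E b s \<Longrightarrow> exec n w E c s t s' \<Longrightarrow> exec n w E (COND b c d) s (Suc t) s'"
| CondFalse: "\<not> holds n w E b s \<Longrightarrow> exec n w E d s t s' \<Longrightarrow> exec n w E (COND b c d) s (Suc t) s'"
| LoopFalse: "\<not> holds n w E b s \<Longrightarrow> exec n w E (LOOP b c) s 1 s"
| LoopTrue: "holds n w E b s \<Longrightarrow> exec n w E c s t s' \<Longrightarrow> exec n w E (LOOP b c) s' u s'' \<Longrightarrow>
    exec n w E (LOOP b c) s (Suc (t + u)) s''"

lemma exec_deterministic:
  "exec n w E c s t s' \<Longrightarrow> exec n w E c s u s'' \<Longrightarrow> t = u \<and> s' = s''"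
proof (induction arbitrary: u s'' rule: exec.induct)
  case (Skip s)
  then show ?case by cases simp_all
next
  case (Instr a s)
  then show ?case by cases simp_all
next
  case (Seq c s t s1 d t' s2)
  from Seq.prems obtain u1 r u2 where
    r: "exec n w E c s u1 r" "exec n w E d r u2 s''" "u = u1 + u2"
    by cases
  from Seq.IH(1)[OF r(1)] Seq.IH(2)[of u2 s''] r show ?case
    by simp
next
  case (CondTrue b s c t s' d)
  from CondTrue.prems CondTrue.hyps(1) obtain v where
    v: "exec n w E c s v s''" "u = Suc v"
    by cases simp_all
  from CondTrue.IH[OF v(1)] v(2) show ?case
    by simp
next
  case (CondFalse b s d t s' c)
  from CondFalse.prems CondFalse.hyps(1) obtain v where
    v: "exec n w E d s v s''" "u = Suc v"
    by cases simp_all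
  from CondFalse.IH[OF v(1)] v(2) show ?case
    by simp
next
  case (LoopFalse b s c)
  from LoopFalse.prems LoopFalse.hyps show ?case
    by cases simp_all
next
  case (LoopTrue b s c t s1 t' s2)
  from LoopTrue.prems LoopTrue.hyps(1) obtain u1 r u2 where
    r: "exec n w E c s u1 r" "exec n w E (LOOP b c) r u2 s''" "u = Suc (u1 + u2)"
    by cases simp_all
  from LoopTrue.IH(1)[OF r(1)] LoopTrue.IH(2)[of u2 s''] r show ?case
    by simp
qed

text \<open>
  The input \<open>n\<close> is passed in register \<open>0\<close>. The output is a set of vertices, represented by its
  characteristic function in the memory cells \<open>1, \<dots>, n\<close>.
\<close>

definition start :: "nat \<Rightarrow> state" where
  "start n = ((\<lambda>_. 0)(0 := n), (\<lambda>_. 0))"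

fun result :: "nat \<Rightarrow> state \<Rightarrow> nat set" where
  "result n (R, M) = {v \<in> {1..n}. M v \<noteq> 0}"

definition outputs_within ::
  "nat \<Rightarrow> (nat \<Rightarrow> real) \<Rightarrow> (nat \<times> nat \<Rightarrow> bool) \<Rightarrow> com \<Rightarrow> nat \<Rightarrow> nat set \<Rightarrow> bool" where
  "outputs_within n w E c T K \<longleftrightarrow>
     (\<exists>t s. exec n w E c (start n) t s \<and> t \<le> T \<and> result n s = K)"

end

theory Submission
  imports Defs "HOL-Real_Asymp.Real_Asymp"
begin

text \<open>
  Two ranges of the exponent are treated by two different algorithms.

  \<^bold>\<open>Heavy tails, \<open>\<alpha> < 2\<close>.\<close> Let \<open>\<kappa> = 1 - \<alpha> / 2\<close>. There are about \<open>n powr \<kappa>\<close> vertices of weight at least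
  \<open>sqrt (c * n * ln n)\<close>, up to a logarithmic factor, and two vertices of this weight are non-adjacent
  with probability \<open>n powr (- b * c)\<close>. The critical value is therefore \<open>c = \<kappa> / b\<close>. Fix a small
  \<open>\<eta> > 0\<close> and consider the thresholds for \<open>c = \<kappa> * (1 \<plusminus> \<eta>) / b\<close>. The numbers of vertices above these
  two thresholds are concentrated by Chebyshev's inequality, and their ratio is close to \<open>1\<close>. Among
  the vertices above the upper threshold so few edges are missing that a clique which is maximal in this
  set contains almost all of it. Among the vertices below the lower threshold a first moment estimate
  excludes cliques of comparable size. So every clique that is maximal in the set of vertices above the
  upper threshold is optimal up to a factor close to \<open>1\<close>. The algorithm does not know the threshold, but
  it can try all weights: for each vertex \<open>t\<close> it builds a clique greedily among the vertices not
  lighter than \<open>t\<close>, and outputs the largest clique obtained (\<open>greedy_correct\<close>, \<open>greedy_succeeds_whp\<close>).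
  Letting \<open>\<eta>\<close> tend to zero slowly yields the sequence \<open>\<epsilon>\<close> (\<open>diagonal_sequence\<close>).

  \<^bold>\<open>Light tails, \<open>\<alpha> \<ge> 2\<close>.\<close> Here with high probability the graph has only polynomially many cliques.
  Only few vertices have a weight above \<open>sqrt n / (ln n) powr (1/4)\<close>, so that there are at most
      \<open>n\<close> sets of
  such vertices; and the other vertices span no clique of size four, by another first moment estimate.
  Hence there are at most \<open>n * (n + 1) ^ 3\<close> cliques, and a backtracking search that enumerates all of
  them finds a largest one in polynomial time (\<open>dfs_correct\<close>, \<open>dfs_succeeds_whp\<close>).
\<close>

section \<open>Total correctness within a time bound\<close>

text \<open>
  Hoare triples for total correctness with a time bound: every state that satisfies \<open>P\<close> leads in
  at most \<open>T\<close> steps to a state that satisfies \<open>Q\<close>.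
\<close>

definition triple :: "nat \<Rightarrow> (nat \<Rightarrow> real) \<Rightarrow> (nat \<times> nat \<Rightarrow> bool) \<Rightarrow>
    (state \<Rightarrow> bool) \<Rightarrow> com \<Rightarrow> nat \<Rightarrow> (state \<Rightarrow> bool) \<Rightarrow> bool" where
  "triple n w E P c T Q \<longleftrightarrow>
     (\<forall>s. P s \<longrightarrow> (\<exists>t s'. exec n w E c s t s' \<and> t \<le> T \<and> Q s'))"

lemma tripleI:
  assumes "\<And>s. P s \<Longrightarrow> \<exists>t s'. exec n w E c s t s' \<and> t \<le> T \<and> Q s'"
  shows "triple n w E P c T Q"
  using assms unfolding triple_def by blast

lemma tripleD:
  assumes "triple n w E P c T Q" "P s"
  obtains t s' where "exec n w E c s t s'" "t \<le> T" "Q s'"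
  using assms unfolding triple_def by blast

lemma triple_conseq:
  assumes "triple n w E P' c T' Q'" "\<And>s. P s \<Longrightarrow> P' s" "T' \<le> T" "\<And>s. Q' s \<Longrightarrow> Q s"
  shows "triple n w E P c T Q"
  using assms unfolding triple_def by (meson order_trans)

lemma triple_seq:
  assumes "triple n w E P c T Q" "triple n w E Q d U Z"
  shows "triple n w E P (SEQ c d) (T + U) Z"
  using assms unfolding triple_def by (meson Seq add_mono)

lemma triple_cond:
  assumes "triple n w E (\<lambda>s. P s \<and> holds n w E b s) c T Q"
    and "triple n w E (\<lambda>s. P s \<and> \<not> holds n w E b s) d T Q"
  shows "triple n w E P (COND b c d) (Suc T) Q"
  using assms unfolding triple_def by (meson CondTrue CondFalse Suc_le_mono)

text \<open>
  Programs without loops can be evaluated directly; \<open>cost\<close> bounds their running time. The values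
  of \<open>cost\<close> and \<open>run\<close> for loops are irrelevant.
\<close>

fun straight :: "com \<Rightarrow> bool" where
  "straight SKIP = True"
| "straight (INSTR a) = True"
| "straight (SEQ c d) = (straight c \<and> straight d)"
| "straight (COND b c d) = (straight c \<and> straight d)"
| "straight (LOOP b c) = False"

fun cost :: "com \<Rightarrow> nat" where
  "cost SKIP = 1"
| "cost (INSTR a) = 1"
| "cost (SEQ c d) = cost c + cost d"
| "cost (COND b c d) = Suc (cost c + cost d)"
| "cost (LOOP b c) = 0"

fun run :: "nat \<Rightarrow> (nat \<Rightarrow> real) \<Rightarrow> (nat \<times> nat \<Rightarrow> bool) \<Rightarrow> com \<Rightarrow> state \<Rightarrow> state" where
  "run n w E SKIP s = s"
| "run n w E (INSTR a) s = run_instr a s"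
| "run n w E (SEQ c d) s = run n w E d (run n w E c s)"
| "run n w E (COND b c d) s = (if holds n w E b s then run n w E c s else run n w E d s)"
| "run n w E (LOOP b c) s = s"

lemma exec_straight:
  "straight c \<Longrightarrow> \<exists>t \<le> cost c. exec n w E c s t (run n w E c s)"
proof (induction c arbitrary: s)
  case (SEQ c d)
  from SEQ.IH(1)[of s] SEQ.prems obtain t where
    t: "t \<le> cost c" "exec n w E c s t (run n w E c s)" by auto
  from SEQ.IH(2)[of "run n w E c s"] SEQ.prems obtain u where
    u: "u \<le> cost d" "exec n w E d (run n w E c s) u (run n w E d (run n w E c s))" by auto
  show ?case
    using Seq[OF t(2) u(2)] t(1) u(1) by (auto intro!: exI[of _ "t + u"])
next
  case (COND b c d)
  from COND.IH(1)[of s] COND.prems obtain t where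
    t: "t \<le> cost c" "exec n w E c s t (run n w E c s)" by auto
  from COND.IH(2)[of s] COND.prems obtain u where
    u: "u \<le> cost d" "exec n w E d s u (run n w E d s)" by auto
  show ?case
  proof (cases "holds n w E b s")
    case True
    then show ?thesis using CondTrue[OF True t(2)] t(1) by (auto intro!: exI[of _ "Suc t"])
  next
    case False
    then show ?thesis using CondFalse[OF False u(2)] u(1) by (auto intro!: exI[of _ "Suc u"])
  qed
qed (auto intro: Skip[unfolded One_nat_def] Instr[unfolded One_nat_def])

lemma triple_straight:
  assumes "straight c" "cost c \<le> T" "\<And>R M. P (R, M) \<Longrightarrow> Q (run n w E c (R, M))"
  shows "triple n w E P c T Q"
proof (rule tripleI)
  fix s assume "P s"
  then have "Q (run n w E c s)" using assms(3) by (cases s) auto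
  then show "\<exists>t s'. exec n w E c s t s' \<and> t \<le> T \<and> Q s'"
    using exec_straight[OF assms(1), of n w E s] assms(2) order_trans by blast
qed

text \<open>
  A loop that runs until register \<open>r\<close> is zero, where the body decreases \<open>r\<close> at least by one;
  register \<open>9\<close> holds the constant zero. The body may skip values of \<open>r\<close>, which models leaving the
  loop early.
\<close>

lemma triple_countdown_jump:
  assumes body: "\<And>k. k < m \<Longrightarrow> triple n w E (J (Suc k)) c T (\<lambda>s. \<exists>j\<le>k. J j s)"
    and J: "\<And>k s. J k s \<Longrightarrow> fst s r = k \<and> fst s 9 = 0"
  shows "triple n w E (J m) (LOOP (LESS 9 r) c) (Suc T * m + 1) (J 0)"
  using body
proof (induction m rule: less_induct)
  case (less m)
  show ?case
  proof (rule tripleI)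
    fix s assume s: "J m s"
    show "\<exists>t s'. exec n w E (LOOP (LESS 9 r) c) s t s' \<and> t \<le> Suc T * m + 1 \<and> J 0 s'"
    proof (cases m)
      case 0
      then have "\<not> holds n w E (LESS 9 r) s"
        using J[OF s] by (cases s) simp
      from LoopFalse[OF this, of c] s 0 show ?thesis
        by (intro exI[of _ 1] exI[of _ s]) simp_all
    next
      case (Suc k)
      have k: "k < m" and Jk: "J (Suc k) s"
        using s Suc by auto
      from tripleD[OF less.prems[OF k] Jk] obtain t s' where
        1: "exec n w E c s t s'" "t \<le> T" and "\<exists>j\<le>k. J j s'" .
      then obtain j where j: "j \<le> k" "J j s'" by blast
      have "triple n w E (J j) (LOOP (LESS 9 r) c) (Suc T * j + 1) (J 0)"
      proof (rule less.IH)
        show "triple n w E (J (Suc i)) c T (\<lambda>s. \<exists>j\<le>i. J j s)" if "i < j" for i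
          using that j(1) k by (intro less.prems) simp
      qed (use j(1) k in simp)
      from tripleD[OF this j(2)] obtain u s'' where
        2: "exec n w E (LOOP (LESS 9 r) c) s' u s''" "u \<le> Suc T * j + 1" "J 0 s''" .
      have "holds n w E (LESS 9 r) s"
        using J[OF s] Suc by (cases s) simp
      note LoopTrue[OF this 1(1) 2(1)]
      moreover have "Suc (t + u) \<le> Suc T * m + 1"
      proof -
        have "Suc T * j \<le> Suc T * k" using j(1) by (rule mult_le_mono2)
        then show ?thesis using 1(2) 2(2) Suc by simp
      qed
      ultimately show ?thesis using 2(3) by blast
    qed
  qed
qed

lemma triple_countdown:
  assumes "\<And>k. k < m \<Longrightarrow> triple n w E (J (Suc k)) c T (J k)"
    and "\<And>k s. J k s \<Longrightarrow> fst s r = k \<and> fst s 9 = 0"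
  shows "triple n w E (J m) (LOOP (LESS 9 r) c) (Suc T * m + 1) (J 0)"
  by (rule triple_countdown_jump[where J = J, OF triple_conseq[OF assms(1)]]) (auto dest: assms(2))

fun seqs :: "com list \<Rightarrow> com" where
  "seqs [] = SKIP"
| "seqs [c] = c"
| "seqs (c # d # cs) = SEQ c (seqs (d # cs))"

section \<open>Cliques\<close>

lemma adjacent_sym: "adjacent n E i j \<longleftrightarrow> adjacent n E j i"
  by (auto simp: adjacent_def)

lemma is_clique_empty [simp]: "is_clique n E {}"
  by (simp add: is_clique_def)

lemma finite_clique: "is_clique n E K \<Longrightarrow> finite K"
  by (auto simp: is_clique_def intro: finite_subset)

lemma finite_cliques [simp]: "finite {K. is_clique n E K}"
  by (rule finite_subset[of _ "Pow {1..n}"]) (auto simp: is_clique_def)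

lemma is_clique_subset: "is_clique n E K \<Longrightarrow> K' \<subseteq> K \<Longrightarrow> is_clique n E K'"
  by (auto simp: is_clique_def)

lemma is_clique_insert_iff:
  assumes "is_clique n E S" "v \<in> {1..n}" "v \<notin> S"
  shows "is_clique n E (insert v S) \<longleftrightarrow> (\<forall>u\<in>S. adjacent n E u v)"
proof
  assume *: "is_clique n E (insert v S)"
  show "\<forall>u\<in>S. adjacent n E u v"
  proof
    fix u assume "u \<in> S"
    then have "u \<noteq> v" using assms(3) by auto
    then show "adjacent n E u v" using * \<open>u \<in> S\<close> by (simp add: is_clique_def)
  qed
next
  assume *: "\<forall>u\<in>S. adjacent n E u v"
  have "adjacent n E v u" if "u \<in> S" for u
    using * that adjacent_sym[of n E u v] by simp
  with * assms(1,2) show "is_clique n E (insert v S)"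
    by (simp add: is_clique_def)
qed

section \<open>Extending the current clique by one vertex\<close>

text \<open>
  The program \<open>check\<close> leaves in register \<open>5\<close> whether the vertex in register \<open>1\<close> is adjacent to all
  elements of the current set, and \<open>copy\<close> replaces the best set by the current one. The program
  \<open>try_add\<close> adds the vertex in register \<open>1\<close> to the current set if that keeps it a clique, and then
  updates the best set if the current set has become larger.
\<close>

definition check_body :: com where
  "check_body = seqs [INSTR (ADD 6 0 4), INSTR (LOAD 7 6),
     COND (LESS 9 7) (COND (ADJACENT 4 1) SKIP (INSTR (LIT 5 0))) SKIP, INSTR (SUB 4 4 8)]"

definition check :: com where
  "check = seqs [INSTR (LIT 5 1), INSTR (MOVE 4 0), LOOP (LESS 9 4) check_body]"

definition copy_body :: com where
  "copy_body = seqs [INSTR (ADD 6 0 4), INSTR (LOAD 7 6), INSTR (STORE 4 7), INSTR (SUB 4 4 8)]"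

definition copy :: com where
  "copy = seqs [INSTR (MOVE 3 2), INSTR (MOVE 4 0), LOOP (LESS 9 4) copy_body]"

definition try_add :: com where
  "try_add = SEQ check (COND (LESS 9 5)
     (SEQ (seqs [INSTR (ADD 6 0 1), INSTR (STORE 6 8), INSTR (ADD 2 2 8)])
        (COND (LESS 3 2) copy SKIP))
     SKIP)"

text \<open>
  \<open>represents n v x S B s\<close>: the state \<open>s\<close> holds the current set \<open>S\<close> in the memory cells
  \<open>n + 1, \<dots>, 2 n\<close> and the best set \<open>B\<close> found so far in the cells \<open>1, \<dots>, n\<close>, both as
  characteristic functions. Register \<open>1\<close> is the vertex \<open>v\<close> under consideration and register \<open>10\<close>
  an auxiliary value \<open>x\<close>; registers \<open>2\<close> and \<open>3\<close> count the elements of \<open>S\<close> and \<open>B\<close>; registers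
  \<open>0\<close>, \<open>8\<close> and \<open>9\<close> are the constants \<open>n\<close>, \<open>1\<close> and \<open>0\<close>. Registers \<open>4\<close> to \<open>7\<close> are scratch space.
\<close>

definition represents :: "nat \<Rightarrow> nat \<Rightarrow> nat \<Rightarrow> nat set \<Rightarrow> nat set \<Rightarrow> state \<Rightarrow> bool" where
  "represents n v x S B s \<longleftrightarrow> (case s of (R, M) \<Rightarrow>
     R 0 = n \<and> R 8 = 1 \<and> R 9 = 0 \<and> R 1 = v \<and> R 10 = x \<and> R 2 = card S \<and> R 3 = card B \<and>
     S \<subseteq> {1..n} \<and> B \<subseteq> {1..n} \<and>
     (\<forall>u\<in>{1..n}. M (n + u) \<noteq> 0 \<longleftrightarrow> u \<in> S) \<and> (\<forall>u\<in>{1..n}. M u \<noteq> 0 \<longleftrightarrow> u \<in> B))"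

lemma result_rep: "represents n v x S B s \<Longrightarrow> result n s = B"
  by (cases s) (auto simp: represents_def)

lemma represents_scratch [simp]:
  "r \<in> {4, 5, 6, 7} \<Longrightarrow> represents n v x S B (R(r := y), M) \<longleftrightarrow> represents n v x S B (R, M)"
  by (auto simp: represents_def)

lemma represents_registers:
  assumes "represents n v x S B (R, M)"
  shows "R 0 = n" "R 8 = 1" "R 9 = 0" "R 1 = v" "R 10 = x" "R 2 = card S" "R 3 = card B"
  using assms by (auto simp: represents_def)

lemma represents_memory:
  assumes "represents n v x S B (R, M)" "u \<in> {1..n}"
  shows "0 < M (n + u) \<longleftrightarrow> u \<in> S" "0 < M u \<longleftrightarrow> u \<in> B"
  using assms by (auto simp: represents_def)

lemma triple_check:
  "triple n w E (represents n v x S B) check (13 * n + 3)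
     (\<lambda>s. represents n v x S B s \<and> (0 < fst s 5 \<longleftrightarrow> (\<forall>u\<in>S. adjacent n E u v)))"
proof -
  define J where "J k s \<longleftrightarrow> represents n v x S B s \<and> fst s 4 = k \<and> k \<le> n \<and>
    (0 < fst s 5 \<longleftrightarrow> (\<forall>u\<in>S. k < u \<longrightarrow> adjacent n E u v))" for k s
  have body: "triple n w E (J (Suc k)) check_body 11 (J k)" for k
  proof (rule triple_straight)
    fix R M assume J: "J (Suc k) (R, M)"
    then have rep: "represents n v x S B (R, M)" and k: "R 4 = Suc k" "Suc k \<le> n"
      and ok: "0 < R 5 \<longleftrightarrow> (\<forall>u\<in>S. Suc k < u \<longrightarrow> adjacent n E u v)"
      by (simp_all add: J_def)
    have "0 < M (n + Suc k) \<longleftrightarrow> Suc k \<in> S"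
      using represents_memory[OF rep, of "Suc k"] k by simp
    moreover have "(\<forall>u\<in>S. k < u \<longrightarrow> adjacent n E u v) \<longleftrightarrow>
        0 < R 5 \<and> (Suc k \<in> S \<longrightarrow> adjacent n E (Suc k) v)"
    proof -
      have "k < u \<longleftrightarrow> u = Suc k \<or> Suc k < u" for u by arith
      then have "(\<forall>u\<in>S. k < u \<longrightarrow> adjacent n E u v) \<longleftrightarrow>
          (\<forall>u\<in>S. u = Suc k \<or> Suc k < u \<longrightarrow> adjacent n E u v)" by (simp only:)
      also have "\<dots> \<longleftrightarrow> (\<forall>u\<in>S. Suc k < u \<longrightarrow> adjacent n E u v) \<and> (Suc k \<in> S \<longrightarrow> adjacent n E (Suc k) v)"
        by blast
      finally show ?thesis by (simp only: ok)
    qed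
    ultimately show "J k (run n w E check_body (R, M))"
      using rep k represents_registers[OF rep] by (simp add: J_def check_body_def)
  qed (simp_all add: check_body_def)
  have 1: "triple n w E (J n) (LOOP (LESS 9 4) check_body) (Suc 11 * n + 1) (J 0)"
    by (rule triple_countdown[where J = J, OF body]) (auto simp: J_def represents_def)
  have 3: "triple n w E (represents n v x S B) (INSTR (LIT 5 1)) 1 (\<lambda>s. represents n v x S B s \<and>
      fst s 5 = 1)"
    by (rule triple_straight) (auto simp: represents_def)
  have 4: "triple n w E (\<lambda>s. represents n v x S B s \<and> fst s 5 = 1) (INSTR (MOVE 4 0)) 1 (J n)"
    by (rule triple_straight) (auto simp: J_def represents_def)
  show ?thesis
    unfolding check_def seqs.simps
  proof (rule triple_conseq[OF triple_seq[OF 3 triple_seq[OF 4 1]]])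
    show "represents n v x S B s \<and> (0 < fst s 5 \<longleftrightarrow> (\<forall>u\<in>S. adjacent n E u v))" if "J 0 s" for s
      using that by (cases s) (auto simp: J_def represents_def)
  qed auto
qed

lemma triple_copy:
  "triple n w E (represents n v x S B) copy (5 * n + 3) (represents n v x S S)"
proof -
  define J where "J k s \<longleftrightarrow> (case (s :: state) of (R, M) \<Rightarrow>
     R 0 = n \<and> R 8 = 1 \<and> R 9 = 0 \<and> R 1 = v \<and> R 10 = x \<and> R 2 = card S \<and> R 3 = card S \<and>
     S \<subseteq> {1..n} \<and> R 4 = k \<and> k \<le> n \<and>
     (\<forall>u\<in>{1..n}. M (n + u) \<noteq> 0 \<longleftrightarrow> u \<in> S) \<and> (\<forall>u\<in>{k<..n}. M u \<noteq> 0 \<longleftrightarrow> u \<in> S))" for k s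
  have body: "triple n w E (J (Suc k)) copy_body 4 (J k)" for k
  proof (rule triple_straight)
    fix R M assume J: "J (Suc k) (R, M)"
    then have "\<forall>u\<in>{1..n}. M (n + u) \<noteq> 0 \<longleftrightarrow> u \<in> S" "Suc k \<in> {1..n}"
      by (simp_all add: J_def)
    then have "M (n + Suc k) \<noteq> 0 \<longleftrightarrow> Suc k \<in> S" by blast
    then have "0 < M (Suc (n + k)) \<longleftrightarrow> Suc k \<in> S" by simp
    then show "J k (run n w E copy_body (R, M))"
      using J by (auto simp: J_def copy_body_def)
  qed (auto simp: copy_body_def)
  have 1: "triple n w E (J n) (LOOP (LESS 9 4) copy_body) (Suc 4 * n + 1) (J 0)"
    by (rule triple_countdown[where J = J, OF body]) (auto simp: J_def)
  have 2: "triple n w E (represents n v x S B) (INSTR (MOVE 3 2)) 1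
      (\<lambda>s. represents n v x S B ((fst s)(3 := card B), snd s) \<and> fst s 3 = card S)"
    by (rule triple_straight) (auto simp: represents_def)
  have 3: "triple n w E (\<lambda>s. represents n v x S B ((fst s)(3 := card B), snd s) \<and> fst s 3 = card S)
      (INSTR (MOVE 4 0)) 1 (J n)"
    by (rule triple_straight) (auto simp: J_def represents_def)
  show ?thesis
    unfolding copy_def seqs.simps
  proof (rule triple_conseq[OF triple_seq[OF 2 triple_seq[OF 3 1]]])
    show "represents n v x S S s" if "J 0 s" for s
      using that by (cases s) (auto simp: J_def represents_def)
  qed auto
qed

text \<open>The set that results from \<open>S\<close> by an attempt to add \<open>v\<close>.\<close>

definition extend_clique :: "nat \<Rightarrow> (nat \<times> nat \<Rightarrow> bool) \<Rightarrow> nat \<Rightarrow> nat set \<Rightarrow> nat set" where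
  "extend_clique n E v S = (if \<forall>u\<in>S. adjacent n E u v then insert v S else S)"

text \<open>The best set after it has been compared with \<open>S\<close>.\<close>

definition keep_larger :: "nat set \<Rightarrow> nat set \<Rightarrow> nat set" where
  "keep_larger S B = (if card B < card S then S else B)"

lemma triple_try_add:
  assumes "v \<in> {1..n}" "v \<notin> S" "card S \<le> card B"
  shows "triple n w E (represents n v x S B) try_add (18 * n + 14)
     (represents n v x (extend_clique n E v S) (keep_larger (extend_clique n E v S) B))"
proof -
  let ?S = "insert v S"
  define P where "P s \<longleftrightarrow> represents n v x S B s \<and> (0 < fst s 5 \<longleftrightarrow> (\<forall>u\<in>S. adjacent n E u v))" for s
  let ?Q = "represents n v x (extend_clique n E v S) (keep_larger (extend_clique n E v S) B)"
  have 1: "triple n w E (\<lambda>s. P s \<and> holds n w E (LESS 9 5) s)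
      (seqs [INSTR (ADD 6 0 1), INSTR (STORE 6 8), INSTR (ADD 2 2 8)]) 3
      (\<lambda>s. represents n v x ?S B s \<and> extend_clique n E v S = ?S)"
  proof (rule triple_straight, goal_cases)
    case (3 R M)
    have "finite S" using 3 by (auto simp: P_def represents_def intro: finite_subset)
    then show ?case using 3 assms by (auto simp: P_def represents_def extend_clique_def)
  qed auto
  have 2: "triple n w E (\<lambda>s. represents n v x ?S B s \<and> extend_clique n E v S = ?S)
      (COND (LESS 3 2) copy SKIP) (Suc (5 * n + 3)) ?Q"
  proof (cases "extend_clique n E v S = ?S")
    case e: True
    show ?thesis
    proof (rule triple_cond)
      show "triple n w E (\<lambda>s. (represents n v x ?S B s \<and> extend_clique n E v S = ?S) \<and>
          holds n w E (LESS 3 2) s)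
          copy (5 * n + 3) ?Q"
      proof (cases "card B < card ?S")
        case True
        with e show ?thesis
          by (intro triple_conseq[OF triple_copy[of n w E v x ?S B]]) (auto simp: keep_larger_def)
      next
        case False
        have "\<not> holds n w E (LESS 3 2) s" if "represents n v x ?S B s" for s
          using that False by (cases s) (auto simp: represents_def)
        then show ?thesis
          unfolding triple_def by blast
      qed
      show "triple n w E (\<lambda>s. (represents n v x ?S B s \<and> extend_clique n E v S = ?S) \<and>
          \<not> holds n w E (LESS 3 2) s)
          SKIP (5 * n + 3) ?Q"
        using e by (intro triple_straight) (auto simp: keep_larger_def represents_def)
    qed
  next
    case False
    then show ?thesis
      unfolding triple_def by blast
  qed
  have 3: "triple n w E (\<lambda>s. P s \<and> \<not> holds n w E (LESS 9 5) s) SKIP (3 + Suc (5 * n + 3)) ?Q"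
    using assms by (intro triple_straight) (auto simp: P_def represents_def extend_clique_def
        keep_larger_def)
  show ?thesis
    unfolding try_add_def
    by (rule triple_conseq[OF triple_seq[OF triple_check[of n w E v x S B, folded P_def]
        triple_cond[OF triple_seq[OF 1 2] 3]]]) auto
qed

lemma extend_clique_eq:
  assumes "is_clique n E S" "v \<in> {1..n}" "v \<notin> S"
  shows "extend_clique n E v S = (if is_clique n E (insert v S) then insert v S else S)"
  using is_clique_insert_iff[OF assms] by (simp add: extend_clique_def)

lemma is_clique_extend_clique:
  assumes "is_clique n E S" "v \<in> {1..n}" "v \<notin> S"
  shows "is_clique n E (extend_clique n E v S)"
  using assms by (simp add: extend_clique_eq)

lemma card_keep_larger: "card B \<le> card (keep_larger S B)" "card S \<le> card (keep_larger S B)"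
  by (auto simp: keep_larger_def)

lemma is_clique_keep_larger: "is_clique n E S \<Longrightarrow> is_clique n E B \<Longrightarrow> is_clique n E (keep_larger S B)"
  by (simp add: keep_larger_def)

section \<open>Greedy cliques above all weight thresholds\<close>

definition clear_body :: com where
  "clear_body = seqs [INSTR (ADD 6 0 4), INSTR (STORE 6 9), INSTR (SUB 4 4 8)]"

definition clear :: com where
  "clear = seqs [INSTR (MOVE 4 0), LOOP (LESS 9 4) clear_body, INSTR (LIT 2 0)]"

lemma triple_clear: "triple n w E (represents n v x S B) clear (4 * n + 3) (represents n v x {} B)"
proof -
  define J where "J k s \<longleftrightarrow> (case (s :: state) of (R, M) \<Rightarrow>
     R 0 = n \<and> R 8 = 1 \<and> R 9 = 0 \<and> R 1 = v \<and> R 10 = x \<and> R 3 = card B \<and>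
     B \<subseteq> {1..n} \<and> R 4 = k \<and> k \<le> n \<and>
     (\<forall>u\<in>{k<..n}. M (n + u) = 0) \<and> (\<forall>u\<in>{1..n}. M u \<noteq> 0 \<longleftrightarrow> u \<in> B))" for k s
  have body: "triple n w E (J (Suc k)) clear_body 3 (J k)" for k
  proof (rule triple_straight)
    fix R M assume J: "J (Suc k) (R, M)"
    then show "J k (run n w E clear_body (R, M))"
      by (simp add: J_def clear_body_def)
  qed (simp_all add: clear_body_def)
  have 1: "triple n w E (J n) (LOOP (LESS 9 4) clear_body) (Suc 3 * n + 1) (J 0)"
    by (rule triple_countdown[where J = J, OF body]) (auto simp: J_def)
  have 2: "triple n w E (represents n v x S B) (INSTR (MOVE 4 0)) 1 (J n)"
    by (rule triple_straight) (auto simp: J_def represents_def)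
  have 3: "triple n w E (J 0) (INSTR (LIT 2 0)) 1 (represents n v x {} B)"
    by (rule triple_straight) (auto simp: J_def represents_def)
  show ?thesis
    unfolding clear_def seqs.simps
    by (rule triple_conseq[OF triple_seq[OF 2 triple_seq[OF 1 3]]]) auto
qed

text \<open>
  The vertices that are not lighter than \<open>t\<close>. If \<open>t\<close> is a lightest vertex of weight above some
  threshold, these are exactly the vertices of weight above the threshold.
\<close>

definition weight_above :: "nat \<Rightarrow> (nat \<Rightarrow> real) \<Rightarrow> nat \<Rightarrow> nat set" where
  "weight_above n w t = {u \<in> {1..n}. \<not> w u < w t}"

text \<open>\<open>S\<close> is a clique that cannot be enlarged within \<open>H\<close>.\<close>

definition maximal_on :: "nat \<Rightarrow> (nat \<times> nat \<Rightarrow> bool) \<Rightarrow> nat set \<Rightarrow> nat set \<Rightarrow> bool" where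
  "maximal_on n E H S \<longleftrightarrow>
     is_clique n E S \<and> S \<subseteq> H \<and> (\<forall>v\<in>H - S. \<exists>u\<in>S. \<not> adjacent n E u v)"

text \<open>\<open>B\<close> is at least as large as some maximal clique among the vertices not lighter than \<open>t\<close>.\<close>

definition beats :: "nat \<Rightarrow> (nat \<Rightarrow> real) \<Rightarrow> (nat \<times> nat \<Rightarrow> bool) \<Rightarrow> nat set \<Rightarrow> nat \<Rightarrow> bool" where
  "beats n w E B t \<longleftrightarrow> (\<exists>S. maximal_on n E (weight_above n w t) S \<and> card S \<le> card B)"

lemma beats_mono: "beats n w E B t \<Longrightarrow> card B \<le> card B' \<Longrightarrow> beats n w E B' t"
  unfolding beats_def using order_trans by blast

text \<open>
  For every vertex \<open>t\<close>, held in register \<open>10\<close>, the algorithm builds a clique greedily among the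
  vertices not lighter than \<open>t\<close>; it outputs the largest of these cliques. No sorting is needed:
  for a fixed \<open>t\<close> the vertices are scanned in decreasing order of their names.
\<close>

definition greedy_step :: com where
  "greedy_step = SEQ (COND (LIGHTER 1 10) SKIP try_add) (INSTR (SUB 1 1 8))"

definition greedy_round :: com where
  "greedy_round = seqs [clear, INSTR (MOVE 1 0), LOOP (LESS 9 1) greedy_step, INSTR (SUB 10 10 8)]"

definition greedy :: com where
  "greedy = seqs [INSTR (LIT 8 1), INSTR (MOVE 10 0), LOOP (LESS 9 10) greedy_round]"

lemma triple_greedy_step:
  assumes t: "t \<in> {1..n}" and k: "k < n"
    and S: "maximal_on n E (weight_above n w t \<inter> {Suc k<..n}) S"
    and B: "is_clique n E B" "card S \<le> card B"
  shows "triple n w E (represents n (Suc k) t S B) greedy_step (18 * n + 16)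
    (\<lambda>s. \<exists>S' B'. represents n k t S' B' s \<and> maximal_on n E (weight_above n w t \<inter> {k<..n}) S' \<and>
       is_clique n E B' \<and> card S' \<le> card B' \<and> card B \<le> card B')"
proof -
  let ?v = "Suc k"
  define S' where "S' = (if w ?v < w t then S else extend_clique n E ?v S)"
  define B' where "B' = (if w ?v < w t then B else keep_larger S' B)"
  have vS: "?v \<notin> S" "?v \<in> {1..n}"
    using S k by (auto simp: maximal_on_def)
  have holds: "holds n w E (LIGHTER 1 10) s \<longleftrightarrow> w ?v < w t" if "represents n ?v t S B s" for s
  proof (cases s)
    case (Pair R M)
    with that have "represents n ?v t S B (R, M)" by simp
    from represents_registers[OF this] show ?thesis using t k Pair by simp
  qed
  have 1: "triple n w E (represents n ?v t S B) (COND (LIGHTER 1 10) SKIP try_add) (Suc (18 * n + 14))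
      (represents n ?v t S' B')"
  proof (rule triple_cond)
    show "triple n w E (\<lambda>s. represents n ?v t S B s \<and> holds n w E (LIGHTER 1 10) s) SKIP (18 * n + 14)
        (represents n ?v t S' B')"
      using holds by (intro triple_straight) (auto simp: S'_def B'_def)
    show "triple n w E (\<lambda>s. represents n ?v t S B s \<and> \<not> holds n w E (LIGHTER 1 10) s) try_add
        (18 * n + 14) (represents n ?v t S' B')"
    proof (cases "w ?v < w t")
      case True
      then show ?thesis using holds unfolding triple_def by blast
    next
      case False
      have "triple n w E (represents n ?v t S B) try_add (18 * n + 14)
          (represents n ?v t (extend_clique n E ?v S) (keep_larger (extend_clique n E ?v S) B))"
        using vS B by (intro triple_try_add) auto
      with False show ?thesis
        unfolding triple_def S'_def B'_def by auto
    qed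
  qed
  have 2: "triple n w E (represents n ?v t S' B') (INSTR (SUB 1 1 8)) 1 (represents n k t S' B')"
    by (rule triple_straight) (auto simp: represents_def)
  have kk: "u \<in> {k<..n} \<longleftrightarrow> u = ?v \<or> u \<in> {Suc k<..n}" for u
    using k by auto
  have S': "maximal_on n E (weight_above n w t \<inter> {k<..n}) S'"
  proof -
    have "is_clique n E S'"
      using S is_clique_extend_clique[OF _ vS(2,1)] by (simp add: S'_def maximal_on_def)
    moreover have "S' \<subseteq> weight_above n w t \<inter> {k<..n}"
      using S vS(2) by (auto simp: S'_def maximal_on_def extend_clique_def weight_above_def)
    moreover have "\<exists>u\<in>S'. \<not> adjacent n E u v" if v: "v \<in> weight_above n w t \<inter> {k<..n} - S'" for v
    proof (cases "v = ?v")
      case True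
      with v have "\<not> w ?v < w t" "?v \<notin> S'" by (auto simp: weight_above_def)
      then show ?thesis unfolding S'_def True by (auto simp: extend_clique_def split: if_splits)
    next
      case False
      then have "v \<in> weight_above n w t \<inter> {Suc k<..n}" using v kk[of v] by auto
      moreover have "S \<subseteq> S'" by (auto simp: S'_def extend_clique_def)
      ultimately show ?thesis using S v unfolding maximal_on_def by blast
    qed
    ultimately show ?thesis by (auto simp: maximal_on_def)
  qed
  have B': "is_clique n E B'" "card S' \<le> card B'" "card B \<le> card B'"
    using S' B is_clique_keep_larger[of n E S' B] card_keep_larger[of B S'] card_keep_larger(2)[of S' B]
    by (auto simp: B'_def maximal_on_def S'_def)
  show ?thesis
    unfolding greedy_step_def
    by (rule triple_conseq[OF triple_seq[OF 1 2]]) (use S' B' in auto)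
qed

lemma triple_greedy_round:
  assumes t: "Suc t \<le> n" and B: "is_clique n E B"
  shows "triple n w E (represents n v (Suc t) S B) greedy_round (18 * n * n + 21 * n + 6)
    (\<lambda>s. \<exists>v S' B'. represents n v t S' B' s \<and> is_clique n E B' \<and> card B \<le> card B' \<and>
        beats n w E B' (Suc t))"
proof -
  define I where "I k s \<longleftrightarrow> k \<le> n \<and> (\<exists>S' B'. represents n k (Suc t) S' B' s \<and>
    maximal_on n E (weight_above n w (Suc t) \<inter> {k<..n}) S' \<and>
    is_clique n E B' \<and> card S' \<le> card B' \<and> card B \<le> card B')" for k s
  have body: "triple n w E (I (Suc k)) greedy_step (18 * n + 16) (I k)" if "k < n" for k
  proof (rule tripleI)
    fix s assume "I (Suc k) s"
    then obtain S' B' where SB: "represents n (Suc k) (Suc t) S' B' s"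
      "maximal_on n E (weight_above n w (Suc t) \<inter> {Suc k<..n}) S'"
      "is_clique n E B'" "card S' \<le> card B'" "card B \<le> card B'"
      unfolding I_def by blast
    have "Suc t \<in> {1..n}" using t by auto
    from tripleD[OF triple_greedy_step[OF this that SB(2-4)] SB(1)]
    show "\<exists>t s'. exec n w E greedy_step s t s' \<and> t \<le> 18 * n + 16 \<and> I k s'"
      using SB(5) that unfolding I_def by (smt (verit, best) order_trans less_imp_le)
  qed
  have 1: "triple n w E (represents n v (Suc t) S B) clear (4 * n + 3) (represents n v (Suc t) {} B)"
    by (rule triple_clear)
  have 2: "triple n w E (represents n v (Suc t) {} B) (INSTR (MOVE 1 0)) 1 (I n)"
  proof (rule triple_straight)
    fix R M assume "represents n v (Suc t) {} B (R, M)"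
    then have "represents n n (Suc t) {} B (run n w E (INSTR (MOVE 1 0)) (R, M))"
      by (auto simp: represents_def)
    moreover have "maximal_on n E (weight_above n w (Suc t) \<inter> {n<..n}) {}"
      by (simp add: maximal_on_def)
    ultimately show "I n (run n w E (INSTR (MOVE 1 0)) (R, M))"
      unfolding I_def using B by (metis card.empty le0 order_refl)
  qed auto
  have 3: "triple n w E (I n) (LOOP (LESS 9 1) greedy_step) (Suc (18 * n + 16) * n + 1) (I 0)"
    by (rule triple_countdown[where J = I, OF body]) (auto simp: I_def dest: represents_registers)
  have 4: "triple n w E (I 0) (INSTR (SUB 10 10 8)) 1
    (\<lambda>s. \<exists>v S' B'. represents n v t S' B' s \<and> is_clique n E B' \<and> card B \<le> card B' \<and>
        beats n w E B' (Suc t))"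
  proof (rule triple_straight)
    fix R M assume "I 0 (R, M)"
    then obtain S' B' where SB: "represents n 0 (Suc t) S' B' (R, M)"
      "maximal_on n E (weight_above n w (Suc t) \<inter> {0<..n}) S'"
      "is_clique n E B'" "card S' \<le> card B'" "card B \<le> card B'"
      unfolding I_def by blast
    have "weight_above n w (Suc t) \<inter> {0<..n} = weight_above n w (Suc t)"
      by (auto simp: weight_above_def)
    then have "beats n w E B' (Suc t)" using SB(2,4) by (auto simp: beats_def)
    moreover have "represents n 0 t S' B' (run n w E (INSTR (SUB 10 10 8)) (R, M))"
      using SB(1) by (auto simp: represents_def)
    ultimately show "\<exists>v S' B'. represents n v t S' B' (run n w E (INSTR (SUB 10 10 8)) (R, M)) \<and>
        is_clique n E B' \<and> card B \<le> card B' \<and> beats n w E B' (Suc t)"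
      using SB by blast
  qed auto
  show ?thesis
    unfolding greedy_round_def seqs.simps
    by (rule triple_conseq[OF triple_seq[OF 1 triple_seq[OF 2 triple_seq[OF 3 4]]]])
      (auto simp: algebra_simps)
qed

lemma represents_start: "represents n 0 0 {} {} ((fst (start n))(8 := 1), snd (start n))"
  by (simp add: represents_def start_def)

theorem greedy_correct:
  obtains K where "outputs_within n w E greedy (18 * n * n * n + 21 * n * n + 7 * n + 3) K"
    "is_clique n E K" "\<And>t. t \<in> {1..n} \<Longrightarrow> beats n w E K t"
proof -
  define J where "J t s \<longleftrightarrow> t \<le> n \<and> (\<exists>v S B. represents n v t S B s \<and> is_clique n E B \<and>
    (\<forall>t'\<in>{t<..n}. beats n w E B t'))" for t s
  have body: "triple n w E (J (Suc t)) greedy_round (18 * n * n + 21 * n + 6) (J t)" for t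
  proof (rule tripleI)
    fix s assume "J (Suc t) s"
    then obtain v S B where B: "Suc t \<le> n" "represents n v (Suc t) S B s" "is_clique n E B"
      "\<forall>t'\<in>{Suc t<..n}. beats n w E B t'"
      unfolding J_def by blast
    from tripleD[OF triple_greedy_round[OF B(1,3)] B(2)] obtain u s' where
      u: "exec n w E greedy_round s u s'" "u \<le> 18 * n * n + 21 * n + 6"
      and "\<exists>v S' B'. represents n v t S' B' s' \<and> is_clique n E B' \<and> card B \<le> card B' \<and>
        beats n w E B' (Suc t)" .
    then obtain v' S' B' where B': "represents n v' t S' B' s'" "is_clique n E B'" "card B \<le> card B'"
      "beats n w E B' (Suc t)" by blast
    have "beats n w E B' t'" if "t' \<in> {t<..n}" for t'
    proof (cases "t' = Suc t")
      case False
      with that have "t' \<in> {Suc t<..n}" by auto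
      with B(4) have "beats n w E B t'" by blast
      then show ?thesis using B'(3) by (rule beats_mono)
    qed (use B' in simp)
    then have "\<forall>t'\<in>{t<..n}. beats n w E B' t'" by blast
    with B(1) B' have "J t s'"
      unfolding J_def by (intro conjI exI[of _ v'] exI[of _ S'] exI[of _ B']) simp_all
    with u show "\<exists>u s'. exec n w E greedy_round s u s' \<and> u \<le> 18 * n * n + 21 * n + 6 \<and> J t s'"
      by blast
  qed
  have 1: "triple n w E (\<lambda>s. s = start n) (INSTR (LIT 8 1)) 1 (represents n 0 0 {} {})"
    using represents_start[of n] by (intro triple_straight) (auto simp: start_def)
  have 2: "triple n w E (represents n 0 0 {} {}) (INSTR (MOVE 10 0)) 1 (J n)"
  proof (rule triple_straight)
    fix R M assume "represents n 0 0 {} {} (R, M)"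
    then have "represents n 0 n {} {} (run n w E (INSTR (MOVE 10 0)) (R, M))"
      by (auto simp: represents_def)
    then show "J n (run n w E (INSTR (MOVE 10 0)) (R, M))"
      unfolding J_def by force
  qed auto
  have 3: "triple n w E (J n) (LOOP (LESS 9 10) greedy_round)
      (Suc (18 * n * n + 21 * n + 6) * n + 1) (J 0)"
    by (rule triple_countdown[where J = J, OF body]) (auto simp: J_def dest: represents_registers)
  from triple_seq[OF 1 triple_seq[OF 2 3]]
  obtain u s where u: "exec n w E greedy (start n) u s"
      "u \<le> 1 + (1 + (Suc (18 * n * n + 21 * n + 6) * n + 1))" "J 0 s"
    unfolding greedy_def seqs.simps by (rule tripleD) simp
  from u(3) obtain v S B where B: "represents n v 0 S B s" "is_clique n E B"
    "\<forall>t'\<in>{0<..n}. beats n w E B t'"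
    unfolding J_def by blast
  show ?thesis
  proof (rule that)
    show "outputs_within n w E greedy (18 * n * n * n + 21 * n * n + 7 * n + 3) B"
      unfolding outputs_within_def using u result_rep[OF B(1)]
      by (intro exI[of _ u] exI[of _ s]) (auto simp: algebra_simps)
  qed (use B in auto)
qed

section \<open>Exhaustive search for a largest clique\<close>

text \<open>
  Backtracking enumerates all cliques. The current set \<open>S\<close> and the vertex \<open>v\<close> in register \<open>1\<close>
  describe the position in the search: all elements of \<open>S\<close> are less than \<open>v\<close>, and \<open>v\<close> is the next
  vertex to be tried. When \<open>v\<close> exceeds \<open>n\<close>, the largest element \<open>m\<close> of \<open>S\<close> is removed and the
  search continues with \<open>m + 1\<close>; it ends when \<open>S\<close> is empty, which clears the flag in register \<open>10\<close>.
\<close>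

definition back_body :: com where
  "back_body = seqs [INSTR (ADD 6 0 4), INSTR (LOAD 7 6), COND (LESS 9 7)
     (seqs [INSTR (STORE 6 9), INSTR (SUB 2 2 8), INSTR (ADD 1 4 8), INSTR (LIT 10 1), INSTR (LIT 4 0)])
     (INSTR (SUB 4 4 8))]"

definition backtrack :: com where
  "backtrack = seqs [INSTR (LIT 10 0), INSTR (MOVE 4 0), LOOP (LESS 9 4) back_body]"

definition dfs_body :: com where
  "dfs_body = COND (LESS 0 1) backtrack (SEQ try_add (INSTR (ADD 1 1 8)))"

definition dfs :: com where
  "dfs = seqs [INSTR (LIT 8 1), INSTR (LIT 1 1), INSTR (LIT 10 1), LOOP (LESS 9 10) dfs_body]"

lemma triple_back_nonempty:
  assumes m: "m \<in> {1..n}" "S \<subseteq> {1..<m}"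
  shows "triple n w E (represents n v x (insert m S) B) backtrack (11 * n + 3) (represents n (Suc
      m) 1 S B)"
proof -
  define J where "J k s \<longleftrightarrow> k \<le> n \<and> fst s 4 = k \<and>
    (represents n v 0 (insert m S) B s \<and> m \<le> k \<or> represents n (Suc m) 1 S B s \<and> k = 0)" for k
        and s :: state
  have body: "triple n w E (J (Suc k)) back_body 10 (\<lambda>s. \<exists>j\<le>k. J j s)" for k
  proof (rule triple_straight)
    fix R M assume "J (Suc k) (R, M)"
    then have rep: "represents n v 0 (insert m S) B (R, M)" and k: "m \<le> Suc k" "Suc k \<le> n" "R 4 = Suc k"
      by (auto simp: J_def)
    have mem: "0 < M (n + Suc k) \<longleftrightarrow> Suc k = m"
      using represents_memory[OF rep, of "Suc k"] k m by auto
    show "\<exists>j\<le>k. J j (run n w E back_body (R, M))"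
    proof (cases "Suc k = m")
      case True
      have "finite S" "m \<notin> S" using m by (auto intro: finite_subset)
      then have "J 0 (run n w E back_body (R, M))"
        using mem True rep k m by (auto simp: J_def back_body_def represents_def)
      then show ?thesis by blast
    next
      case False
      then have "J k (run n w E back_body (R, M))"
        using mem rep k represents_registers[OF rep] by (simp add: J_def back_body_def)
      then show ?thesis by blast
    qed
  qed (simp_all add: back_body_def)
  have reg: "fst s 4 = k \<and> fst s 9 = 0" if "J k s" for k s
    using that by (cases s) (auto simp: J_def dest: represents_registers(3))
  have 1: "triple n w E (J n) (LOOP (LESS 9 4) back_body) (Suc 10 * n + 1) (J 0)"
    by (rule triple_countdown_jump[where J = J, OF body]) (rule reg)
  have 2: "triple n w E (represents n v x (insert m S) B) (INSTR (LIT 10 0)) 1 (represents n v 0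
      (insert m S) B)"
    by (rule triple_straight) (auto simp: represents_def)
  have 3: "triple n w E (represents n v 0 (insert m S) B) (INSTR (MOVE 4 0)) 1 (J n)"
  proof (rule triple_straight)
    fix R M assume rep: "represents n v 0 (insert m S) B (R, M)"
    then show "J n (run n w E (INSTR (MOVE 4 0)) (R, M))"
      using m represents_registers[OF rep] by (simp add: J_def)
  qed auto
  show ?thesis
    unfolding backtrack_def seqs.simps
    by (rule triple_conseq[OF triple_seq[OF 2 triple_seq[OF 3 1]]]) (use m in \<open>auto simp: J_def\<close>)
qed

lemma triple_back_empty:
  "triple n w E (represents n v x {} B) backtrack (11 * n + 3) (represents n v 0 {} B)"
proof -
  define J where "J k s \<longleftrightarrow> k \<le> n \<and> fst s 4 = k \<and> represents n v 0 {} B s" for k and s :: state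
  have body: "triple n w E (J (Suc k)) back_body 10 (J k)" for k
  proof (rule triple_straight)
    fix R M assume J: "J (Suc k) (R, M)"
    then have rep: "represents n v 0 {} B (R, M)" by (simp add: J_def)
    have "\<not> 0 < M (n + Suc k)"
      using represents_memory[OF rep, of "Suc k"] J by (simp add: J_def)
    then show "J k (run n w E back_body (R, M))"
      using J represents_registers[OF rep] by (simp add: J_def back_body_def)
  qed (simp_all add: back_body_def)
  have reg: "fst s 4 = k \<and> fst s 9 = 0" if "J k s" for k s
    using that by (cases s) (auto simp: J_def dest: represents_registers(3))
  have 1: "triple n w E (J n) (LOOP (LESS 9 4) back_body) (Suc 10 * n + 1) (J 0)"
    by (rule triple_countdown[where J = J, OF body]) (rule reg)
  have 2: "triple n w E (represents n v x {} B) (INSTR (LIT 10 0)) 1 (represents n v 0 {} B)"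
    by (rule triple_straight) (auto simp: represents_def)
  have 3: "triple n w E (represents n v 0 {} B) (INSTR (MOVE 4 0)) 1 (J n)"
  proof (rule triple_straight)
    fix R M assume rep: "represents n v 0 {} B (R, M)"
    then show "J n (run n w E (INSTR (MOVE 4 0)) (R, M))"
      using represents_registers[OF rep] by (simp add: J_def)
  qed auto
  show ?thesis
    unfolding backtrack_def seqs.simps
    by (rule triple_conseq[OF triple_seq[OF 2 triple_seq[OF 3 1]]]) (auto simp: J_def)
qed

text \<open>
  \<open>reach n w E T s s'\<close>: some rounds of the main loop lead from \<open>s\<close> to \<open>s'\<close> in at most \<open>T\<close> steps.
  This is stated through the runs of the whole loop from \<open>s'\<close>, which makes it transitive at once.
\<close>

definition reach :: "nat \<Rightarrow> (nat \<Rightarrow> real) \<Rightarrow> (nat \<times> nat \<Rightarrow> bool) \<Rightarrow> nat \<Rightarrow> state \<Rightarrow> state \<Rightarrow> bool" where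
  "reach n w E T s s' \<longleftrightarrow> (\<forall>u s''. exec n w E (LOOP (LESS 9 10) dfs_body) s' u s'' \<longrightarrow>
     (\<exists>t \<le> T. exec n w E (LOOP (LESS 9 10) dfs_body) s (t + u) s''))"

lemma reach_refl: "reach n w E 0 s s"
  by (auto simp: reach_def)

lemma reach_trans:
  assumes "reach n w E T s s'" "reach n w E U s' s''"
  shows "reach n w E (T + U) s s''"
  unfolding reach_def
proof (intro allI impI)
  fix u s3 assume "exec n w E (LOOP (LESS 9 10) dfs_body) s'' u s3"
  with assms(2) obtain t where t: "t \<le> U" "exec n w E (LOOP (LESS 9 10) dfs_body) s' (t + u) s3"
    unfolding reach_def by blast
  with assms(1) obtain t' where "t' \<le> T" "exec n w E (LOOP (LESS 9 10) dfs_body) s (t' + (t + u)) s3"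
    unfolding reach_def by blast
  with t show "\<exists>t\<le>T + U. exec n w E (LOOP (LESS 9 10) dfs_body) s (t + u) s3"
    by (intro exI[of _ "t' + t"]) (auto simp: add.assoc)
qed

lemma reach_step:
  assumes "represents n v 1 S B s" "triple n w E (represents n v 1 S B) dfs_body T Q" "U = Suc T"
  obtains s' where "reach n w E U s s'" "Q s'"
proof -
  from tripleD[OF assms(2,1)] obtain t s' where t: "exec n w E dfs_body s t s'" "t \<le> T" "Q s'" .
  have "holds n w E (LESS 9 10) s"
    using assms(1) by (cases s) (simp add: represents_def)
  from LoopTrue[OF this t(1)] have "reach n w E U s s'"
    unfolding reach_def assms(3) using t(2) by (intro allI impI exI[of _ "Suc t"]) simp
  with t(3) that show ?thesis by blast
qed

lemma triple_dfs_forward: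
  assumes "v \<in> {1..n}" "v \<notin> S" "card S \<le> card B"
  shows "triple n w E (represents n v 1 S B) dfs_body (18 * n + 16)
    (represents n (Suc v) 1 (extend_clique n E v S) (keep_larger (extend_clique n E v S) B))"
proof -
  have 1: "triple n w E (represents n v 1 S' B') (INSTR (ADD 1 1 8)) 1 (represents n (Suc v) 1 S'
      B')" for S' B'
    by (rule triple_straight) (auto simp: represents_def)
  have h: "\<not> holds n w E (LESS 0 1) s" if "represents n v 1 S B s" for s
    using that assms(1) by (cases s) (auto simp: represents_def)
  have "triple n w E (\<lambda>s. represents n v 1 S B s \<and> \<not> holds n w E (LESS 0 1) s)
      (SEQ try_add (INSTR (ADD 1 1 8))) (18 * n + 15)
      (represents n (Suc v) 1 (extend_clique n E v S) (keep_larger (extend_clique n E v S) B))"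
    by (rule triple_conseq[OF triple_seq[OF triple_try_add[OF assms] 1]]) auto
  moreover have "triple n w E (\<lambda>s. represents n v 1 S B s \<and>
      holds n w E (LESS 0 1) s) backtrack (18 * n + 15)
      (represents n (Suc v) 1 (extend_clique n E v S) (keep_larger (extend_clique n E v S) B))"
    using h unfolding triple_def by blast
  ultimately have "triple n w E (represents n v 1 S B) dfs_body (Suc (18 * n + 15))
      (represents n (Suc v) 1 (extend_clique n E v S) (keep_larger (extend_clique n E v S) B))"
    unfolding dfs_body_def by (intro triple_cond)
  then show ?thesis by (rule triple_conseq) simp_all
qed

lemma triple_dfs_backward:
  assumes "triple n w E (represents n (Suc n) 1 S B) backtrack (11 * n + 3) Q"
  shows "triple n w E (represents n (Suc n) 1 S B) dfs_body (18 * n + 16) Q"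
proof -
  have h: "holds n w E (LESS 0 1) s" if "represents n (Suc n) 1 S B s" for s
    using that by (cases s) (auto simp: represents_def)
  have "triple n w E (\<lambda>s. represents n (Suc n) 1 S B s \<and> \<not> holds n w E (LESS 0 1) s)
      (SEQ try_add (INSTR (ADD 1 1 8))) (18 * n + 15) Q"
    using h unfolding triple_def by blast
  moreover have "triple n w E (\<lambda>s. represents n (Suc n) 1 S B s \<and>
      holds n w E (LESS 0 1) s) backtrack (18 * n + 15) Q"
    by (rule triple_conseq[OF assms]) auto
  ultimately have "triple n w E (represents n (Suc n) 1 S B) dfs_body (Suc (18 * n + 15)) Q"
    unfolding dfs_body_def by (intro triple_cond)
  then show ?thesis by (rule triple_conseq) simp_all
qed

text \<open>The cliques that the search visits from position \<open>(S, v)\<close> before it gives up \<open>S\<close>.\<close>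

definition cliques_over :: "nat \<Rightarrow> (nat \<times> nat \<Rightarrow> bool) \<Rightarrow> nat \<Rightarrow> nat set \<Rightarrow> nat set set" where
  "cliques_over n E v S = {K. is_clique n E K \<and> K \<inter> {1..<v} = S}"

lemma finite_cliques_over [simp]: "finite (cliques_over n E v S)"
  by (rule finite_subset[OF _ finite_cliques]) (auto simp: cliques_over_def)

lemma cliques_over_Suc:
  assumes "v \<in> {1..n}" "S \<subseteq> {1..<v}"
  shows "cliques_over n E v S = cliques_over n E (Suc v) (insert v S) \<union> cliques_over n E (Suc v) S"
    and "cliques_over n E (Suc v) (insert v S) \<inter> cliques_over n E (Suc v) S = {}"
proof -
  have "{1..<Suc v} = insert v {1..<v}" using assms(1) by auto
  moreover have "v \<notin> S" using assms(2) by auto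
  ultimately have *: "K \<inter> {1..<Suc v} = insert v S \<longleftrightarrow> v \<in> K \<and> K \<inter> {1..<v} = S"
    "K \<inter> {1..<Suc v} = S \<longleftrightarrow> v \<notin> K \<and> K \<inter> {1..<v} = S" for K
    by auto
  show "cliques_over n E v S = cliques_over n E (Suc v) (insert v S) \<union> cliques_over n E (Suc v) S"
    "cliques_over n E (Suc v) (insert v S) \<inter> cliques_over n E (Suc v) S = {}"
    unfolding cliques_over_def * by auto
qed

text \<open>
  From position \<open>(S, v)\<close> the search reaches position \<open>(S, n + 1)\<close> after it has visited all cliques
  over \<open>S\<close>, in time proportional to their number times \<open>d + 2\<close>, where \<open>d\<close> vertices remain. The
  set of these cliques splits into those with \<open>v\<close> and those without, and so does the search. The
  summand on the left-hand side of the time bound pays for the two rounds that add and remove \<open>v\<close>.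
\<close>

lemma dfs_explores:
  assumes "v + d = Suc n" "1 \<le> v" "S \<subseteq> {1..<v}" "is_clique n E S" "is_clique n E B"
    "card S \<le> card B" "represents n v 1 S B s"
  shows "\<exists>B' s' T. represents n (Suc n) 1 S B' s' \<and> is_clique n E B' \<and> card B \<le> card B' \<and>
    (\<forall>K\<in>cliques_over n E v S. card K \<le> card B') \<and> reach n w E T s s' \<and>
    T + 2 * (18 * n + 17) \<le> (18 * n + 17) * (d + 2) * card (cliques_over n E v S)"
  using assms
proof (induction d arbitrary: v S B s)
  case 0
  have "cliques_over n E v S = {S}"
    using 0 by (auto simp: cliques_over_def is_clique_def)
  with 0 show ?case
    by (intro exI[of _ B] exI[of _ s] exI[of _ 0]) (auto simp: reach_refl)
next
  case (Suc d)
  let ?C = "18 * n + 17" and ?e = "extend_clique n E v S"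
  let ?N = "\<lambda>v S. card (cliques_over n E v S)"
  have C: "?C = Suc (18 * n + 16)" by simp
  have v: "v \<in> {1..n}" "v \<notin> S" and vd: "Suc v + d = Suc n" and v1: "1 \<le> Suc v"
    using Suc.prems(1-3) by auto
  from reach_step[OF Suc.prems(7) triple_dfs_forward[OF v Suc.prems(6)] C] obtain s1 where
    s1: "reach n w E ?C s s1" "represents n (Suc v) 1 ?e (keep_larger ?e B) s1" .
  have S_in: "S \<in> cliques_over n E (Suc v) S"
    using Suc.prems(3,4) by (force simp: cliques_over_def)
  then have pos: "?N (Suc v) S \<ge> 1"
    by (metis One_nat_def Suc_leI card_gt_0_iff empty_iff finite_cliques_over)
  note split = cliques_over_Suc[OF v(1) Suc.prems(3), of E]
  have N: "?N v S = ?N (Suc v) (insert v S) + ?N (Suc v) S"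
    unfolding split(1) by (rule card_Un_disjoint) (use split(2) in auto)
  have kB: "is_clique n E (keep_larger ?e B)" "card ?e \<le> card (keep_larger ?e B)" "card B \<le>
      card (keep_larger ?e B)"
    using Suc.prems v by (auto intro!: is_clique_keep_larger is_clique_extend_clique card_keep_larger)
  show ?case
  proof (cases "is_clique n E (insert v S)")
    case True
    then have e: "?e = insert v S" using Suc.prems v by (simp add: extend_clique_eq)
    have "insert v S \<subseteq> {1..<Suc v}" using Suc.prems(3) v(1) by auto
    from Suc.IH[OF vd v1 this True kB(1)[unfolded e] kB(2)[unfolded e] s1(2)[unfolded e]]
    obtain B2 s2 T2 where
      2: "represents n (Suc n) 1 (insert v S) B2 s2" "is_clique n E B2" "card (keep_larger (insert
          v S) B) \<le> card B2"
      "\<forall>K\<in>cliques_over n E (Suc v) (insert v S). card K \<le> card B2" "reach n w E T2 s1 s2"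
      "T2 + 2 * ?C \<le> ?C * (d + 2) * ?N (Suc v) (insert v S)"
      by blast
    from reach_step[OF 2(1) triple_dfs_backward[OF triple_back_nonempty[OF v(1) Suc.prems(3)]] C]
    obtain s3 where 3: "reach n w E ?C s2 s3" "represents n (Suc v) 1 S B2 s3" .
    have SB: "card S \<le> card B2" "S \<subseteq> {1..<Suc v}"
      using Suc.prems(3,6) kB(3) 2(3) unfolding e by auto
    from Suc.IH[OF vd v1 SB(2) Suc.prems(4) 2(2) SB(1) 3(2)] obtain B4 s4 T4 where
      4: "represents n (Suc n) 1 S B4 s4" "is_clique n E B4" "card B2 \<le> card B4"
      "\<forall>K\<in>cliques_over n E (Suc v) S. card K \<le> card B4" "reach n w E T4 s3 s4"
      "T4 + 2 * ?C \<le> ?C * (d + 2) * ?N (Suc v) S"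
      by blast
    have "reach n w E (?C + (T2 + (?C + T4))) s s4"
      by (intro reach_trans[OF s1(1)] reach_trans[OF 2(5)] reach_trans[OF 3(1)] 4(5))
    moreover have "?C + (T2 + (?C + T4)) + 2 * ?C \<le> ?C * (Suc d + 2) * ?N v S"
    proof -
      have "?C + (T2 + (?C + T4)) + 2 * ?C = (T2 + 2 * ?C) + (T4 + 2 * ?C)" by simp
      also have "\<dots> \<le> ?C * (d + 2) * ?N (Suc v) (insert v S) + ?C * (d + 2) * ?N (Suc v) S"
        by (rule add_mono[OF 2(6) 4(6)])
      also have "\<dots> = ?C * (d + 2) * ?N v S" unfolding N by (simp only: distrib_left)
      also have "\<dots> \<le> ?C * (Suc d + 2) * ?N v S" by (intro mult_le_mono) auto
      finally show ?thesis .
    qed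
    moreover have "card K \<le> card B4" if "K \<in> cliques_over n E v S" for K
      using that 2(4) 4(3,4) unfolding split(1) by (meson UnE order_trans)
    ultimately show ?thesis
      using 4(1,2,3) 2(3) kB(3) unfolding e by (meson order_trans)
  next
    case False
    then have e: "?e = S" using Suc.prems v by (simp add: extend_clique_eq)
    have none: "cliques_over n E (Suc v) (insert v S) = {}"
    proof -
      have "is_clique n E (insert v S)" if "is_clique n E K" "K \<inter> {1..<Suc v} = insert v S" for K
        using that(1) by (rule is_clique_subset) (use that(2) in blast)
      with False show ?thesis by (auto simp: cliques_over_def)
    qed
    have SB: "card S \<le> card (keep_larger S B)" "S \<subseteq> {1..<Suc v}"
      using Suc.prems(3) kB(2) unfolding e by auto
    from Suc.IH[OF vd v1 SB(2) Suc.prems(4) kB(1)[unfolded e] SB(1) s1(2)[unfolded e]]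
        obtain B4 s4 T4 where
      4: "represents n (Suc n) 1 S B4 s4" "is_clique n E B4" "card (keep_larger S B) \<le> card B4"
      "\<forall>K\<in>cliques_over n E (Suc v) S. card K \<le> card B4" "reach n w E T4 s1 s4"
      "T4 + 2 * ?C \<le> ?C * (d + 2) * ?N (Suc v) S"
      by blast
    have "reach n w E (?C + T4) s s4"
      by (intro reach_trans[OF s1(1)] 4(5))
    moreover have "?C + T4 + 2 * ?C \<le> ?C * (Suc d + 2) * ?N v S"
    proof -
      have "?C * 1 \<le> ?C * ?N (Suc v) S" using pos by (rule mult_le_mono2)
      then have "?C * 1 + (T4 + 2 * ?C) \<le> ?C * ?N (Suc v) S + ?C * (d + 2) * ?N (Suc v) S"
        using 4(6) by (rule add_mono)
      also have "\<dots> = ?C * (Suc d + 2) * ?N v S"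
        unfolding N none by (simp add: algebra_simps)
      finally show ?thesis by simp
    qed
    moreover have "card K \<le> card B4" if "K \<in> cliques_over n E v S" for K
      using that 4(4) none unfolding split(1) by blast
    ultimately show ?thesis
      using 4(1,2,3) kB(3) unfolding e by (meson order_trans)
  qed
qed

theorem dfs_correct:
  obtains K where
    "outputs_within n w E dfs ((18 * n + 17) * (n + 2) * card {K. is_clique n E K} + 4) K"
    "is_clique n E K" "card K = clique_number n E"
proof -
  let ?C = "18 * n + 17" and ?loop = "LOOP (LESS 9 10) dfs_body"
  let ?N = "card {K. is_clique n E K}"
  have 1: "triple n w E (\<lambda>s. s = start n) (INSTR (LIT 8 1)) 1 (represents n 0 0 {} {})"
    using represents_start[of n] by (intro triple_straight) (auto simp: start_def)
  have 2: "triple n w E (represents n 0 0 {} {}) (INSTR (LIT 1 1)) 1 (represents n 1 0 {} {})"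
    by (rule triple_straight) (auto simp: represents_def)
  have 3: "triple n w E (represents n 1 0 {} {}) (INSTR (LIT 10 1)) 1 (represents n 1 1 {} {})"
    by (rule triple_straight) (auto simp: represents_def)
  have 4: "triple n w E (represents n 1 1 {} {}) ?loop (?C * (n + 2) * ?N + 1)
    (\<lambda>s. \<exists>B. represents n (Suc n) 0 {} B s \<and> is_clique n E B \<and> (\<forall>K. is_clique n E K \<longrightarrow> card K \<le> card B))"
  proof (rule tripleI)
    fix s assume s: "represents n 1 1 {} {} s"
    have all: "cliques_over n E 1 {} = {K. is_clique n E K}"
      by (simp add: cliques_over_def)
    from dfs_explores[of 1 n n "{}" E "{}" s w] s obtain B s' T where
      B: "represents n (Suc n) 1 {} B s'" "is_clique n E B"
      "\<forall>K\<in>cliques_over n E 1 {}. card K \<le> card B" "reach n w E T s s'"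
      "T + 2 * ?C \<le> ?C * (n + 2) * card (cliques_over n E 1 {})"
      by auto
    from reach_step[OF B(1) triple_dfs_backward[OF triple_back_empty] refl] obtain s3 where
      3: "reach n w E (Suc (18 * n + 16)) s' s3" "represents n (Suc n) 0 {} B s3" .
    have "\<not> holds n w E (LESS 9 10) s3"
      using 3(2) by (cases s3) (auto simp: represents_def)
    then have "exec n w E ?loop s3 1 s3" by (rule LoopFalse)
    with reach_trans[OF B(4) 3(1)] obtain t where
      t: "t \<le> T + Suc (18 * n + 16)" "exec n w E ?loop s (t + 1) s3"
      unfolding reach_def by blast
    show "\<exists>t s'. exec n w E ?loop s t s' \<and> t \<le> ?C * (n + 2) * ?N + 1 \<and>
      (\<exists>B. represents n (Suc n) 0 {} B s' \<and> is_clique n E B \<and> (\<forall>K. is_clique n E K \<longrightarrow> card K \<le> card B))"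
      using t 3(2) B(2,3,5) unfolding all
      by (intro exI[of _ "t + 1"] exI[of _ s3] conjI exI[of _ B]) auto
  qed
  from triple_seq[OF 1 triple_seq[OF 2 triple_seq[OF 3 4]]]
  obtain u s where u: "exec n w E dfs (start n) u s" "u \<le> 1 + (1 + (1 + (?C * (n + 2) * ?N + 1)))"
    "\<exists>B. represents n (Suc n) 0 {} B s \<and> is_clique n E B \<and> (\<forall>K. is_clique n E K \<longrightarrow> card K \<le> card B)"
    unfolding dfs_def seqs.simps by (rule tripleD) simp
  from u(3) obtain B where B: "represents n (Suc n) 0 {} B s" "is_clique n E B"
    "\<And>K. is_clique n E K \<Longrightarrow> card K \<le> card B" by blast
  show ?thesis
  proof (rule that)
    show "outputs_within n w E dfs (?C * (n + 2) * ?N + 4) B"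
      unfolding outputs_within_def using u result_rep[OF B(1)]
      by (intro exI[of _ u] exI[of _ s]) auto
    show "card B = clique_number n E"
      unfolding clique_number_def using B(2,3) by (intro Max_eqI[symmetric]) auto
  qed (rule B(2))
qed

section \<open>The event of success\<close>

text \<open>
  A program inspects the weights only through comparisons. Hence its success depends only on the
  order of the weights, of which there are finitely many, and on the graph. This makes the event
  of success measurable.
\<close>

definition same_order :: "nat \<Rightarrow> (nat \<Rightarrow> real) \<Rightarrow> (nat \<Rightarrow> real) \<Rightarrow> bool" where
  "same_order n w w' \<longleftrightarrow> (\<forall>i\<in>{1..n}. \<forall>j\<in>{1..n}. w i < w j \<longleftrightarrow> w' i < w' j)"

lemma same_order_sym: "same_order n w w' \<Longrightarrow> same_order n w' w"
  by (simp add: same_order_def)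

lemma holds_same_order:
  assumes "same_order n w w'"
  shows "holds n w E b s \<longleftrightarrow> holds n w' E b s"
proof (cases s)
  case (Pair R M)
  with assms show ?thesis by (cases b) (auto simp: same_order_def)
qed

lemma exec_same_order:
  assumes "exec n w E c s t s'" "same_order n w w'"
  shows "exec n w' E c s t s'"
  using assms(1)
proof (induction rule: exec.induct)
  case (CondTrue b s c t s' d)
  then show ?case using holds_same_order[OF assms(2)] by (auto intro: exec.CondTrue)
next
  case (CondFalse b s d t s' c)
  then show ?case using holds_same_order[OF assms(2)] by (auto intro: exec.CondFalse)
next
  case (LoopFalse b s c)
  then show ?case using holds_same_order[OF assms(2)] by (metis exec.LoopFalse)
next
  case (LoopTrue b s c t s1 u s2)
  have "holds n w' E b s" using LoopTrue.hyps(1) holds_same_order[OF assms(2)] by simp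
  then show ?case using LoopTrue.IH by (rule exec.LoopTrue)
qed (rule exec.Skip exec.Instr exec.Seq; assumption)+

lemma outputs_within_same_order:
  assumes "same_order n w w'"
  shows "outputs_within n w E c T K \<longleftrightarrow> outputs_within n w' E c T K"
  unfolding outputs_within_def
  using exec_same_order[OF _ assms] exec_same_order[OF _ same_order_sym[OF assms]] by blast

lemma sets_order_event:
  assumes P: "\<And>w w' E. same_order n w w' \<Longrightarrow> P w E \<longleftrightarrow> P w' E"
  shows "{x \<in> space (graph_space n). case x of (w, E) \<Rightarrow> P w E} \<in> sets (graph_space n)"
proof -
  let ?W = "\<Pi>\<^sub>M i\<in>{1..n}. (borel :: real measure)"
  let ?I = "{1..n} \<times> {1..n}"
  define C where "C R = {w \<in> space ?W. \<forall>(i, j)\<in>?I. w i < w j \<longleftrightarrow> (i, j) \<in> R}" for R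
  have C: "C R \<in> sets ?W" for R
  proof -
    have "{w \<in> space ?W. w i < w j \<longleftrightarrow> (i, j) \<in> R} \<in> sets ?W" if "(i, j) \<in> ?I" for i j
    proof -
      have [measurable]: "(\<lambda>w. w i) \<in> borel_measurable ?W" "(\<lambda>w. w j) \<in> borel_measurable ?W"
        using that by (auto intro: measurable_component_singleton)
      show ?thesis by measurable
    qed
    then have "{w \<in> space ?W. \<forall>x\<in>?I. w (fst x) < w (snd x) \<longleftrightarrow> x \<in> R} \<in> sets ?W"
      by (intro sets.sets_Collect_finite_All) auto
    then show ?thesis by (simp add: C_def case_prod_beta)
  qed
  have same: "same_order n w w'" if "w \<in> C R" "w' \<in> C R" for w w' R
    using that by (auto simp: C_def same_order_def)
  have "{x \<in> space (graph_space n). case x of (w, E) \<Rightarrow> P w E} =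
      (\<Union>R\<in>Pow ?I. C R \<times> {E. \<exists>w\<in>C R. P w E})" (is "?X = ?Y")
  proof (intro set_eqI iffI)
    fix x assume "x \<in> ?X"
    then obtain w E where x: "x = (w, E)" "w \<in> space ?W" "P w E"
      by (auto simp: graph_space_def space_pair_measure)
    define R where "R = {(i, j) \<in> ?I. w i < w j}"
    have w: "w \<in> C R" and R: "R \<in> Pow ?I"
      using x(2) by (auto simp: C_def R_def)
    show "x \<in> ?Y" unfolding x(1)
      by (rule UN_I[OF R], rule SigmaI[OF w], rule CollectI, rule bexI[where x = w], rule x(3), rule w)
  next
    fix x assume "x \<in> ?Y"
    then obtain R w E w' where x: "x = (w, E)" "w \<in> C R" "w' \<in> C R" "P w' E" by auto
    have "P w E" using P[OF same[OF x(2,3)]] x(4) by simp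
    moreover have "w \<in> space ?W" using x(2) by (simp add: C_def)
    ultimately show "x \<in> ?X" using x(1) by (simp add: graph_space_def space_pair_measure)
  qed
  also have "\<dots> \<in> sets (graph_space n)"
    unfolding graph_space_def by (intro sets.finite_UN pair_measureI C) auto
  finally show ?thesis .
qed

text \<open>
  The probability of failure is at most the mean of any bound \<open>h\<close> on the conditional probability
  of failure given the weights.
\<close>

lemma prob_weighted_graph_ge:
  assumes D: "prob_space D" "sets D = sets borel"
    and X: "{x \<in> space (graph_space n). case x of (w, E) \<Rightarrow> P w E} \<in> sets (graph_space n)"
    and h: "AE w in (\<Pi>\<^sub>M i\<in>{1..n}. D). emeasure (measure_pmf (edges_pmf b n w)) {E. \<not> P w E} \<le> h w"
    and r: "(\<integral>\<^sup>+ w. h w \<partial>(\<Pi>\<^sub>M i\<in>{1..n}. D)) \<le> ennreal r" "0 \<le> r"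
  shows "\<P>((w, E) in weighted_graph D b n. P w E) \<ge> 1 - r"
proof -
  let ?M = "weighted_graph D b n" and ?X = "{x \<in> space (graph_space n). case x of (w, E) \<Rightarrow> P w E}"
  interpret prob_space ?M by (rule prob_space_weighted_graph[OF D])
  have sets: "sets ?M = sets (graph_space n)" by (rule sets_weighted_graph[OF D])
  then have space: "space ?M = space (graph_space n)" by (rule sets_eq_imp_space_eq)
  have "emeasure ?M (space (graph_space n) - ?X) =
      (\<integral>\<^sup>+ w. emeasure (measure_pmf (edges_pmf b n w)) {E.
          (w, E) \<in> space (graph_space n) - ?X} \<partial>(\<Pi>\<^sub>M i\<in>{1..n}. D))"
    using X by (intro emeasure_weighted_graph D) auto
  also have "\<dots> \<le> (\<integral>\<^sup>+ w. h w \<partial>(\<Pi>\<^sub>M i\<in>{1..n}. D))"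
  proof (rule nn_integral_mono_AE)
    show "AE w in (\<Pi>\<^sub>M i\<in>{1..n}. D).
        emeasure (measure_pmf (edges_pmf b n w)) {E. (w, E) \<in> space (graph_space n) - ?X} \<le> h w"
      using h
    proof eventually_elim
      case (elim w)
      have "emeasure (measure_pmf (edges_pmf b n w)) {E. (w, E) \<in> space (graph_space n) - ?X} \<le>
          emeasure (measure_pmf (edges_pmf b n w)) {E. \<not> P w E}"
        by (intro emeasure_mono) auto
      with elim show ?case by (rule order_trans[rotated])
    qed
  qed
  also note r(1)
  finally have "emeasure ?M (space ?M - ?X) \<le> ennreal r" by (simp only: space)
  then have "prob (space ?M - ?X) \<le> r"
    using r(2) by (simp add: emeasure_eq_measure)
  moreover have "prob (space ?M - ?X) = 1 - prob ?X"
    using X sets by (intro prob_compl) simp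
  moreover have "{(w, E). (w, E) \<in> space (graph_space n) \<and> P w E} = ?X" by auto
  ultimately show ?thesis unfolding space by simp
qed

text \<open>The same with an exceptional set \<open>B\<close> of weights, for which nothing is claimed.\<close>

lemma prob_weighted_graph_ge_outside:
  assumes D: "prob_space D" "sets D = sets borel"
    and X: "{x \<in> space (graph_space n). case x of (w, E) \<Rightarrow> P w E} \<in> sets (graph_space n)"
    and B: "B \<in> sets (\<Pi>\<^sub>M i\<in>{1..n}. D)" "measure (\<Pi>\<^sub>M i\<in>{1..n}. D) B \<le> r"
    and h: "h \<in> borel_measurable (\<Pi>\<^sub>M i\<in>{1..n}. D)" "(\<integral>\<^sup>+ w. h w \<partial>(\<Pi>\<^sub>M i\<in>{1..n}. D)) \<le>
        ennreal r'" "0 \<le> r'"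
    and le: "AE w in (\<Pi>\<^sub>M i\<in>{1..n}. D). w \<notin> B \<longrightarrow>
      emeasure (measure_pmf (edges_pmf b n w)) {E. \<not> P w E} \<le> h w"
  shows "\<P>((w, E) in weighted_graph D b n. P w E) \<ge> 1 - (r + r')"
proof (rule prob_weighted_graph_ge[OF D X])
  let ?M = "\<Pi>\<^sub>M i\<in>{1..n}. D"
  interpret prob_space ?M by (intro prob_space_PiM D(1))
  show "AE w in ?M. emeasure (measure_pmf (edges_pmf b n w)) {E. \<not> P w E} \<le> indicator B w + h w"
    using le
  proof eventually_elim
    case (elim w)
    show ?case
    proof (cases "w \<in> B")
      case True
      have "emeasure (measure_pmf (edges_pmf b n w)) {E. \<not> P w E} \<le> 1"
        by (rule measure_pmf.emeasure_le_1)
      also have "\<dots> \<le> indicator B w + h w" using True by simp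
      finally show ?thesis .
    qed (use elim in simp)
  qed
  have "(\<integral>\<^sup>+ w. indicator B w + h w \<partial>?M) = emeasure ?M B + (\<integral>\<^sup>+ w. h w \<partial>?M)"
    using B(1) h(1) by (subst nn_integral_add) auto
  also have "\<dots> \<le> ennreal r + ennreal r'"
    unfolding emeasure_eq_measure by (intro add_mono ennreal_leI B(2) h(2))
  also have "\<dots> = ennreal (r + r')"
    using h(3) order_trans[OF measure_nonneg B(2)] by (simp add: ennreal_plus)
  finally show "(\<integral>\<^sup>+ w. indicator B w + h w \<partial>?M) \<le> ennreal (r + r')" .
  show "0 \<le> r + r'" using h(3) order_trans[OF measure_nonneg B(2)] by simp
qed

text \<open>
  The program \<open>c\<close> outputs within \<open>poly q n\<close> steps a clique that is optimal up to a factor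
  \<open>1 - \<epsilon>\<close>.
\<close>

definition succeeds :: "com \<Rightarrow> nat poly \<Rightarrow> real \<Rightarrow> nat \<Rightarrow> (nat \<Rightarrow> real) \<Rightarrow> (nat \<times> nat \<Rightarrow> bool) \<Rightarrow> bool" where
  "succeeds c q \<epsilon> n w E \<longleftrightarrow> (\<exists>K. outputs_within n w E c (poly q n) K \<and> is_clique n E K \<and>
     real (card K) \<ge> (1 - \<epsilon>) * real (clique_number n E))"

lemma sets_succeeds:
  "{x \<in> space (graph_space n). case x of (w, E) \<Rightarrow> succeeds c q \<epsilon> n w E} \<in> sets (graph_space n)"
proof (rule sets_order_event)
  fix w w' E assume "same_order n w w'"
  from outputs_within_same_order[OF this]
  show "succeeds c q \<epsilon> n w E \<longleftrightarrow> succeeds c q \<epsilon> n w' E" by (simp add: succeeds_def)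
qed

lemma outputs_within_mono:
  "outputs_within n w E c T K \<Longrightarrow> T \<le> T' \<Longrightarrow> outputs_within n w E c T' K"
  unfolding outputs_within_def using order_trans by blast

section \<open>Edges and cliques for given weights\<close>

text \<open>The pairs of elements of \<open>K\<close>, each in increasing order.\<close>

definition pairs_in :: "nat set \<Rightarrow> (nat \<times> nat) set" where
  "pairs_in K = {(i, j). i \<in> K \<and> j \<in> K \<and> i < j}"

lemma finite_pairs_in [simp]: "finite K \<Longrightarrow> finite (pairs_in K)"
  by (rule finite_subset[of _ "K \<times> K"]) (auto simp: pairs_in_def)

lemma pairs_in_vertex_pairs: "K \<subseteq> {1..n} \<Longrightarrow> pairs_in K \<subseteq> vertex_pairs n"
  by (auto simp: pairs_in_def vertex_pairs_def)

lemma card_pairs_in: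
  assumes "finite K"
  shows "2 * card (pairs_in K) = card K * (card K - 1)"
proof -
  let ?D = "(\<lambda>i. (i, i)) ` K"
  have fin: "finite (pairs_in K)" using assms by simp
  have disj: "pairs_in K \<inter> prod.swap ` pairs_in K = {}" "(pairs_in K \<union> prod.swap ` pairs_in K) \<inter>
      ?D = {}"
    by (auto simp: pairs_in_def)
  have "K \<times> K = (pairs_in K \<union> prod.swap ` pairs_in K) \<union> ?D"
    by (force simp: pairs_in_def image_iff)
  moreover have "card ((pairs_in K \<union> prod.swap ` pairs_in K) \<union> ?D) =
      card (pairs_in K \<union> prod.swap ` pairs_in K) + card ?D"
    using assms fin disj by (intro card_Un_disjoint) auto
  moreover have "card (pairs_in K \<union> prod.swap ` pairs_in K) =
      card (pairs_in K) + card (prod.swap ` pairs_in K)"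
    using assms fin disj by (intro card_Un_disjoint) auto
  moreover have "card (prod.swap ` pairs_in K) = card (pairs_in K)" "card ?D = card K"
    by (auto intro!: card_image inj_onI)
  ultimately have "card K * card K = 2 * card (pairs_in K) + card K"
    by (metis card_cartesian_product mult_2)
  then show ?thesis by (simp add: diff_mult_distrib2)
qed

lemma is_clique_iff_pairs:
  assumes "K \<subseteq> {1..n}"
  shows "is_clique n E K \<longleftrightarrow> (\<forall>p\<in>pairs_in K. E p)"
proof -
  have "adjacent n E i j \<longleftrightarrow> E (i, j)" if "i \<in> K" "j \<in> K" "i < j" for i j
    using that assms by (auto simp: adjacent_def vertex_pairs_def)
  moreover have "(\<forall>i\<in>K. \<forall>j\<in>K. i \<noteq> j \<longrightarrow> adjacent n E i j) \<longleftrightarrow>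
      (\<forall>i\<in>K. \<forall>j\<in>K. i < j \<longrightarrow> adjacent n E i j)"
    by (metis adjacent_sym linorder_neqE_nat less_irrefl)
  ultimately show ?thesis
    using assms by (auto simp: is_clique_def pairs_in_def)
qed

text \<open>
  The conditional probability of the edge \<open>(i, j)\<close> given the weights \<open>w\<close>, provided that these are
  nonnegative.
\<close>

definition edge_prob :: "real \<Rightarrow> nat \<Rightarrow> (nat \<Rightarrow> real) \<Rightarrow> nat \<times> nat \<Rightarrow> real" where
  "edge_prob b n w = (\<lambda>(i, j). 1 - exp (- (b * w i * w j / real n)))"

lemma edge_prob_bounds:
  assumes "b > 0" "w i \<ge> 0" "w j \<ge> 0"
  shows "0 \<le> edge_prob b n w (i, j)" "edge_prob b n w (i, j) \<le> 1"
    "edge_prob b n w (i, j) \<le> b * w i * w j / real n"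
  using assms exp_ge_add_one_self[of "- (b * w i * w j / real n)"]
  by (auto simp: edge_prob_def)

lemma prob_all_edges:
  assumes "P \<subseteq> vertex_pairs n" "b > 0" "\<And>i. i \<in> {1..n} \<Longrightarrow> w i \<ge> 0"
  shows "measure_pmf.prob (edges_pmf b n w) {E. \<forall>p\<in>P. E p} = (\<Prod>p\<in>P. edge_prob b n w p)"
proof -
  let ?B = "\<lambda>p. if p \<in> P then {True} else UNIV"
  have "{E. \<forall>p\<in>P. E p} = Pi (vertex_pairs n) ?B"
    using assms(1) by (auto simp: Pi_iff split: if_splits)
  then have "measure_pmf.prob (edges_pmf b n w) {E. \<forall>p\<in>P. E p} =
      (\<Prod>p\<in>vertex_pairs n. measure_pmf.prob (case p of (i, j) \<Rightarrow>
         bernoulli_pmf (1 - exp (- (b * w i * w j / real n)))) (?B p))"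
    unfolding edges_pmf_def by (simp add: measure_Pi_pmf_Pi)
  also have "\<dots> = (\<Prod>p\<in>vertex_pairs n. if p \<in> P then edge_prob b n w p else 1)"
  proof (rule prod.cong[OF refl])
    fix p assume p: "p \<in> vertex_pairs n"
    obtain i j where ij: "p = (i, j)" by (cases p)
    have "0 \<le> edge_prob b n w p" "edge_prob b n w p \<le> 1"
      unfolding ij using p assms by (auto intro!: edge_prob_bounds simp: ij vertex_pairs_def)
    then show "measure_pmf.prob (case p of (i, j) \<Rightarrow>
         bernoulli_pmf (1 - exp (- (b * w i * w j / real n)))) (?B p) =
        (if p \<in> P then edge_prob b n w p else 1)"
      by (auto simp: ij edge_prob_def measure_pmf_single pmf_bernoulli_clamp)
  qed
  also have "\<dots> = (\<Prod>p\<in>P. edge_prob b n w p)"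
    using assms(1) by (simp add: prod.If_cases Int_absorb1)
  finally show ?thesis .
qed

lemma prob_no_edge:
  assumes "p \<in> vertex_pairs n" "b > 0" "\<And>i. i \<in> {1..n} \<Longrightarrow> w i \<ge> 0"
  shows "measure_pmf.prob (edges_pmf b n w) {E. \<not> E p} = 1 - edge_prob b n w p"
proof -
  have "measure_pmf.prob (edges_pmf b n w) (space (measure_pmf (edges_pmf b n w)) - {E. \<forall>q\<in>{p}. E q}) =
      1 - measure_pmf.prob (edges_pmf b n w) {E. \<forall>q\<in>{p}. E q}"
    by (rule measure_pmf.prob_compl) simp
  also have "\<dots> = 1 - edge_prob b n w p"
    using assms by (subst prob_all_edges) auto
  finally show ?thesis by (simp add: set_diff_eq)
qed

text \<open>Markov's inequality for the number of missing edges in a set \<open>H\<close>.\<close>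

lemma prob_many_nonedges:
  assumes "H \<subseteq> {1..n}" "b > 0" "\<And>i. i \<in> {1..n} \<Longrightarrow> w i \<ge> 0"
    and q: "\<And>i j. i \<in> H \<Longrightarrow> j \<in> H \<Longrightarrow> exp (- (b * w i * w j / real n)) \<le> q" and x: "x > 0"
  shows "measure_pmf.prob (edges_pmf b n w) {E. real (card {p \<in> pairs_in H. \<not> E p}) \<ge> x} \<le>
    real (card H) ^ 2 * q / x"
proof -
  let ?M = "measure_pmf (edges_pmf b n w)"
  have fH: "finite H" using assms(1) finite_subset by blast
  have eq: "real (card {p \<in> pairs_in H. \<not> E p}) = (\<Sum>p\<in>pairs_in H. indicator {E. \<not> E p} E)" for E
  proof -
    have "real (card {p \<in> pairs_in H. \<not> E p}) = (\<Sum>p\<in>{p \<in> pairs_in H. \<not> E p}. 1)" by simp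
    also have "\<dots> = (\<Sum>p\<in>pairs_in H. if \<not> E p then 1 else 0)"
      using fH by (intro sum.inter_filter) simp
    also have "\<dots> = (\<Sum>p\<in>pairs_in H. indicator {E. \<not> E p} E)"
      by (intro sum.cong) (auto simp: indicator_def)
    finally show ?thesis .
  qed
  have int: "integrable ?M (\<lambda>E. real (card {p \<in> pairs_in H. \<not> E p}))"
    unfolding eq by (intro Bochner_Integration.integrable_sum
        measure_pmf.integrable_const_bound[where B = 1])
      (auto simp: indicator_def)
  have "measure_pmf.prob (edges_pmf b n w) {E \<in> space ?M. real (card {p \<in> pairs_in H. \<not> E p}) \<ge> x} \<le>
      (\<integral>E. real (card {p \<in> pairs_in H. \<not> E p}) \<partial>?M) / x"
    using x by (intro integral_Markov_inequality_measure[OF int, where A = "space ?M"]) auto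
  also have "(\<integral>E. real (card {p \<in> pairs_in H. \<not> E p}) \<partial>?M) = (\<Sum>p\<in>pairs_in H.
      measure_pmf.prob (edges_pmf b n w) {E. \<not> E p})"
    unfolding eq by (subst Bochner_Integration.integral_sum)
      (auto intro!: measure_pmf.integrable_const_bound[where B = 1] simp: indicator_def)
  also have "\<dots> \<le> (\<Sum>p\<in>pairs_in H. q)"
  proof (rule sum_mono)
    fix p assume p: "p \<in> pairs_in H"
    then have "p \<in> vertex_pairs n" using pairs_in_vertex_pairs[OF assms(1)] by blast
    then show "measure_pmf.prob (edges_pmf b n w) {E. \<not> E p} \<le> q"
      using assms(2,3) p by (subst prob_no_edge) (auto simp: edge_prob_def pairs_in_def intro!: q)
  qed
  also have "\<dots> = real (card (pairs_in H)) * q" by simp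
  also have "\<dots> \<le> real (card H) ^ 2 * q"
  proof (cases "pairs_in H = {}")
    case False
    then obtain i j where "i \<in> H" "j \<in> H" by (auto simp: pairs_in_def)
    from q[OF this] have "q \<ge> 0" using exp_ge_zero order_trans by blast
    moreover have "card (pairs_in H) \<le> card (H \<times> H)"
      using fH by (intro card_mono) (auto simp: pairs_in_def)
    then have "real (card (pairs_in H)) \<le> real (card H) ^ 2"
      by (simp add: card_cartesian_product power2_eq_square flip: of_nat_mult)
    ultimately show ?thesis by (intro mult_right_mono)
  next
    case True
    show ?thesis
    proof (cases "H = {}")
      case False
      then obtain i where "i \<in> H" by auto
      from q[OF this this] have "q \<ge> 0" using exp_ge_zero order_trans by blast
      then show ?thesis using True by simp
    qed (simp add: pairs_in_def)
  qed
  finally show ?thesis using x by (simp add: divide_right_mono)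
qed

text \<open>
  First moment method: if each pair in \<open>L\<close> is non-adjacent with probability at least \<open>q\<close>, each of
  the at most \<open>n ^ m\<close> subsets of \<open>L\<close> of size \<open>m\<close> is a clique with probability at most
  \<open>exp (- q * m * (m - 1) / 2)\<close>.
\<close>

lemma prob_large_clique:
  assumes "L \<subseteq> {1..n}" "b > 0" "\<And>i. i \<in> {1..n} \<Longrightarrow> w i \<ge> 0"
    and q: "\<And>i j. i \<in> L \<Longrightarrow> j \<in> L \<Longrightarrow> exp (- (b * w i * w j / real n)) \<ge> q" and q01: "0 \<le> q" "q \<le> 1"
    and n: "n > 0" and m: "m > 0"
  shows "measure_pmf.prob (edges_pmf b n w) {E. \<exists>K\<subseteq>L. is_clique n E K \<and> card K \<ge> m} \<le>
    exp (real m * (ln (real n) - q * (real m - 1) / 2))"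
proof -
  let ?M = "measure_pmf (edges_pmf b n w)"
  let ?KK = "{K. K \<subseteq> L \<and> card K = m}"
  have fL: "finite L" using assms(1) finite_subset by blast
  then have fKK: "finite ?KK" by simp
  have "{E. \<exists>K\<subseteq>L. is_clique n E K \<and> card K \<ge> m} \<subseteq> (\<Union>K\<in>?KK. {E. \<forall>p\<in>pairs_in K. E p})"
  proof
    fix E assume "E \<in> {E. \<exists>K\<subseteq>L. is_clique n E K \<and> card K \<ge> m}"
    then obtain K where K: "K \<subseteq> L" "is_clique n E K" "m \<le> card K" by blast
    \<comment> \<open>a clique with at least \<open>m\<close> elements contains one with exactly \<open>m\<close>\<close>
    then obtain K' where K': "K' \<subseteq> K" "card K' = m" using obtain_subset_with_card_n by metis
    then have "is_clique n E K'" using K(2) by (auto simp: is_clique_def)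
    then have "\<forall>p\<in>pairs_in K'. E p"
      using is_clique_iff_pairs[of K' n E] K' K(1) assms(1) by blast
    then show "E \<in> (\<Union>K\<in>?KK. {E. \<forall>p\<in>pairs_in K. E p})" using K' K(1) by blast
  qed
  then have "measure_pmf.prob (edges_pmf b n w) {E. \<exists>K\<subseteq>L. is_clique n E K \<and> card K \<ge> m} \<le>
      measure_pmf.prob (edges_pmf b n w) (\<Union>K\<in>?KK. {E. \<forall>p\<in>pairs_in K. E p})"
    by (intro measure_pmf.finite_measure_mono) auto
  also have "\<dots> \<le> (\<Sum>K\<in>?KK. measure_pmf.prob (edges_pmf b n w) {E. \<forall>p\<in>pairs_in K. E p})"
    by (intro measure_pmf.finite_measure_subadditive_finite fKK) auto
  also have "\<dots> \<le> (\<Sum>K\<in>?KK. exp (- q * (real m * (real m - 1) / 2)))"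
  proof (rule sum_mono)
    fix K assume K: "K \<in> ?KK"
    then have fK: "finite K" using fL finite_subset by blast
    have Kn: "K \<subseteq> {1..n}" using K assms(1) by auto
    have "measure_pmf.prob (edges_pmf b n w) {E. \<forall>p\<in>pairs_in K. E p} = (\<Prod>p\<in>pairs_in K.
        edge_prob b n w p)"
      by (intro prob_all_edges pairs_in_vertex_pairs Kn assms)
    also have "\<dots> \<le> (\<Prod>p\<in>pairs_in K. exp (- q))"
    proof (rule prod_mono)
      fix p assume "p \<in> pairs_in K"
      then obtain i j where p: "p = (i, j)" "i \<in> K" "j \<in> K"
        by (auto simp: pairs_in_def)
      have ij: "p = (i, j)" "i \<in> L" "j \<in> L" "i \<in> {1..n}" "j \<in> {1..n}"
        using p K Kn by blast+
      have "edge_prob b n w p \<le> 1 - q" using q[OF ij(2,3)] by (simp add: ij(1) edge_prob_def)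
      also have "\<dots> \<le> exp (- q)" using exp_ge_add_one_self[of "- q"] by simp
      finally show "0 \<le> edge_prob b n w p \<and> edge_prob b n w p \<le> exp (- q)"
        using edge_prob_bounds(1)[of b w i j n] assms(2,3) ij by simp
    qed
    also have "\<dots> = exp (- q * real (card (pairs_in K)))"
      by (simp add: exp_of_nat_mult[symmetric] mult.commute)
    also have "real (card (pairs_in K)) = real m * (real m - 1) / 2"
    proof -
      have "2 * card (pairs_in K) = m * (m - 1)" using card_pairs_in[OF fK] K by simp
      then have "real (2 * card (pairs_in K)) = real (m * (m - 1))" by (rule arg_cong)
      then show ?thesis using m by (simp add: of_nat_diff)
    qed
    finally show "measure_pmf.prob (edges_pmf b n w) {E. \<forall>p\<in>pairs_in K. E p} \<le>
      exp (- q * (real m * (real m - 1) / 2))" .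
  qed
  also have "\<dots> = real (card L choose m) * exp (- q * (real m * (real m - 1) / 2))"
    using fL by (simp add: n_subsets)
  also have "\<dots> \<le> real n ^ m * exp (- q * (real m * (real m - 1) / 2))"
  proof (intro mult_right_mono)
    have "card L \<le> n" using card_mono[OF _ assms(1)] by simp
    have "card L choose m \<le> n ^ m"
    proof (cases "m \<le> card L")
      case True
      then have "card L choose m \<le> card L ^ m" by (rule binomial_le_pow)
      also have "\<dots> \<le> n ^ m" using \<open>card L \<le> n\<close> by (rule power_mono) simp
      finally show ?thesis .
    qed (simp add: binomial_eq_0)
    then show "real (card L choose m) \<le> real n ^ m" by (metis of_nat_le_iff of_nat_power)
  qed simp
  also have "real n ^ m = exp (real m * ln (real n))"
    using n by (simp add: exp_of_nat_mult)
  also have "exp (real m * ln (real n)) * exp (- q * (real m * (real m - 1) / 2)) =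
      exp (real m * (ln (real n) - q * (real m - 1) / 2))"
    by (simp add: exp_add[symmetric] field_simps)
  finally show ?thesis .
qed

section \<open>Weights\<close>

lemma real_card_eq_sum_indicator:
  fixes n :: nat
  shows "real (card {i \<in> {1..n}. w i \<in> A}) = (\<Sum>i\<in>{1..n}. indicator A (w i))"
proof -
  have "real (card {i \<in> {1..n}. w i \<in> A}) = (\<Sum>i\<in>{i \<in> {1..n}. w i \<in> A}. 1)" by simp
  also have "\<dots> = (\<Sum>i\<in>{1..n}. if w i \<in> A then 1 else 0)"
    by (intro sum.inter_filter) simp
  also have "\<dots> = (\<Sum>i\<in>{1..n}. indicator A (w i))"
    by (intro sum.cong) (auto simp: indicator_def)
  finally show ?thesis .
qed

text \<open>
  Chebyshev's inequality for the number of weights in \<open>A\<close>: the variance of this binomial variable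
  is at most its mean, because the centred indicators are orthogonal.
\<close>

lemma weight_count_deviation:
  fixes D :: "real measure"
  assumes D: "prob_space D" "sets D = sets borel" and A: "A \<in> sets borel" and t: "t > 0"
  defines "p \<equiv> measure D A"
  shows "measure (\<Pi>\<^sub>M i\<in>{1..n}. D)
      {w \<in> space (\<Pi>\<^sub>M i\<in>{1..n}. D). t \<le> \<bar>real (card {i \<in> {1..n}. w i \<in> A}) - real n * p\<bar>} \<le>
    real n * p / t\<^sup>2"
proof -
  let ?I = "{1..n}"
  let ?M = "\<Pi>\<^sub>M i\<in>?I. D"
  interpret D: prob_space D by (rule D(1))
  interpret PM: prob_space ?M by (intro prob_space_PiM D(1))
  interpret product_prob_space "\<lambda>_. D" ?I by (intro product_prob_spaceI D(1))
  have A': "A \<in> sets D" using A D(2) by simp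
  define g where "g x = indicator A x - p" for x :: real
  have g [measurable]: "g \<in> borel_measurable D"
    unfolding g_def using A' by simp
  have p01: "0 \<le> p" "p \<le> 1" by (auto simp: p_def)
  have bound: "\<bar>g x\<bar> \<le> 1" for x
    using p01 by (auto simp: g_def indicator_def)
  have bound2: "\<bar>g x * g y\<bar> \<le> 1" for x y
    unfolding abs_mult using bound by (intro mult_le_one) auto
  have int_g: "integrable D g"
    by (rule D.integrable_const_bound[where B = 1]) (use bound in auto)
  have g0: "(\<integral>x. g x \<partial>D) = 0"
    unfolding g_def p_def using A' by (simp add: D.prob_space D.emeasure_eq_measure)
  have g2: "(\<integral>x. g x * g x \<partial>D) \<le> p"
  proof -
    have "(\<integral>x. g x * g x \<partial>D) = (\<integral>x. (1 - 2 * p) * indicator A x + p\<^sup>2 \<partial>D)"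
      by (intro Bochner_Integration.integral_cong)
        (auto simp: g_def indicator_def power2_eq_square algebra_simps)
    also have "\<dots> = (1 - 2 * p) * p + p\<^sup>2"
      using A' by (simp add: p_def D.prob_space D.emeasure_eq_measure)
    also have "\<dots> \<le> p" by (simp add: power2_eq_square algebra_simps)
    finally show ?thesis .
  qed
  have meas: "(\<lambda>w. g (w i)) \<in> borel_measurable ?M" if "i \<in> ?I" for i
    using measurable_component_singleton[OF that, of "\<lambda>_. D"] g by (rule measurable_compose)
  have int: "integrable ?M (\<lambda>w. g (w i) * g (w j))" if "i \<in> ?I" "j \<in> ?I" for i j
  proof (rule PM.integrable_const_bound[where B = 1])
    show "AE w in ?M. norm (g (w i) * g (w j)) \<le> 1"
      using bound2 by simp
  qed (use meas that in measurable)
  have cov: "(\<integral>w. g (w i) * g (w j) \<partial>?M) \<le> (if i = j then p else 0)" if ij: "i \<in> ?I" "j \<in> ?I" for i j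
  proof -
    \<comment> \<open>the product of two factors as a product over all coordinates\<close>
    define h where "h k = (if k = i \<and> k = j then (\<lambda>x. g x * g x) else if k = i \<or> k =
        j then g else (\<lambda>_. 1))" for k
    have int_h: "integrable D (h k)" for k
    proof (rule D.integrable_const_bound[where B = 1])
      have "norm (h k x) \<le> 1" for x
        using bound[of x] bound2[of x x] by (simp add: h_def)
      then show "AE x in D. norm (h k x) \<le> 1" by simp
    qed (auto simp: h_def)
    have "(\<Prod>k\<in>?I. h k (w k)) = g (w i) * g (w j)" for w
    proof (cases "i = j")
      case True
      have "(\<Prod>k\<in>?I. h k (w k)) = (\<Prod>k\<in>?I. if k = i then g (w i) * g (w i) else 1)"
        using True by (intro prod.cong) (auto simp: h_def)
      then show ?thesis using True ij by simp
    next
      case False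
      have "(\<Prod>k\<in>?I. h k (w k)) = (\<Prod>k\<in>?I. (if k = i then g (w i) else 1) * (if k =
          j then g (w j) else 1))"
        using False by (intro prod.cong) (auto simp: h_def)
      then show ?thesis using ij by (simp add: prod.distrib)
    qed
    then have "(\<integral>w. g (w i) * g (w j) \<partial>?M) = (\<integral>w. (\<Prod>k\<in>?I. h k (w k)) \<partial>?M)" by simp
    also have "\<dots> = (\<Prod>k\<in>?I. \<integral>x. h k x \<partial>D)"
      by (rule product_integral_prod) (use int_h in auto)
    also have "\<dots> \<le> (if i = j then p else 0)"
    proof (cases "i = j")
      case True
      have "(\<Prod>k\<in>?I. \<integral>x. h k x \<partial>D) = (\<Prod>k\<in>?I. if k = i then \<integral>x. g x * g x \<partial>D else 1)"
        using True by (intro prod.cong) (auto simp: h_def D.prob_space)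
      then show ?thesis using True ij g2 by simp
    next
      case False
      then have "(\<integral>x. h i x \<partial>D) = 0" using g0 by (simp add: h_def)
      then have "\<exists>k\<in>?I. (\<integral>x. h k x \<partial>D) = 0" using ij(1) by blast
      then have "(\<Prod>k\<in>?I. \<integral>x. h k x \<partial>D) = 0" by (intro prod_zero) auto
      then show ?thesis by (simp only: False if_False order_refl)
    qed
    finally show ?thesis .
  qed
  let ?f = "\<lambda>w. \<Sum>i\<in>?I. g (w i)"
  have f_eq: "real (card {i \<in> ?I. w i \<in> A}) - real n * p = ?f w" for w
    unfolding real_card_eq_sum_indicator by (simp add: g_def sum_subtractf)
  have sq: "(?f w)\<^sup>2 = (\<Sum>i\<in>?I. \<Sum>j\<in>?I. g (w i) * g (w j))" for w
    by (simp add: power2_eq_square sum_product)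
  have int_sq: "integrable ?M (\<lambda>w. (?f w)\<^sup>2)"
    unfolding sq by (intro Bochner_Integration.integrable_sum int)
  have "measure ?M {w \<in> space ?M. t\<^sup>2 \<le> (?f w)\<^sup>2} \<le> (\<integral>w. (?f w)\<^sup>2 \<partial>?M) / t\<^sup>2"
    using t by (intro integral_Markov_inequality_measure[OF int_sq, where A = "space ?M"]) auto
  also have "(\<integral>w. (?f w)\<^sup>2 \<partial>?M) = (\<Sum>i\<in>?I. \<integral>w. (\<Sum>j\<in>?I. g (w i) * g (w j)) \<partial>?M)"
    unfolding sq by (intro Bochner_Integration.integral_sum Bochner_Integration.integrable_sum int)
  also have "\<dots> = (\<Sum>i\<in>?I. \<Sum>j\<in>?I. \<integral>w. g (w i) * g (w j) \<partial>?M)"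
    by (intro sum.cong refl Bochner_Integration.integral_sum int)
  also have "\<dots> \<le> (\<Sum>i\<in>?I. \<Sum>j\<in>?I. if i = j then p else 0)"
    by (intro sum_mono cov)
  also have "\<dots> = real n * p" by simp
  also have "{w \<in> space ?M. t\<^sup>2 \<le> (?f w)\<^sup>2} = {w \<in> space ?M. t \<le> \<bar>?f w\<bar>}"
    using t by (auto simp: abs_le_square_iff[symmetric])
  finally show ?thesis
    unfolding f_eq by (simp add: divide_right_mono)
qed

text \<open>
  A tail of order \<open>x powr (- 2)\<close> makes the third moment truncated at \<open>T\<close> at most linear in \<open>T\<close>.
  The proof is a discrete layer-cake argument: \<open>x ^ 3\<close> is at most the sum of \<open>3 * (j + 1)\<^sup>2\<close> over the
  natural numbers \<open>j < x\<close>, and each of these summands contributes at most \<open>3 * C\<close> to the integral.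
\<close>

lemma truncated_cube_integral:
  fixes D :: "real measure"
  assumes D: "prob_space D" "sets D = sets borel" and T: "T \<ge> 0" and C: "C \<ge> 0"
    and tail: "\<And>x. x \<ge> 0 \<Longrightarrow> measure D {x<..} \<le> C / (x + 1)\<^sup>2"
  shows "(\<integral>\<^sup>+ x. ennreal (x ^ 3 * indicator {0..T} x) \<partial>D) \<le> ennreal (3 * C * (T + 1))"
proof -
  interpret prob_space D by (rule D(1))
  define m where "m = nat \<lceil>T\<rceil>"
  have m: "real m < T + 1" "T \<le> real m"
    using T unfolding m_def by linarith+
  have cubes: "real k ^ 3 \<le> (\<Sum>j<k. 3 * (real j + 1)\<^sup>2)" for k
  proof (induction k)
    case (Suc k)
    have "real (Suc k) ^ 3 \<le> real k ^ 3 + 3 * (real k + 1)\<^sup>2"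
      by (simp add: power2_eq_square power3_eq_cube algebra_simps)
    with Suc show ?case by simp
  qed simp
  have le: "x ^ 3 * indicator {0..T} x \<le> (\<Sum>j<m. 3 * (real j + 1)\<^sup>2 * indicator {real j<..} x)" for x
  proof (cases "x \<in> {0..T}")
    case True
    define k where "k = nat \<lceil>x\<rceil>"
    have k: "x \<le> real k" "k \<le> m" "\<And>j. j < k \<Longrightarrow> real j < x"
      using True m unfolding k_def m_def by (auto simp: nat_mono ceiling_mono) linarith+
    have "x ^ 3 \<le> real k ^ 3" using True k(1) by (intro power_mono) auto
    also note cubes
    also have "(\<Sum>j<k. 3 * (real j + 1)\<^sup>2) = (\<Sum>j<k. 3 * (real j + 1)\<^sup>2 * indicator {real j<..} x)"
      using k(3) by (intro sum.cong) auto
    also have "\<dots> \<le> (\<Sum>j<m. 3 * (real j + 1)\<^sup>2 * indicator {real j<..} x)"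
      using k(2) by (intro sum_mono2) auto
    finally show ?thesis using True by simp
  qed (simp add: sum_nonneg)
  have "(\<integral>\<^sup>+ x. ennreal (x ^ 3 * indicator {0..T} x) \<partial>D) \<le>
      (\<integral>\<^sup>+ x. ennreal (\<Sum>j<m. 3 * (real j + 1)\<^sup>2 * indicator {real j<..} x) \<partial>D)"
    by (intro nn_integral_mono ennreal_leI le)
  also have "\<dots> = (\<integral>\<^sup>+ x. (\<Sum>j<m. ennreal (3 * (real j + 1)\<^sup>2) * indicator {real j<..} x) \<partial>D)"
    by (intro nn_integral_cong) (simp add: sum_ennreal[symmetric] ennreal_mult indicator_def)
  also have "\<dots> = (\<Sum>j<m. \<integral>\<^sup>+ x. ennreal (3 * (real j + 1)\<^sup>2) * indicator {real j<..} x \<partial>D)"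
    using D(2) by (intro nn_integral_sum) simp
  also have "\<dots> = (\<Sum>j<m. ennreal (3 * (real j + 1)\<^sup>2) * emeasure D {real j<..})"
    using D(2) by (intro sum.cong refl nn_integral_cmult_indicator) simp
  also have "\<dots> = ennreal (\<Sum>j<m. 3 * (real j + 1)\<^sup>2 * measure D {real j<..})"
    by (simp add: emeasure_eq_measure sum_ennreal[symmetric] ennreal_mult)
  also have "\<dots> \<le> ennreal (\<Sum>j<m. 3 * C)"
  proof (intro ennreal_leI sum_mono)
    fix j :: nat
    have "3 * (real j + 1)\<^sup>2 * measure D {real j<..} \<le> 3 * (real j + 1)\<^sup>2 * (C / (real j + 1)\<^sup>2)"
      by (intro mult_left_mono tail) auto
    also have "\<dots> = 3 * C"
      using of_nat_0_le_iff[of j] by (simp add: field_simps del: of_nat_0_le_iff)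
    finally show "3 * (real j + 1)\<^sup>2 * measure D {real j<..} \<le> 3 * C" .
  qed
  also have "\<dots> \<le> ennreal (3 * C * (T + 1))"
    using m(1) C by (intro ennreal_leI) (simp add: mult.commute mult_left_mono)
  finally show ?thesis .
qed

lemma measurable_weight_count:
  fixes D :: "real measure" and n :: nat
  assumes "sets D = sets borel" "A \<in> sets borel"
  shows "(\<lambda>w. real (card {i \<in> {1..n}. w i \<in> A})) \<in> borel_measurable (\<Pi>\<^sub>M i\<in>{1..n}. D)"
proof -
  have A': "A \<in> sets D" using assms by simp
  have "(\<lambda>w. indicator A (w i) :: real) \<in> borel_measurable (\<Pi>\<^sub>M i\<in>{1..n}. D)" if "i \<in> {1..n}" for i
    by (rule measurable_compose[OF measurable_component_singleton[OF that, of "\<lambda>_. D"]])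
      (use A' in simp)
  then show ?thesis unfolding real_card_eq_sum_indicator by (intro borel_measurable_sum)
qed

lemma AE_weights_nonneg:
  fixes D :: "real measure" and n :: nat
  assumes "prob_space D" "AE x in D. 0 \<le> x"
  shows "AE w in (\<Pi>\<^sub>M i\<in>{1..n}. D). \<forall>i\<in>{1..n}. 0 \<le> w i"
  using assms by (intro AE_finite_allI AE_PiM_component) auto

section \<open>Cliques among light vertices\<close>

lemma card_small_subsets:
  "card {S. S \<subseteq> {1..n} \<and> card S \<le> 3} \<le> (n + 1) ^ 3"
proof -
  let ?f = "\<lambda>(x, y, z). {x, y, z} - {0 :: nat}"
  let ?T = "{0..n} \<times> {0..n} \<times> {0..n}"
  \<comment> \<open>the value \<open>0\<close>, which is not a vertex, stands for a missing element\<close>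
  have "{S. S \<subseteq> {1..n} \<and> card S \<le> 3} \<subseteq> ?f ` ?T"
  proof
    fix S assume "S \<in> {S. S \<subseteq> {1..n} \<and> card S \<le> 3}"
    then have S: "S \<subseteq> {1..n}" "card S \<le> 3" by auto
    then have fS: "finite S" using finite_subset by blast
    define l where "l = sorted_list_of_set S"
    have l: "set l = S" "length l \<le> 3" using fS S(2) by (auto simp: l_def)
    have nz: "0 \<notin> S" using S(1) by auto
    from l(2) consider "l = []" | x where "l = [x]" | x y where "l = [x, y]" | x y z where "l =
        [x, y, z]"
      by (cases l rule: remdups_adj.cases; cases "tl (tl l)") auto
    then obtain x y z where xyz: "S = {x, y, z} - {0}" "(x, y, z) \<in> ?T"
    proof cases
      case 1
      then show ?thesis using that[of 0 0 0] l by auto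
    next
      case (2 x)
      then show ?thesis using that[of x x x] l nz S(1) by auto
    next
      case (3 x y)
      then show ?thesis using that[of x y y] l nz S(1) by auto
    next
      case (4 x y z)
      then show ?thesis using that[of x y z] l nz S(1) by auto
    qed
    then show "S \<in> ?f ` ?T"
      by (intro image_eqI[OF _ xyz(2)]) simp
  qed
  then have "card {S. S \<subseteq> {1..n} \<and> card S \<le> 3} \<le> card (?f ` ?T)"
    by (intro card_mono) auto
  also have "\<dots> \<le> card ?T" by (intro card_image_le) auto
  also have "\<dots> = (n + 1) ^ 3"
    by (simp add: card_cartesian_product power3_eq_cube algebra_simps)
  finally show ?thesis .
qed

text \<open>
  If no clique has four elements outside \<open>H\<close>, a clique is determined by its part in \<open>H\<close> and by at
  most three further vertices.
\<close>

lemma card_cliques_le: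
  assumes H: "H \<subseteq> {1..n}"
    and light: "\<And>K. is_clique n E K \<Longrightarrow> K \<inter> H = {} \<Longrightarrow> card K \<le> 3"
  shows "card {K. is_clique n E K} \<le> 2 ^ card H * (n + 1) ^ 3"
proof -
  let ?f = "\<lambda>K. (K \<inter> H, K - H)" and ?T = "{S. S \<subseteq> {1..n} \<and> card S \<le> 3}"
  have fH: "finite H" using H finite_subset by blast
  have fT: "finite ?T" by (rule finite_subset[of _ "Pow {1..n}"]) auto
  have "card {K. is_clique n E K} \<le> card (Pow H \<times> ?T)"
  proof (rule card_inj_on_le)
    show "inj_on ?f {K. is_clique n E K}" by (auto simp: inj_on_def)
    show "?f ` {K. is_clique n E K} \<subseteq> Pow H \<times> ?T"
    proof
      fix x assume "x \<in> ?f ` {K. is_clique n E K}"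
      then obtain K where K: "is_clique n E K" "x = (K \<inter> H, K - H)" by auto
      have "is_clique n E (K - H)" using K(1) by (rule is_clique_subset) auto
      then have "card (K - H) \<le> 3" "K - H \<subseteq> {1..n}"
        using light[of "K - H"] by (auto simp: is_clique_def)
      then show "x \<in> Pow H \<times> ?T" using K(2) by auto
    qed
    show "finite (Pow H \<times> ?T)" using fH fT by simp
  qed
  also have "\<dots> = 2 ^ card H * card ?T"
    using fH by (simp add: card_cartesian_product card_Pow)
  also have "\<dots> \<le> 2 ^ card H * (n + 1) ^ 3"
    by (intro mult_le_mono2 card_small_subsets)
  finally show ?thesis .
qed

text \<open>Each element of a set of four lies in three of its six pairs.\<close>

lemma pairs_in_prod_four:
  fixes f :: "nat \<Rightarrow> real"
  assumes "card K = 4"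
  shows "(\<Prod>(i, j)\<in>pairs_in K. c * f i * f j) = c ^ 6 * (\<Prod>i\<in>K. f i ^ 3)"
proof -
  have fK: "finite K" using assms card.infinite by fastforce
  define l where "l = sorted_list_of_set K"
  have l: "set l = K" "length l = 4" "sorted l" "distinct l" using fK assms by (auto simp: l_def)
  from l(2) have "\<exists>p q r s. l = [p, q, r, s]"
    by (auto simp: eval_nat_numeral length_Suc_conv)
  then obtain p q r s where "l = [p, q, r, s]" by blast
  with l have K: "K = {p, q, r, s}" and lt: "p < q" "q < r" "r < s" by auto
  have ls: "p < r" "p < s" "q < s" using lt by simp_all
  have nl: "\<not> q < p" "\<not> r < p" "\<not> s < p" "\<not> r < q" "\<not> s < q" "\<not> s < r" using lt by simp_all
  have ne: "p \<noteq> q" "p \<noteq> r" "p \<noteq> s" "q \<noteq> r" "q \<noteq> s" "r \<noteq> s" using lt by simp_all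
  have "pairs_in K = {(p, q), (p, r), (p, s), (q, r), (q, s), (r, s)}"
  proof (intro set_eqI, clarify)
    fix i j
    have "(i, j) \<in> pairs_in K \<longleftrightarrow> i \<in> {p, q, r, s} \<and> j \<in> {p, q, r, s} \<and> i < j"
      by (simp add: pairs_in_def K)
    also have "\<dots> \<longleftrightarrow> (i = p \<and> j \<in> {q, r, s}) \<or> (i = q \<and> j \<in> {r, s}) \<or> (i = r \<and> j = s)"
    proof
      assume *: "i \<in> {p, q, r, s} \<and> j \<in> {p, q, r, s} \<and> i < j"
      then consider "i = p" | "i = q" | "i = r" | "i = s" by blast
      then show "(i = p \<and> j \<in> {q, r, s}) \<or> (i = q \<and> j \<in> {r, s}) \<or> (i = r \<and> j = s)"
        using * lt by cases auto
    qed (use lt in auto)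
    also have "\<dots> \<longleftrightarrow> (i, j) \<in> {(p, q), (p, r), (p, s), (q, r), (q, s), (r, s)}"
      by blast
    finally show "(i, j) \<in> pairs_in K \<longleftrightarrow> (i, j) \<in> {(p, q), (p, r), (p, s), (q, r), (q, s), (r, s)}" .
  qed
  then have "(\<Prod>(i, j)\<in>pairs_in K. c * f i * f j) =
      (c * f p * f q) * ((c * f p * f r) * ((c * f p * f s) * ((c * f q * f r) * ((c * f q * f s)
          * (c * f r * f s)))))"
    using ne by simp
  moreover have "(\<Prod>i\<in>K. f i ^ 3) = f p ^ 3 * (f q ^ 3 * (f r ^ 3 * f s ^ 3))"
    unfolding K using ne by simp
  ultimately show ?thesis
    by (simp add: power3_eq_cube eval_nat_numeral)
qed

text \<open>
  Under a quadratic tail bound, the expected number of cliques of size four among the vertices of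
  weight at most \<open>T\<close> is at most of order \<open>(T + 1) ^ 4 / n ^ 2\<close>.
      Here \<open>h\<close> bounds the conditional expectation given
  the weights: the six edges of such a clique have joint probability at most
  \<open>(b / n) ^ 6\<close> times the product of the cubes of the four weights.
\<close>

lemma light_clique_prob:
  fixes D :: "real measure"
  assumes D: "prob_space D" "sets D = sets borel" and b: "b > 0" and n: "n > 0" and T: "T \<ge> 0"
      and C: "C \<ge> 0"
    and tail: "\<And>x. x \<ge> 0 \<Longrightarrow> measure D {x<..} \<le> C / (x + 1)\<^sup>2"
  defines "u \<equiv> \<lambda>x. ennreal (x ^ 3 * indicator {0..T} x)"
  defines "h \<equiv> \<lambda>w. \<Sum>K\<in>{K. K \<subseteq> {1..n} \<and> card K = 4}. ennreal ((b / real n) ^ 6) * (\<Prod>i\<in>K. u (w i))"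
  shows "\<And>w. (\<And>i. i \<in> {1..n} \<Longrightarrow> w i \<ge> 0) \<Longrightarrow>
      emeasure (measure_pmf (edges_pmf b n w))
        {E. \<exists>K. is_clique n E K \<and> (\<forall>i\<in>K. w i \<le> T) \<and> card K \<ge> 4} \<le> h w"
    and "h \<in> borel_measurable (\<Pi>\<^sub>M i\<in>{1..n}. D)"
    and "(\<integral>\<^sup>+ w. h w \<partial>(\<Pi>\<^sub>M i\<in>{1..n}. D)) \<le> ennreal (b ^ 6 * (3 * C * (T + 1)) ^ 4 / real n ^ 2)"
proof -
  let ?I = "{1..n}"
  let ?KK = "{K. K \<subseteq> ?I \<and> card K = 4}"
  have fKK: "finite ?KK" by simp
  show "emeasure (measure_pmf (edges_pmf b n w))
        {E. \<exists>K. is_clique n E K \<and> (\<forall>i\<in>K. w i \<le> T) \<and> card K \<ge> 4} \<le> h w"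
    if w: "\<And>i. i \<in> ?I \<Longrightarrow> w i \<ge> 0" for w
  proof -
    let ?M = "measure_pmf (edges_pmf b n w)"
    let ?LL = "{K \<in> ?KK. \<forall>i\<in>K. w i \<le> T}"
    have "{E. \<exists>K. is_clique n E K \<and> (\<forall>i\<in>K. w i \<le> T) \<and> card K \<ge> 4} \<subseteq>
        (\<Union>K\<in>?LL. {E. \<forall>p\<in>pairs_in K. E p})"
    proof
      fix E assume "E \<in> {E. \<exists>K. is_clique n E K \<and> (\<forall>i\<in>K. w i \<le> T) \<and> card K \<ge> 4}"
      then obtain K where K: "is_clique n E K" "\<forall>i\<in>K. w i \<le> T" "4 \<le> card K" by blast
      then obtain K' where K': "K' \<subseteq> K" "card K' = 4" using obtain_subset_with_card_n by metis
      have "is_clique n E K'" using K(1) K'(1) by (rule is_clique_subset)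
      then have "K' \<subseteq> ?I" "\<forall>p\<in>pairs_in K'. E p"
        using is_clique_iff_pairs[of K' n E] by (auto simp: is_clique_def)
      then show "E \<in> (\<Union>K\<in>?LL. {E. \<forall>p\<in>pairs_in K. E p})" using K(2) K' by blast
    qed
    then have "emeasure ?M {E. \<exists>K. is_clique n E K \<and> (\<forall>i\<in>K. w i \<le> T) \<and> card K \<ge> 4} \<le>
        emeasure ?M (\<Union>K\<in>?LL. {E. \<forall>p\<in>pairs_in K. E p})"
      by (intro emeasure_mono) auto
    also have "\<dots> \<le> (\<Sum>K\<in>?LL. emeasure ?M {E. \<forall>p\<in>pairs_in K. E p})"
      by (intro emeasure_subadditive_finite) auto
    also have "\<dots> \<le> (\<Sum>K\<in>?LL. ennreal ((b / real n) ^ 6) * (\<Prod>i\<in>K. u (w i)))"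
    proof (rule sum_mono)
      fix K assume K: "K \<in> ?LL"
      then have KI: "K \<subseteq> ?I" "card K = 4" "\<And>i. i \<in> K \<Longrightarrow> 0 \<le> w i" "\<And>i. i \<in> K \<Longrightarrow> w i \<le> T"
        using w by auto
      have "measure_pmf.prob (edges_pmf b n w) {E. \<forall>p\<in>pairs_in K. E p} = (\<Prod>p\<in>pairs_in K.
          edge_prob b n w p)"
        by (intro prob_all_edges pairs_in_vertex_pairs KI b w)
      also have "\<dots> \<le> (\<Prod>(i, j)\<in>pairs_in K. b / real n * w i * w j)"
      proof (rule prod_mono)
        fix p assume "p \<in> pairs_in K"
        then obtain i j where "p = (i, j)" "i \<in> K" "j \<in> K" by (auto simp: pairs_in_def)
        then show "0 \<le> edge_prob b n w p \<and> edge_prob b n w p \<le>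
            (case p of (i, j) \<Rightarrow> b / real n * w i * w j)"
          using edge_prob_bounds[of b w i j n] b KI(3) by simp
      qed
      also have "\<dots> = (b / real n) ^ 6 * (\<Prod>i\<in>K. w i ^ 3)"
        by (rule pairs_in_prod_four[OF KI(2)])
      finally have "emeasure ?M {E. \<forall>p\<in>pairs_in K. E p} \<le> ennreal ((b / real n) ^ 6 * (\<Prod>i\<in>K. w i ^ 3))"
        by (simp add: measure_pmf.emeasure_eq_measure ennreal_leI)
      also have "\<dots> = ennreal ((b / real n) ^ 6) * (\<Prod>i\<in>K. ennreal (w i ^ 3))"
        using b KI(3) by (subst prod_ennreal) (auto simp: ennreal_mult prod_nonneg)
      also have "(\<Prod>i\<in>K. ennreal (w i ^ 3)) = (\<Prod>i\<in>K. u (w i))"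
        using KI(3,4) by (intro prod.cong) (auto simp: u_def)
      finally show "emeasure ?M {E. \<forall>p\<in>pairs_in K. E p} \<le> ennreal ((b / real n) ^ 6) * (\<Prod>i\<in>K.
          u (w i))" .
    qed
    also have "\<dots> \<le> h w"
      unfolding h_def by (intro sum_mono2 fKK) auto
    finally show ?thesis .
  qed
  interpret product_prob_space "\<lambda>_. D" ?I by (intro product_prob_spaceI D(1))
  have u_meas [measurable]: "u \<in> borel_measurable D"
    unfolding u_def using D(2) by simp
  let ?\<mu> = "\<integral>\<^sup>+ x. u x \<partial>D"
  have \<mu>: "?\<mu> \<le> ennreal (3 * C * (T + 1))"
    unfolding u_def by (intro truncated_cube_integral D T C tail)
  have D1: "emeasure D (space D) = 1"
    by (rule prob_space.emeasure_space_1[OF D(1)])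
  have prod: "(\<integral>\<^sup>+ w. (\<Prod>i\<in>K. u (w i)) \<partial>(\<Pi>\<^sub>M i\<in>?I. D)) = ?\<mu> ^ 4" if K: "K \<in> ?KK" for K
  proof -
    \<comment> \<open>a product over all coordinates, to which independence applies\<close>
    let ?v = "\<lambda>i x. if i \<in> K then u x else 1"
    have "(\<Prod>i\<in>K. u (w i)) = (\<Prod>i\<in>?I. ?v i (w i))" for w
      using K by (simp add: prod.If_cases Int_absorb1)
    then have "(\<integral>\<^sup>+ w. (\<Prod>i\<in>K. u (w i)) \<partial>(\<Pi>\<^sub>M i\<in>?I. D)) = (\<integral>\<^sup>+ w. (\<Prod>i\<in>?I. ?v i (w i)) \<partial>(\<Pi>\<^sub>M i\<in>?I. D))"
      by simp
    also have "\<dots> = (\<Prod>i\<in>?I. \<integral>\<^sup>+ x. ?v i x \<partial>D)"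
      by (intro product_nn_integral_prod) auto
    also have "\<dots> = (\<Prod>i\<in>?I. if i \<in> K then ?\<mu> else 1)"
      by (intro prod.cong) (auto simp: D1)
    also have "\<dots> = ?\<mu> ^ 4"
      using K by (simp add: prod.If_cases Int_absorb1)
    finally show ?thesis .
  qed
  have meas: "(\<lambda>w. \<Prod>i\<in>K. u (w i)) \<in> borel_measurable (\<Pi>\<^sub>M i\<in>?I. D)" if K: "K \<in> ?KK" for K
  proof (rule borel_measurable_prod_ennreal)
    fix i assume "i \<in> K"
    then have "i \<in> ?I" using K by auto
    from measurable_component_singleton[OF this, of "\<lambda>_. D"] u_meas
    show "(\<lambda>w. u (w i)) \<in> borel_measurable (\<Pi>\<^sub>M i\<in>?I. D)" by (rule measurable_compose)
  qed
  show "h \<in> borel_measurable (\<Pi>\<^sub>M i\<in>?I. D)"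
    unfolding h_def using meas by (intro borel_measurable_sum borel_measurable_times_ennreal) auto
  have "(\<integral>\<^sup>+ w. h w \<partial>(\<Pi>\<^sub>M i\<in>?I. D)) =
      (\<Sum>K\<in>?KK. \<integral>\<^sup>+ w. ennreal ((b / real n) ^ 6) * (\<Prod>i\<in>K. u (w i)) \<partial>(\<Pi>\<^sub>M i\<in>?I. D))"
    unfolding h_def using meas by (intro nn_integral_sum borel_measurable_times_ennreal) auto
  also have "\<dots> = (\<Sum>K\<in>?KK. ennreal ((b / real n) ^ 6) * ?\<mu> ^ 4)"
    using meas prod by (intro sum.cong refl) (simp add: nn_integral_cmult)
  also have "\<dots> = of_nat (n choose 4) * (ennreal ((b / real n) ^ 6) * ?\<mu> ^ 4)"
    by (simp add: n_subsets)
  also have "\<dots> \<le> of_nat (n ^ 4) * (ennreal ((b / real n) ^ 6) * ennreal (3 * C * (T + 1)) ^ 4)"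
  proof (intro mult_mono power_mono \<mu>)
    have "n choose 4 \<le> n ^ 4"
      by (cases "4 \<le> n") (simp_all add: binomial_le_pow binomial_eq_0)
    then show "of_nat (n choose 4) \<le> (of_nat (n ^ 4) :: ennreal)" by (rule of_nat_mono)
  qed auto
  also have "\<dots> = ennreal (real n ^ 4 * ((b / real n) ^ 6 * (3 * C * (T + 1)) ^ 4))"
  proof -
    have "of_nat (n ^ 4) * (ennreal y * ennreal x ^ 4) = ennreal (real n ^ 4 * (y * x ^ 4))"
      if "0 \<le> x" "0 \<le> y" for x y
      unfolding ennreal_of_nat_eq_real_of_nat ennreal_power[OF that(1)] of_nat_power
      using that by (subst ennreal_mult[symmetric], simp, simp)+ (rule refl)
    from this[of "3 * C * (T + 1)" "(b / real n) ^ 6"] b T C show ?thesis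
      by (simp only: zero_le_mult_iff zero_le_divide_iff zero_le_power less_imp_le of_nat_0_le_iff
          add_nonneg_nonneg zero_le_one zero_le_numeral simp_thms)
  qed
  also have "real n ^ 4 * ((b / real n) ^ 6 * (3 * C * (T + 1)) ^ 4) =
      b ^ 6 * (3 * C * (T + 1)) ^ 4 / real n ^ 2"
    using n by (simp add: power_divide field_simps eval_nat_numeral)
  finally show "(\<integral>\<^sup>+ w. h w \<partial>(\<Pi>\<^sub>M i\<in>?I. D)) \<le> ennreal (b ^ 6 * (3 * C * (T + 1)) ^ 4 / real n ^ 2)" .
qed

section \<open>Comparison of greedy cliques with largest cliques\<close>

text \<open>
  Each vertex of \<open>H\<close> missing from a maximal clique \<open>S\<close> is the endpoint outside \<open>S\<close> of a missing
  edge whose other endpoint is in \<open>S\<close>; distinct vertices yield distinct missing edges.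
\<close>

lemma card_maximal_on:
  assumes S: "maximal_on n E H S" and H: "H \<subseteq> {1..n}"
  shows "card H \<le> card S + card {p \<in> pairs_in H. \<not> E p}"
proof -
  have fH: "finite H" using H finite_subset by blast
  have SH: "S \<subseteq> H" using S by (simp add: maximal_on_def)
  have "\<forall>v\<in>H - S. \<exists>u. u \<in> S \<and> \<not> adjacent n E u v"
    using S unfolding maximal_on_def by blast
  then obtain c where c: "\<And>v. v \<in> H - S \<Longrightarrow> c v \<in> S \<and> \<not> adjacent n E (c v) v"
    using bchoice[of "H - S"] by metis
  define f where "f v = (min v (c v), max v (c v))" for v
  have "inj_on f (H - S)"
  proof (rule inj_onI)
    fix v v' assume v: "v \<in> H - S" "v' \<in> H - S" "f v = f v'"
    have "v = v' \<or> v = c v'"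
      using v(3) by (auto simp: f_def min_def max_def split: if_splits)
    then show "v = v'" using c[OF v(2)] v(1) by blast
  qed
  moreover have "f ` (H - S) \<subseteq> {p \<in> pairs_in H. \<not> E p}"
  proof
    fix p assume "p \<in> f ` (H - S)"
    then obtain v where v: "v \<in> H - S" "p = f v" by blast
    have cS: "c v \<in> S" using c[OF v(1)] by simp
    have cv: "c v \<in> H" "c v \<noteq> v" "v \<in> H"
      using cS SH v(1) by auto
    then have cv1: "v \<in> {1..n}" "c v \<in> {1..n}" using H by blast+
    have "\<not> adjacent n E (c v) v" using c[OF v(1)] by blast
    then have "\<not> E p"
      using cv cv1 v(2) by (cases "v < c v") (auto simp: f_def adjacent_def vertex_pairs_def)
    moreover have "p \<in> pairs_in H"
      using cv v by (cases "v < c v") (auto simp: f_def pairs_in_def)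
    ultimately show "p \<in> {p \<in> pairs_in H. \<not> E p}" by blast
  qed
  ultimately have "card (H - S) \<le> card {p \<in> pairs_in H. \<not> E p}"
    using fH by (intro card_inj_on_le[of f]) auto
  then show ?thesis
    using fH SH card_Diff_subset[OF finite_subset[OF SH fH] SH] by linarith
qed

lemma beats_upper_set:
  assumes B: "\<And>t. t \<in> {1..n} \<Longrightarrow> beats n w E B t"
  shows "card {i \<in> {1..n}. w i > T} \<le>
    card B + card {p \<in> pairs_in {i \<in> {1..n}. w i > T}. \<not> E p}"
proof (cases "{i \<in> {1..n}. w i > T} = {}")
  case False
  let ?H = "{i \<in> {1..n}. w i > T}"
  \<comment> \<open>a lightest vertex \<open>t\<close> of \<open>?H\<close> yields this set as the set of vertices not lighter than \<open>t\<close>\<close>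
  have "Min (w ` ?H) \<in> w ` ?H"
    using False by (intro Min_in) auto
  then obtain t where t: "t \<in> ?H" "Min (w ` ?H) = w t" by blast
  have min: "w t \<le> w i" if "i \<in> ?H" for i
    unfolding t(2)[symmetric] using that by (intro Min_le) auto
  have "weight_above n w t = ?H"
  proof (intro set_eqI iffI)
    fix i assume "i \<in> weight_above n w t"
    then show "i \<in> ?H" using t(1) by (auto simp: weight_above_def)
  next
    fix i assume "i \<in> ?H"
    with min[OF this] show "i \<in> weight_above n w t" by (auto simp: weight_above_def)
  qed
  then obtain S where S: "maximal_on n E ?H S" "card S \<le> card B"
    using B[of t] t(1) by (auto simp: beats_def)
  have "card ?H \<le> card S + card {p \<in> pairs_in ?H. \<not> E p}"
    using S(1) by (rule card_maximal_on) blast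
  then show ?thesis
    using S(2) by linarith
next
  case True
  show ?thesis unfolding True by simp
qed

lemma clique_number_attained:
  obtains K where "is_clique n E K" "card K = clique_number n E"
proof -
  have "clique_number n E \<in> card ` {K. is_clique n E K}"
    unfolding clique_number_def by (rule Max_in) (auto intro: exI[of _ "{}"])
  then show ?thesis using that by auto
qed

lemma clique_number_le:
  fixes w :: "nat \<Rightarrow> real"
  assumes "\<And>K. is_clique n E K \<Longrightarrow> (\<forall>i\<in>K. w i \<le> T) \<Longrightarrow> card K \<le> m"
  shows "clique_number n E \<le> card {i \<in> {1..n}. w i > T} + m"
proof -
  obtain K where K: "is_clique n E K" "card K = clique_number n E"
    by (rule clique_number_attained)
  let ?H = "{i \<in> {1..n}. w i > T}"
  have "is_clique n E (K - ?H)" using K(1) by (rule is_clique_subset) auto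
  moreover have "\<forall>i\<in>K - ?H. w i \<le> T"
  proof
    fix i assume i: "i \<in> K - ?H"
    then have "i \<in> {1..n}" using K(1) unfolding is_clique_def by blast
    with i show "w i \<le> T" by (simp add: not_less)
  qed
  ultimately have "card (K - ?H) \<le> m" by (rule assms)
  moreover have "card (K \<inter> ?H) \<le> card ?H" by (intro card_mono) auto
  moreover have "card K = card (K \<inter> ?H) + card (K - ?H)"
    using sum.Int_Diff[OF finite_clique[OF K(1)], of "\<lambda>_. 1 :: nat" ?H] by simp
  ultimately show ?thesis using K(2) by linarith
qed

section \<open>Light tails\<close>

lemma quadratic_tail:
  fixes D :: "real measure"
  assumes D: "prob_space D" and \<alpha>: "\<alpha> \<ge> 2" and a: "a > 0" and x0: "x\<^sub>0 > 0"
    and tail: "\<And>x. x \<ge> x\<^sub>0 \<Longrightarrow> measure D {x<..} = a * x powr (- \<alpha>)"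
  obtains C where "C > 0" "\<And>x. x \<ge> 0 \<Longrightarrow> measure D {x<..} \<le> C / (x + 1)\<^sup>2"
proof (rule that)
  define y where "y = max x\<^sub>0 1"
  \<comment> \<open>the first value serves \<open>x \<ge> y\<close>, where \<open>x + 1 \<le> 2 * x\<close>, and the second one \<open>x < y\<close>\<close>
  define C where "C = max (4 * a) ((y + 1)\<^sup>2)"
  show "C > 0" using a by (simp add: C_def)
  show "measure D {x<..} \<le> C / (x + 1)\<^sup>2" if x: "x \<ge> 0" for x
  proof (cases "x \<ge> y")
    case True
    then have x1: "x \<ge> 1" "x \<ge> x\<^sub>0" by (auto simp: y_def)
    have "measure D {x<..} = a * x powr (- \<alpha>)" by (rule tail[OF x1(2)])
    also have "\<dots> \<le> a * x powr (- 2)"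
      using \<alpha> a x1 by (intro mult_left_mono powr_mono) auto
    also have "\<dots> = a / x\<^sup>2"
      using x1 by (simp add: powr_minus powr_numeral divide_inverse)
    also have "\<dots> = 4 * a / (2 * x)\<^sup>2" by (simp add: power2_eq_square)
    also have "\<dots> \<le> C / (x + 1)\<^sup>2"
      using x1 a by (intro frac_le power_mono) (auto simp: C_def)
    finally show ?thesis .
  next
    case False
    have "measure D {x<..} \<le> 1" by (rule prob_space.prob_le_1[OF D])
    also have "1 \<le> (y + 1)\<^sup>2 / (x + 1)\<^sup>2"
      using False x by (simp add: power_mono)
    also have "\<dots> \<le> C / (x + 1)\<^sup>2" by (intro divide_right_mono) (auto simp: C_def)
    finally show ?thesis .
  qed
qed

text \<open>
  The truncation at weight \<open>T n\<close> slightly below \<open>sqrt n\<close> leaves at most of order \<open>sqrt (ln n)\<close>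
  heavier vertices in the mean, so that with high probability these have at most \<open>n\<close> subsets, while
  \<open>T n ^ 4 / n ^ 2\<close> tends to zero.
\<close>

lemma dfs_succeeds_whp:
  fixes D :: "real measure"
  assumes D: "prob_space D" "sets D = sets borel" and nonneg: "AE x in D. 0 \<le> x"
    and b: "b > 0" and C: "C > 0"
    and tail: "\<And>x. x \<ge> 0 \<Longrightarrow> measure D {x<..} \<le> C / (x + 1)\<^sup>2"
  shows "(\<lambda>n. \<P>((w, E) in weighted_graph D b n. succeeds dfs (smult 40 ([:1, 1:] ^ 6)) 0 n w E)) \<longlonglongrightarrow> 1"
proof -
  let ?q = "smult 40 ([:1, 1:] ^ 6) :: nat poly"
  let ?P = "\<lambda>n. \<P>((w, E) in weighted_graph D b n. succeeds dfs ?q 0 n w E)"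
  define T where "T n = sqrt (real n) / (ln (real n)) powr (1/4)" for n :: nat
  define mm where "mm n = C * ln (real n) powr (1/2)" for n :: nat
  define r where "r n = mm n / (log 2 (real n) - mm n)\<^sup>2" for n
  define r' where "r' n = b ^ 6 * (3 * C * (T n + 1)) ^ 4 / real n ^ 2" for n
  have lower: "1 - (r n + r' n) \<le> ?P n" if n: "n \<ge> 2" and t: "log 2 (real n) - mm n > 0" for n
  proof -
    let ?M = "\<Pi>\<^sub>M i\<in>{1..n}. D"
    let ?A = "{T n<..}"
    let ?H = "\<lambda>w. {i \<in> {1..n}. w i \<in> ?A}"
    define p where "p = measure D ?A"
    define t where "t = log 2 (real n) - mm n"
    define B where "B = {w \<in> space ?M. t \<le> \<bar>real (card (?H w)) - real n * p\<bar>}"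
    define h where "h w = (\<Sum>K\<in>{K. K \<subseteq> {1..n} \<and> card K = 4}. ennreal ((b / real n) ^ 6) *
      (\<Prod>i\<in>K. ennreal (w i ^ 3 * indicator {0..T n} (w i))))" for w
    have ln: "ln (real n) > 0" using n by simp
    then have T: "T n > 0" using n by (simp add: T_def)
    have n0: "n > 0" using n by simp
    \<comment> \<open>\<open>mm n\<close> bounds the mean number of vertices of weight above \<open>T n\<close>\<close>
    have np: "real n * p \<le> mm n"
    proof -
      have "(ln (real n) powr (1/4))\<^sup>2 = ln (real n) powr (1/2)"
        by (simp add: power2_eq_square flip: powr_add)
      then have T2: "(T n)\<^sup>2 = real n / ln (real n) powr (1/2)"
        by (simp add: T_def power_divide)
      have "p \<le> C / (T n + 1)\<^sup>2" unfolding p_def using T by (intro tail) simp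
      also have "\<dots> \<le> C / (T n)\<^sup>2" using T C by (intro divide_left_mono power_mono) auto
      finally have "real n * p \<le> real n * (C / (T n)\<^sup>2)" by (intro mult_left_mono) auto
      also have "\<dots> = mm n" unfolding T2 mm_def using n0 by simp
      finally show ?thesis .
    qed
    show ?thesis
    proof (rule prob_weighted_graph_ge_outside[OF D sets_succeeds, where B = B and h = h])
      have [measurable]: "(\<lambda>w. real (card (?H w))) \<in> borel_measurable ?M"
        using D(2) by (rule measurable_weight_count) simp
      show "B \<in> sets ?M" unfolding B_def by measurable
      have "measure ?M B \<le> real n * p / t\<^sup>2"
        unfolding B_def p_def using \<open>log 2 (real n) - mm n > 0\<close>
        by (intro weight_count_deviation[OF D]) (auto simp: t_def)
      also have "\<dots> \<le> r n" unfolding r_def t_def using np by (intro divide_right_mono) auto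
      finally show "measure ?M B \<le> r n" .
      show "h \<in> borel_measurable ?M" "(\<integral>\<^sup>+ w. h w \<partial>?M) \<le> ennreal (r' n)"
        unfolding h_def r'_def
        using T C by (intro light_clique_prob[OF D b n0 _ _ tail]; simp)+
      show "0 \<le> r' n" using b C T by (simp add: r'_def)
      show "AE w in ?M. w \<notin> B \<longrightarrow>
          emeasure (measure_pmf (edges_pmf b n w)) {E. \<not> succeeds dfs ?q 0 n w E} \<le> h w"
        using AE_weights_nonneg[OF D(1) nonneg] AE_space
      proof eventually_elim
        case (elim w)
        show ?case
        proof
          assume "w \<notin> B"
          with elim(2) have "\<bar>real (card (?H w)) - real n * p\<bar> < t" by (simp add: B_def)
          with np have H: "real (card (?H w)) \<le> log 2 (real n)" by (simp add: t_def)
          have "real (2 ^ card (?H w)) = 2 powr real (card (?H w))" by (simp add: powr_realpow)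
          also have "\<dots> \<le> 2 powr log 2 (real n)" using H by (intro powr_mono) auto
          also have "\<dots> = real n" using n0 by simp
          finally have H2: "2 ^ card (?H w) \<le> n" by linarith
          let ?F = "{E. \<exists>K. is_clique n E K \<and> (\<forall>i\<in>K. w i \<le> T n) \<and> card K \<ge> 4}"
          have "{E. \<not> succeeds dfs ?q 0 n w E} \<subseteq> ?F"
          proof (rule ccontr)
            assume "\<not> {E. \<not> succeeds dfs ?q 0 n w E} \<subseteq> ?F"
            then obtain E where E: "\<not> succeeds dfs ?q 0 n w E" "E \<notin> ?F" by blast
            have "card {K. is_clique n E K} \<le> 2 ^ card (?H w) * (n + 1) ^ 3"
            proof (rule card_cliques_le)
              fix K assume K: "is_clique n E K" "K \<inter> ?H w = {}"
              have "w i \<le> T n" if i: "i \<in> K" for i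
              proof -
                have "i \<in> {1..n}" using K(1) i unfolding is_clique_def by blast
                moreover have "i \<notin> ?H w" using K(2) i by blast
                ultimately show ?thesis by simp
              qed
              then have "\<not> card K \<ge> 4" using E(2) K(1) by blast
              then show "card K \<le> 3" by simp
            qed auto
            also have "\<dots> \<le> n * (n + 1) ^ 3" using H2 by (rule mult_le_mono1)
            finally have N: "card {K. is_clique n E K} \<le> n * (n + 1) ^ 3" .
            obtain K where K: "outputs_within n w E dfs ((18 * n + 17) * (n + 2) * card {K.
                is_clique n E K} + 4) K"
              "is_clique n E K" "card K = clique_number n E"
              by (rule dfs_correct)
            have "(18 * n + 17) * (n + 2) * card {K. is_clique n E K} + 4 \<le>
                (18 * (n + 1)) * (2 * (n + 1)) * ((n + 1) * (n + 1) ^ 3) + 4 * (n + 1) ^ 6"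
              using N by (intro add_mono mult_le_mono) (auto intro: order_trans)
            also have "\<dots> = 40 * (n + 1) ^ 6"
            proof -
              have "18 * x * (2 * x) * y + 4 * (x * x * y) = 40 * (x * x * y)" for x y :: nat
                by (simp add: algebra_simps)
              moreover have "x ^ 6 = x * x * (x * x ^ 3)" for x :: nat
                by (simp add: eval_nat_numeral)
              ultimately show ?thesis by (simp only:)
            qed
            also have "\<dots> = poly ?q n" by (simp add: poly_power)
            finally have "succeeds dfs ?q 0 n w E"
              unfolding succeeds_def using outputs_within_mono[OF K(1)] K(2,3)
              by (intro exI[of _ K]) simp
            with E(1) show False by contradiction
          qed
          then have "emeasure (measure_pmf (edges_pmf b n w)) {E. \<not> succeeds dfs ?q 0 n w E} \<le>
              emeasure (measure_pmf (edges_pmf b n w)) ?F"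
            by (intro emeasure_mono) auto
          also have "\<dots> \<le> h w"
            unfolding h_def using T C elim(1) by (intro light_clique_prob(1)[OF D b n0 _ _ tail]) auto
          finally show "emeasure (measure_pmf (edges_pmf b n w)) {E. \<not> succeeds dfs ?q 0 n w E} \<le> h w" .
        qed
      qed
    qed
  qed
  show ?thesis
  proof (rule tendsto_sandwich[of "\<lambda>n. 1 - (r n + r' n)" _ _ "\<lambda>_. 1"])
    have "eventually (\<lambda>n::nat. log 2 n - C * ln n powr (1/2) > 0) at_top"
      using C by real_asymp
    with eventually_ge_at_top[of 2] show "eventually (\<lambda>n. 1 - (r n + r' n) \<le> ?P n) sequentially"
      by eventually_elim (rule lower; simp add: mm_def)
    show "eventually (\<lambda>n. ?P n \<le> 1) sequentially"
      by (intro always_eventually allI prob_space.prob_le_1 prob_space_weighted_graph D)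
    have "(\<lambda>n. r n + r' n) \<longlonglongrightarrow> 0"
      unfolding r_def r'_def mm_def T_def using b C by real_asymp
    then show "(\<lambda>n. 1 - (r n + r' n)) \<longlonglongrightarrow> 1"
      using tendsto_diff[OF tendsto_const, of "\<lambda>n. r n + r' n" 0 sequentially 1] by simp
  qed simp
qed

section \<open>Heavy tails\<close>

text \<open>
  The mean number of weights above \<open>sqrt (c * n * ln n)\<close> for a tail of exponent
  \<open>\<alpha> = 2 - 2 * \<kappa>\<close>.
\<close>

lemma count_above_scale:
  fixes a c \<kappa> :: real and n :: nat
  assumes c: "c > 0" and n: "n \<ge> 3"
  shows "real n * (a * sqrt (c * real n * ln (real n)) powr (- (2 - 2 * \<kappa>))) =
    a * c powr (\<kappa> - 1) * real n powr \<kappa> * ln (real n) powr (\<kappa> - 1)"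
proof -
  have ln: "ln (real n) > 0" using n by simp
  have "sqrt (c * real n * ln (real n)) powr (- (2 - 2 * \<kappa>)) =
      (c * real n * ln (real n)) powr (\<kappa> - 1)"
  proof -
    have root: "sqrt (c * real n * ln (real n)) = (c * real n * ln (real n)) powr (1 / 2)"
      using c n ln by (simp add: powr_half_sqrt)
    have exponent: "1 / 2 * - (2 - 2 * \<kappa>) = \<kappa> - 1" by (simp add: field_simps)
    show ?thesis by (simp only: root powr_powr exponent)
  qed
  also have "\<dots> = c powr (\<kappa> - 1) * real n powr (\<kappa> - 1) * ln (real n) powr (\<kappa> - 1)"
    using c n ln by (simp add: powr_mult)
  finally have "real n * (a * sqrt (c * real n * ln (real n)) powr (- (2 - 2 * \<kappa>))) =
      a * c powr (\<kappa> - 1) * (real n * real n powr (\<kappa> - 1)) * ln (real n) powr (\<kappa> - 1)"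
    by (simp add: algebra_simps)
  also have "real n * real n powr (\<kappa> - 1) = real n powr \<kappa>"
    using n by (simp add: powr_diff)
  finally show ?thesis .
qed

text \<open>
  The deterministic part of the comparison. At least about \<open>Np\<close> weights are above the upper
  threshold \<open>Tp\<close>, and few edges are missing between their vertices; at most about \<open>Nm\<close> weights are
  above the lower threshold \<open>Tm\<close>, and the other vertices span no large clique. The factor \<open>7\<close> comes from
  \<open>(1 - 7 * \<eta>) * (1 + 2 * \<eta>) \<le> (1 - 2 * \<eta>)\<^sup>2\<close>.
\<close>

lemma greedy_deterministic:
  fixes Np Nm \<eta> :: real
  assumes \<eta>: "0 < \<eta>" "\<eta> \<le> 1/7" "7 * \<eta> \<le> \<delta>"
    and N: "Nm \<ge> 0" "Np \<ge> (1 - 2 * \<eta>) * Nm"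
    and upper: "real (card {i \<in> {1..n}. w i > Tp}) \<ge> (1 - \<eta>) * Np"
    and lower: "real (card {i \<in> {1..n}. w i > Tm}) \<le> (1 + \<eta>) * Nm"
    and nonedges: "real (card {p \<in> pairs_in {i \<in> {1..n}. w i > Tp}. \<not> E p}) \<le> \<eta> * Np"
    and light: "\<And>K. is_clique n E K \<Longrightarrow> (\<forall>i\<in>K. w i \<le> Tm) \<Longrightarrow> real (card K) \<le> \<eta> * Nm"
  shows "succeeds greedy [:3, 7, 21, 18:] \<delta> n w E"
proof -
  obtain K where K: "outputs_within n w E greedy (18 * n * n * n + 21 * n * n + 7 * n + 3) K"
    "is_clique n E K" "\<And>t. t \<in> {1..n} \<Longrightarrow> beats n w E K t"
    by (rule greedy_correct) blast
  have "real (card {i \<in> {1..n}. w i > Tp}) \<le>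
      real (card K) + real (card {p \<in> pairs_in {i \<in> {1..n}. w i > Tp}. \<not> E p})"
    using beats_upper_set[OF K(3), of Tp] by linarith
  with upper nonedges have "(1 - \<eta>) * Np \<le> real (card K) + \<eta> * Np" by linarith
  then have "(1 - 2 * \<eta>) * Np \<le> real (card K)" by (simp add: algebra_simps)
  moreover have "(1 - 2 * \<eta>) * ((1 - 2 * \<eta>) * Nm) \<le> (1 - 2 * \<eta>) * Np"
    using N(2) \<eta> by (intro mult_left_mono) auto
  ultimately have K_ge: "(1 - 2 * \<eta>) * (1 - 2 * \<eta>) * Nm \<le> real (card K)" by simp
  have "clique_number n E \<le> card {i \<in> {1..n}. w i > Tm} + nat \<lfloor>\<eta> * Nm\<rfloor>"
  proof (rule clique_number_le)
    fix K assume "is_clique n E K" "\<forall>i\<in>K. w i \<le> Tm"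
    from light[OF this] show "card K \<le> nat \<lfloor>\<eta> * Nm\<rfloor>" by (simp add: le_nat_floor)
  qed
  moreover have "real (nat \<lfloor>\<eta> * Nm\<rfloor>) \<le> \<eta> * Nm"
    using N(1) \<eta>(1) by (intro of_nat_floor) simp
  ultimately have "real (clique_number n E) \<le> (1 + \<eta>) * Nm + \<eta> * Nm"
    using lower by linarith
  then have "(1 - 7 * \<eta>) * real (clique_number n E) \<le> (1 - 7 * \<eta>) * ((1 + 2 * \<eta>) * Nm)"
    using \<eta> by (intro mult_left_mono) (auto simp: algebra_simps)
  also have "\<dots> \<le> (1 - 2 * \<eta>) * (1 - 2 * \<eta>) * Nm"
  proof -
    have "(1 - 7 * \<eta>) * (1 + 2 * \<eta>) \<le> (1 - 2 * \<eta>) * (1 - 2 * \<eta>)"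
      using \<eta> by (simp add: algebra_simps)
    then show ?thesis using N(1) by (simp add: mult_right_mono flip: mult.assoc)
  qed
  finally have "(1 - 7 * \<eta>) * real (clique_number n E) \<le> real (card K)" using K_ge by linarith
  moreover have "(1 - \<delta>) * real (clique_number n E) \<le> (1 - 7 * \<eta>) * real (clique_number n E)"
    using \<eta>(3) by (intro mult_right_mono) auto
  ultimately have "(1 - \<delta>) * real (clique_number n E) \<le> real (card K)" by linarith
  moreover have "outputs_within n w E greedy (poly [:3, 7, 21, 18:] n) K"
  proof -
    have "poly [:3, 7, 21, 18:] n = 18 * n * n * n + 21 * n * n + 7 * n + 3"
      by (simp add: algebra_simps)
    with K(1) show ?thesis by (simp only:)
  qed
  ultimately show ?thesis
    unfolding succeeds_def using K(2) by (intro exI[of _ K] conjI)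
qed

text \<open>
  The threshold \<open>T s n\<close> is chosen such that two vertices of this weight are non-adjacent with
  probability \<open>n powr (- \<kappa> * s)\<close>, and \<open>N s n\<close>, which is of order \<open>n powr \<kappa>\<close> up to a logarithmic
  factor, is the mean number of weights above it. For \<open>s = 1 + \<eta>\<close> the mean number of missing edges
  is of smaller order than \<open>N s n\<close>; for \<open>s = 1 - \<eta>\<close> the mean number of missing neighbours that a
  vertex has among \<open>N s n\<close> vertices exceeds every multiple of \<open>ln n\<close>, which excludes cliques of size
  \<open>\<eta> * N s n\<close> among the lighter vertices.
\<close>

lemma greedy_succeeds_whp:
  fixes D :: "real measure"
  assumes D: "prob_space D" "sets D = sets borel" and nonneg: "AE x in D. 0 \<le> x"
    and \<alpha>: "0 < \<alpha>" "\<alpha> < 2" and a: "a > 0" and b: "b > 0"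
    and tail: "\<And>x. x \<ge> x\<^sub>0 \<Longrightarrow> measure D {x<..} = a * x powr (- \<alpha>)"
    and \<delta>: "\<delta> > 0"
  shows "(\<lambda>n. \<P>((w, E) in weighted_graph D b n. succeeds greedy [:3, 7, 21, 18:] \<delta> n w E)) \<longlonglongrightarrow> 1"
proof -
  let ?q = "[:3, 7, 21, 18:] :: nat poly"
  let ?P = "\<lambda>n. \<P>((w, E) in weighted_graph D b n. succeeds greedy ?q \<delta> n w E)"
  define \<eta> where "\<eta> = min (1/7) (\<delta> / 7)"
  have \<eta>: "0 < \<eta>" "\<eta> \<le> 1/7" "7 * \<eta> \<le> \<delta>" "\<eta> < 1" using \<delta> by (auto simp: \<eta>_def)
  define \<kappa> where "\<kappa> = 1 - \<alpha> / 2"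
  have \<kappa>: "0 < \<kappa>" "\<kappa> < 1" "\<alpha> = 2 - 2 * \<kappa>" using \<alpha> by (auto simp: \<kappa>_def)
  define c where "c s = \<kappa> * s / b" for s :: real
  define T where "T s n = sqrt (c s * real n * ln (real n))" for s and n :: nat
  define A where "A s = a * c s powr (\<kappa> - 1)" for s
  define N where "N s n = A s * real n powr \<kappa> * ln (real n) powr (\<kappa> - 1)" for s and n :: nat
  let ?p = "1 + \<eta>" and ?m = "1 - \<eta>"
  have cpos: "c s > 0" if "s > 0" for s using that \<kappa> b by (simp add: c_def)
  have Apos: "A s > 0" if "s > 0" for s using cpos[OF that] a by (simp add: A_def)
  have s: "?p > 0" "?m > 0" using \<eta> by auto
  have ratio: "(1 - 2 * \<eta>) * N ?m n \<le> N ?p n" for n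
  proof -
    define \<rho> where "\<rho> = ?p / ?m"
    have \<rho>: "\<rho> \<ge> 1" using \<eta> by (simp add: \<rho>_def)
    have cp: "c ?p = \<rho> * c ?m" using s by (simp add: c_def \<rho>_def)
    have "1 - 2 * \<eta> \<le> ?m / ?p" using \<eta> by (simp add: field_simps)
    also have "\<dots> = \<rho> powr (- 1)" using \<rho> s by (simp add: \<rho>_def powr_minus)
    also have "\<dots> \<le> \<rho> powr (\<kappa> - 1)" using \<rho> \<kappa> by (intro powr_mono) auto
    finally have "(1 - 2 * \<eta>) * A ?m \<le> \<rho> powr (\<kappa> - 1) * A ?m"
      using Apos[OF s(2)] by (intro mult_right_mono) auto
    also have "\<dots> = A ?p"
      using \<rho> cpos[OF s(2)] by (simp add: A_def cp powr_mult)
    finally have "(1 - 2 * \<eta>) * A ?m * (real n powr \<kappa> * ln (real n) powr (\<kappa> - 1)) \<le>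
        A ?p * (real n powr \<kappa> * ln (real n) powr (\<kappa> - 1))"
      by (intro mult_right_mono) auto
    then show ?thesis by (simp add: N_def mult.assoc)
  qed
  define r where "r n = 1 / (\<eta>\<^sup>2 * N ?p n) + 1 / (\<eta>\<^sup>2 * N ?m n)" for n
  define r' where "r' n = 4 * (N ?p n * exp (- (\<kappa> * ?p * ln (real n)))) / \<eta> + 1 / real n" for n
  have lower: "1 - (r n + r' n) \<le> ?P n"
    if n: "n \<ge> 3" and x0: "T ?p n \<ge> x\<^sub>0" "T ?m n \<ge> x\<^sub>0" and N1: "N ?p n \<ge> 1" "\<eta> * N ?m n \<ge> 1"
      and small: "exp (- (\<kappa> * ?m * ln (real n))) * (\<eta> * N ?m n - 1) / 2 \<ge> 2 * ln (real n)" for n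
  proof -
    let ?M = "\<Pi>\<^sub>M i\<in>{1..n}. D"
    let ?H = "\<lambda>s w. {i \<in> {1..n}. w i \<in> {T s n<..}}"
    define B where "B s = {w \<in> space ?M. \<eta> * N s n \<le> \<bar>real (card (?H s w)) - real n * measure D {T
        s n<..}\<bar>}" for s
    interpret M: prob_space ?M by (intro prob_space_PiM D(1))
    have ln: "ln (real n) > 0" and n0: "n > 0" using n by auto
    have Npos: "N ?p n > 0" "N ?m n > 0"
      using Apos s ln n0 by (auto simp: N_def)
    have np: "real n * measure D {T s n<..} = N s n" if "s > 0" "T s n \<ge> x\<^sub>0" for s
    proof -
      have "measure D {T s n<..} = a * T s n powr (- (2 - 2 * \<kappa>))"
        using tail[OF that(2)] by (simp only: \<kappa>(3))
      then have "real n * measure D {T s n<..} = real n * (a * T s n powr (- (2 - 2 * \<kappa>)))"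
        by (simp only:)
      also have "\<dots> = N s n"
        unfolding T_def N_def A_def using cpos[OF that(1)] n by (rule count_above_scale)
      finally show ?thesis .
    qed
    have B_sets: "B s \<in> sets ?M" for s
    proof -
      have [measurable]: "(\<lambda>w. real (card (?H s w))) \<in> borel_measurable ?M"
        using D(2) by (rule measurable_weight_count) simp
      show ?thesis unfolding B_def by measurable
    qed
    have B_small: "measure ?M (B s) \<le> 1 / (\<eta>\<^sup>2 * N s n)" if "s > 0" "T s n \<ge> x\<^sub>0" "N s n > 0" for s
    proof -
      have "measure ?M (B s) \<le> real n * measure D {T s n<..} / (\<eta> * N s n)\<^sup>2"
        unfolding B_def using that(3) \<eta>(1) by (intro weight_count_deviation[OF D]) auto
      also have "\<dots> = 1 / (\<eta>\<^sup>2 * N s n)"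
        unfolding np[OF that(1,2)] using that(3) \<eta>(1) by (simp add: power2_eq_square field_simps)
      finally show ?thesis .
    qed
    show ?thesis
    proof (rule prob_weighted_graph_ge_outside[OF D sets_succeeds, where B = "B ?p \<union> B ?m" and h =
        "\<lambda>_. ennreal (r' n)"])
      show "B ?p \<union> B ?m \<in> sets ?M" using B_sets by blast
      have "measure ?M (B ?p \<union> B ?m) \<le> measure ?M (B ?p) + measure ?M (B ?m)"
        using B_sets by (intro measure_Un_le)
      also have "\<dots> \<le> r n"
        unfolding r_def using s x0 Npos by (intro add_mono B_small)
      finally show "measure ?M (B ?p \<union> B ?m) \<le> r n" .
      show r'0: "0 \<le> r' n" unfolding r'_def using Npos \<eta> by simp
      show "(\<integral>\<^sup>+ w. ennreal (r' n) \<partial>?M) \<le> ennreal (r' n)"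
          by (simp only: nn_integral_const M.emeasure_space_1 mult_1_right order_refl)
      show "AE w in ?M. w \<notin> B ?p \<union> B ?m \<longrightarrow>
          emeasure (measure_pmf (edges_pmf b n w)) {E. \<not> succeeds greedy ?q \<delta> n w E} \<le> ennreal (r' n)"
        using AE_weights_nonneg[OF D(1) nonneg] AE_space
      proof eventually_elim
        case (elim w)
        show ?case
        proof
          assume w: "w \<notin> B ?p \<union> B ?m"
          have w0: "w i \<ge> 0" if "i \<in> {1..n}" for i using elim(1) that by blast
          let ?Hp = "{i \<in> {1..n}. w i > T ?p n}" and ?Hm = "{i \<in> {1..n}. w i > T ?m n}"
          let ?L = "{i \<in> {1..n}. w i \<le> T ?m n}"
          have Hp: "\<bar>real (card ?Hp) - N ?p n\<bar> < \<eta> * N ?p n"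
            and Hm: "\<bar>real (card ?Hm) - N ?m n\<bar> < \<eta> * N ?m n"
            using w elim(2) np[OF s(1) x0(1)] np[OF s(2) x0(2)] by (auto simp: B_def)
          \<comment> \<open>the least clique size that has to be excluded among the lighter vertices\<close>
          define m where "m = nat \<lceil>\<eta> * N ?m n\<rceil>"
          have m: "m > 0" "\<eta> * N ?m n \<le> real m"
            using N1(2) by (auto simp: m_def)
          let ?F1 = "{E. real (card {p \<in> pairs_in ?Hp. \<not> E p}) \<ge> \<eta> * N ?p n}"
          let ?F2 = "{E. \<exists>K\<subseteq>?L. is_clique n E K \<and> card K \<ge> m}"
          let ?Pr = "measure_pmf.prob (edges_pmf b n w)"
          have T2: "b * (T s n * T s n) / real n = \<kappa> * s * ln (real n)" if "s > 0" for s
          proof -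
            have "T s n * T s n = c s * real n * ln (real n)"
              using cpos[OF that] ln n0 by (simp add: T_def)
            then show ?thesis using n0 b by (simp add: c_def)
          qed
          have "{E. \<not> succeeds greedy ?q \<delta> n w E} \<subseteq> ?F1 \<union> ?F2"
          proof (rule ccontr)
            assume "\<not> {E. \<not> succeeds greedy ?q \<delta> n w E} \<subseteq> ?F1 \<union> ?F2"
            then obtain E where E: "\<not> succeeds greedy ?q \<delta> n w E" "E \<notin> ?F1" "E \<notin> ?F2" by blast
            have "succeeds greedy ?q \<delta> n w E"
            proof (rule greedy_deterministic[OF \<eta>(1-3) _ ratio])
              show "(1 - \<eta>) * N ?p n \<le> real (card ?Hp)" "real (card ?Hm) \<le> (1 + \<eta>) * N ?m n"
                using Hp Hm by (simp_all add: algebra_simps abs_less_iff) 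
              show "real (card {p \<in> pairs_in ?Hp. \<not> E p}) \<le> \<eta> * N ?p n"
                using E(2) by simp
              fix K assume K: "is_clique n E K" "\<forall>i\<in>K. w i \<le> T ?m n"
              have "K \<subseteq> ?L" using K unfolding is_clique_def by blast
              then have "card K < m" using E(3) K(1) by (auto simp: not_le)
              then show "real (card K) \<le> \<eta> * N ?m n" unfolding m_def by linarith
            qed (use Npos in simp)
            with E(1) show False by contradiction
          qed
          then have "?Pr {E. \<not> succeeds greedy ?q \<delta> n w E} \<le> ?Pr (?F1 \<union> ?F2)"
            by (intro measure_pmf.finite_measure_mono) auto
          also have "\<dots> \<le> ?Pr ?F1 + ?Pr ?F2"
            by (intro measure_Un_le) auto
          also have "?Pr ?F1 \<le> real (card ?Hp) ^ 2 * exp (- (\<kappa> * ?p * ln (real n))) / (\<eta> * N ?p n)"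
          proof (rule prob_many_nonedges)
            fix i j assume ij: "i \<in> ?Hp" "j \<in> ?Hp"
            have "T ?p n \<ge> 0" using cpos[OF s(1)] ln by (simp add: T_def)
            then have "T ?p n * T ?p n \<le> w i * w j" using ij by (intro mult_mono) auto
            then have "b * (T ?p n * T ?p n) / real n \<le> b * (w i * w j) / real n"
              using b by (intro divide_right_mono mult_left_mono) auto
            then show "exp (- (b * w i * w j / real n)) \<le> exp (- (\<kappa> * ?p * ln (real n)))"
              unfolding T2[OF s(1)] by (simp add: mult.assoc)
          qed (use b w0 \<eta> Npos in auto)
          also have "\<dots> \<le> (2 * N ?p n) ^ 2 * exp (- (\<kappa> * ?p * ln (real n))) / (\<eta> * N ?p n)"
          proof (intro divide_right_mono mult_right_mono power_mono)
            have "\<eta> * N ?p n \<le> 1 * N ?p n" using \<eta> Npos by (intro mult_right_mono) auto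
            then show "real (card ?Hp) \<le> 2 * N ?p n" using Hp by linarith
          qed (use \<eta> Npos in auto)
          also have "\<dots> = 4 * (N ?p n * exp (- (\<kappa> * ?p * ln (real n)))) / \<eta>"
            using \<eta> Npos by (simp add: power2_eq_square field_simps)
          also have "?Pr ?F2 \<le> exp (real m * (ln (real n) - exp (- (\<kappa> * ?m * ln (real n))) * (real
              m - 1) / 2))"
          proof (rule prob_large_clique)
            fix i j assume ij: "i \<in> ?L" "j \<in> ?L"
            have "T ?m n \<ge> 0" using cpos[OF s(2)] ln by (simp add: T_def)
            then have "w i * w j \<le> T ?m n * T ?m n" using ij w0 by (intro mult_mono) auto
            then have "b * (w i * w j) / real n \<le> b * (T ?m n * T ?m n) / real n"
              using b by (intro divide_right_mono mult_left_mono) auto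
            then show "exp (- (\<kappa> * ?m * ln (real n))) \<le> exp (- (b * w i * w j / real n))"
              unfolding T2[OF s(2)] by (simp add: mult.assoc)
          qed (use b w0 n0 m \<kappa> \<eta> ln in auto)
          also have "\<dots> \<le> exp (- ln (real n))"
          proof -
            let ?g = "exp (- (\<kappa> * ?m * ln (real n)))"
            have "?g * (\<eta> * N ?m n - 1) / 2 \<le> ?g * (real m - 1) / 2"
              using m(2) by (intro divide_right_mono mult_left_mono) auto
            with small have "ln (real n) - ?g * (real m - 1) / 2 \<le> - ln (real n)" by linarith
            then have "real m * (ln (real n) - ?g * (real m - 1) / 2) \<le> real m * (- ln (real n))"
              by (intro mult_left_mono) auto
            also have "\<dots> \<le> 1 * (- ln (real n))"
              using m(1) ln by (intro mult_right_mono_neg) auto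
            finally show ?thesis by simp
          qed
          also have "\<dots> = 1 / real n" using n0 by (simp add: exp_minus divide_inverse)
          finally have "?Pr {E. \<not> succeeds greedy ?q \<delta> n w E} \<le> r' n"
            unfolding r'_def by simp
          then show "emeasure (measure_pmf (edges_pmf b n w)) {E. \<not> succeeds greedy ?q \<delta> n w E} \<le>
              ennreal (r' n)"
            by (simp add: measure_pmf.emeasure_eq_measure ennreal_leI)
        qed
      qed
    qed simp
  qed
  have T_top: "filterlim (T s) at_top sequentially" if "s > 0" for s
    unfolding T_def using cpos[OF that] by real_asymp
  have N_top: "filterlim (N s) at_top sequentially" if "s > 0" for s
    unfolding N_def using Apos[OF that] \<kappa>(1,2) by real_asymp
  show ?thesis
  proof (rule tendsto_sandwich[of "\<lambda>n. 1 - (r n + r' n)" _ _ "\<lambda>_. 1"])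
    have "eventually (\<lambda>n. exp (- (\<kappa> * ?m * ln (real n))) * (\<eta> * N ?m n - 1) / 2 \<ge> 2 * ln (real n))
        sequentially"
      unfolding N_def using Apos[OF s(2)] \<kappa>(1,2) \<eta>(1,4) by real_asymp
    moreover have "eventually (\<lambda>n. T ?p n \<ge> x\<^sub>0) sequentially" "eventually (\<lambda>n.
        T ?m n \<ge> x\<^sub>0) sequentially"
      using T_top s unfolding filterlim_at_top by blast+
    moreover have "eventually (\<lambda>n. N ?p n \<ge> 1) sequentially" "eventually (\<lambda>n.
        N ?m n \<ge> 1 / \<eta>) sequentially"
      using N_top s unfolding filterlim_at_top by blast+
    moreover from this(2) have "eventually (\<lambda>n. \<eta> * N ?m n \<ge> 1) sequentially"
      by eventually_elim (use \<eta>(1) in \<open>simp add: field_simps\<close>)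
    ultimately show "eventually (\<lambda>n. 1 - (r n + r' n) \<le> ?P n) sequentially"
      using eventually_ge_at_top[of 3]
      by eventually_elim (rule lower)
    show "eventually (\<lambda>n. ?P n \<le> 1) sequentially"
      by (intro always_eventually allI prob_space.prob_le_1 prob_space_weighted_graph D)
    have "(\<lambda>n. N ?p n * exp (- (\<kappa> * ?p * ln (real n)))) \<longlonglongrightarrow> 0"
      unfolding N_def using Apos[OF s(1)] \<kappa>(1,2) \<eta>(1) by real_asymp
    from tendsto_add[OF tendsto_divide[OF tendsto_mult_left[OF this, of 4] tendsto_const[of \<eta>]]
        lim_1_over_n]
    have r': "r' \<longlonglongrightarrow> 0" unfolding r'_def using \<eta>(1) by simp
    have inv: "(\<lambda>n. 1 / (\<eta>\<^sup>2 * N s n)) \<longlonglongrightarrow> 0" if "s > 0" for s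
      using \<eta>(1) by (intro real_tendsto_divide_at_top[OF tendsto_const]
        filterlim_tendsto_pos_mult_at_top[OF tendsto_const _ N_top[OF that]]) auto
    have "r \<longlonglongrightarrow> 0"
      unfolding r_def using tendsto_add[OF inv[OF s(1)] inv[OF s(2)]] by simp
    from tendsto_diff[OF tendsto_const tendsto_add[OF this r'], of 1]
    show "(\<lambda>n. 1 - (r n + r' n)) \<longlonglongrightarrow> 1" by simp
  qed simp
qed

text \<open>
  If an event has probability tending to one for every fixed tolerance, it does so for some
  tolerance that tends to zero slowly enough.
\<close>

lemma diagonal_sequence:
  fixes f :: "real \<Rightarrow> nat \<Rightarrow> real"
  assumes lim: "\<And>\<delta>. 0 < \<delta> \<Longrightarrow> f \<delta> \<longlonglongrightarrow> 1" and le1: "\<And>\<delta> n. f \<delta> n \<le> 1"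
  shows "\<exists>\<epsilon>. \<epsilon> \<longlonglongrightarrow> 0 \<and> (\<lambda>n. f (\<epsilon> n) n) \<longlonglongrightarrow> 1"
proof -
  define d where "d k = 1 / real (Suc k)" for k
  have "\<exists>N. \<forall>n\<ge>N. 1 - d k < f (d k) n" for k
  proof -
    have "eventually (\<lambda>n. 1 - d k < f (d k) n) sequentially"
      by (rule order_tendstoD(1)[OF lim]) (auto simp: d_def)
    then show ?thesis by (simp add: eventually_sequentially)
  qed
  then obtain N where N: "\<And>k n. n \<ge> N k \<Longrightarrow> 1 - d k < f (d k) n" by metis
  \<comment> \<open>at \<open>n\<close> the smallest tolerance \<open>d k\<close> is used that is already known to work there\<close>
  define A where "A n = {k. k \<le> n \<and> N k \<le> n}" for n
  define \<epsilon> where "\<epsilon> n = (if A n = {} then 1 else d (Max (A n)))" for n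
  have fin: "finite (A n)" for n by (simp add: A_def)
  have small: "0 < \<epsilon> n \<and> \<epsilon> n \<le> d k \<and> 1 - \<epsilon> n < f (\<epsilon> n) n" if "n \<ge> max k (N k)" for k n
  proof -
    have k: "k \<in> A n" using that by (auto simp: A_def)
    then have M: "Max (A n) \<in> A n" "k \<le> Max (A n)" using fin by (auto intro: Max_in)
    have \<epsilon>: "\<epsilon> n = d (Max (A n))" using k by (auto simp: \<epsilon>_def)
    have "N (Max (A n)) \<le> n" using M(1) by (simp add: A_def)
    from N[OF this] M(2) show ?thesis unfolding \<epsilon> by (auto simp: d_def frac_le)
  qed
  have d0: "d \<longlonglongrightarrow> 0" unfolding d_def by (rule LIMSEQ_Suc[OF lim_1_over_n])
  have \<epsilon>0: "\<epsilon> \<longlonglongrightarrow> 0"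
  proof (rule LIMSEQ_I)
    fix r :: real assume "r > 0"
    then obtain k where "d k < r" using order_tendstoD(2)[OF d0] by (auto simp: eventually_sequentially)
    then have "\<forall>n\<ge>max k (N k). norm (\<epsilon> n - 0) < r" using small by fastforce
    then show "\<exists>no. \<forall>n\<ge>no. norm (\<epsilon> n - 0) < r" by blast
  qed
  have "(\<lambda>n. f (\<epsilon> n) n) \<longlonglongrightarrow> 1"
  proof (rule tendsto_sandwich[of "\<lambda>n. 1 - \<epsilon> n" _ _ "\<lambda>_. 1"])
    show "eventually (\<lambda>n. 1 - \<epsilon> n \<le> f (\<epsilon> n) n) sequentially"
      using small[of 0] unfolding eventually_sequentially
          by (intro exI[of _ "max 0 (N 0)"]) (auto simp: less_imp_le)
    show "(\<lambda>n. 1 - \<epsilon> n) \<longlonglongrightarrow> 1" using tendsto_diff[OF tendsto_const \<epsilon>0, of 1] by simp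
  qed (use le1 in auto)
  with \<epsilon>0 show ?thesis by blast
qed

section \<open>The approximation algorithm\<close>

theorem corollary3:
  fixes \<Omega> :: "'a measure" and W :: "'a \<Rightarrow> real" and \<alpha> a b x\<^sub>0 :: real
  assumes "\<alpha> > 0" and "a > 0" and "b > 0" and "x\<^sub>0 > 0"
    and "prob_space \<Omega>"
    and "W \<in> borel_measurable \<Omega>"
    and "\<And>\<omega>. \<omega> \<in> space \<Omega> \<Longrightarrow> W \<omega> \<ge> 0"
    and "\<And>x. x \<ge> x\<^sub>0 \<Longrightarrow> \<P>(\<omega> in \<Omega>. W \<omega> > x) = a * x powr (- \<alpha>)"
  shows "\<exists>(A :: com) (q :: nat poly) (\<epsilon> :: nat \<Rightarrow> real).
    \<epsilon> \<longlonglongrightarrow> 0 \<and>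
    (\<lambda>n. \<P>((w, E) in weighted_graph (distr \<Omega> borel W) b n.
       \<exists>K. outputs_within n w E A (poly q n) K \<and> is_clique n E K \<and>
           real (card K) \<ge> (1 - \<epsilon> n) * real (clique_number n E)))
    \<longlonglongrightarrow> 1"
proof -
  let ?D = "distr \<Omega> borel W"
  have D: "prob_space ?D" "sets ?D = sets borel"
    using prob_space.prob_space_distr[OF assms(5,6)] by simp_all
  have nonneg: "AE x in ?D. 0 \<le> x"
    using assms(6,7) by (subst AE_distr_iff) auto
  have tail: "measure ?D {x<..} = a * x powr (- \<alpha>)" if "x \<ge> x\<^sub>0" for x
  proof -
    have "measure ?D {x<..} = measure \<Omega> (W -` {x<..} \<inter> space \<Omega>)"
      using assms(6) by (intro measure_distr) auto
    also have "W -` {x<..} \<inter> space \<Omega> = {\<omega> \<in> space \<Omega>. W \<omega> > x}" by auto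
    finally show ?thesis using assms(8)[OF that] by simp
  qed
  have "\<exists>A q \<epsilon>. \<epsilon> \<longlonglongrightarrow> 0 \<and>
      (\<lambda>n. \<P>((w, E) in weighted_graph ?D b n. succeeds A q (\<epsilon> n) n w E)) \<longlonglongrightarrow> 1"
  proof (cases "\<alpha> < 2")
    case True
    have "\<exists>\<epsilon>. \<epsilon> \<longlonglongrightarrow> 0 \<and>
        (\<lambda>n. \<P>((w, E) in weighted_graph ?D b n. succeeds greedy [:3, 7, 21, 18:] (\<epsilon> n) n w E)) \<longlonglongrightarrow> 1"
      by (rule diagonal_sequence[OF greedy_succeeds_whp[OF D nonneg assms(1) True assms(2,3) tail]])
        (auto intro!: prob_space.prob_le_1 prob_space_weighted_graph D)
    then show ?thesis by blast
  next
    case False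
    then obtain C where "C > 0" "\<And>x. x \<ge> 0 \<Longrightarrow> measure ?D {x<..} \<le> C / (x + 1)\<^sup>2"
      using quadratic_tail[OF D(1) _ assms(2,4) tail] by (metis not_less)
    from dfs_succeeds_whp[OF D nonneg assms(3) this] show ?thesis
      by (intro exI[of _ dfs] exI[of _ "smult 40 ([:1, 1:] ^ 6)"] exI[of _ "\<lambda>_. 0"]) auto
  qed
  then show ?thesis unfolding succeeds_def .
qed

end
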